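(* Let $T=T((m_1,1),\dots,(m_k,1);0)$ and $T'=T((n_1,1),\dots,(n_l,1);0)$ for some $k,l\ge 2$ (so $m_1<\dots<m_k$ and $n_1<\dots<n_l$). Suppose $\mathbb{G}(T)$ and $\mathbb{G}(T')$ are commensurable. Then $k=l$ and $$\frac{n_1}{m_1}=\frac{n_2}{m_2}=\dots=\frac{n_k}{m_k}.$$ Moreover, if $S=T((m,2);0)$ for some $m\ge2$, then $\mathbb{G}(S)$ and $\mathbb{G}(T')$ are not commensurable.
   Context: For a finite simplicial graph $\Gamma$, $\mathbb{G}(\Gamma)$ is the right-angled Artin group with generators the vertices of $\Gamma$ and relations $[u,v]=1$ for each edge. Two groups are commensurable if they have isomorphic finite index subgroups. Encoding of trees of diameter 4: in a finite tree of diameter 4 the middle vertex of any path of length 4 is the same vertex $c$, the center; leaves adjacent to $c$ are hair vertices; other neighbours of $c$ are pivots. $T((d_1,k_1),\dots,(d_l,k_l);q)$ is the tree of diameter 4 with exactly $q\ge0$ hair vertices and, for each $i$, exactly $k_i$ pivots adjacent to exactly $d_i$ leaves, where $l,d_i,k_i$ are positive integers, $d_1<\dots<d_l$, and either $l\ge2$ or ($l=1$ and $k_1\ge2$). *)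

theory Defs
  imports "HOL-Algebra.Algebra"
begin

text \<open>A finite simplicial graph is given by a vertex set V and a symmetric
  irreflexive edge relation E. Words in the generators and their inverses are
  lists of pairs (v, s), where s = True means v and s = False means v^-1.\<close>

type_synonym 'v word = "('v \<times> bool) list"

inductive raag_eq :: "('v \<Rightarrow> 'v \<Rightarrow> bool) \<Rightarrow> 'v word \<Rightarrow> 'v word \<Rightarrow> bool"
  for E :: "'v \<Rightarrow> 'v \<Rightarrow> bool" where
  refl: "raag_eq E w w"
| sym: "raag_eq E w w' \<Longrightarrow> raag_eq E w' w"
| trans: "raag_eq E w w' \<Longrightarrow> raag_eq E w' w'' \<Longrightarrow> raag_eq E w w''"
| cancel: "raag_eq E (xs @ [(v, b), (v, \<not> b)] @ ys) (xs @ ys)"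
| commute: "E u v \<Longrightarrow> raag_eq E (xs @ [(u, a), (v, b)] @ ys) (xs @ [(v, b), (u, a)] @ ys)"

definition raag_class :: "('v \<Rightarrow> 'v \<Rightarrow> bool) \<Rightarrow> 'v word \<Rightarrow> 'v word set" where
  "raag_class E w = {w'. raag_eq E w w'}"

definition RAAG :: "'v set \<Rightarrow> ('v \<Rightarrow> 'v \<Rightarrow> bool) \<Rightarrow> 'v word set monoid" where
  "RAAG V E = \<lparr> carrier = raag_class E ` {w. set w \<subseteq> V \<times> UNIV},
               monoid.mult = (\<lambda>A B. (\<Union>x\<in>A. (\<Union>y\<in>B. raag_class E (x @ y)))),
               monoid.one = raag_class E [] \<rparr>"

definition commensurable :: "('a, 'c) monoid_scheme \<Rightarrow> ('b, 'd) monoid_scheme \<Rightarrow> bool" where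
  "commensurable G G' \<longleftrightarrow>
     (\<exists>H H'. subgroup H G \<and> subgroup H' G' \<and>
        finite (rcosets\<^bsub>G\<^esub> H) \<and> finite (rcosets\<^bsub>G'\<^esub> H') \<and>
        G\<lparr>carrier := H\<rparr> \<cong> G'\<lparr>carrier := H'\<rparr>)"

datatype tvert = Center | Hair nat | Pivot nat nat | Leaf nat nat nat

text \<open>tree_V ps q / tree_E ps q: the tree T((d_1,k_1),...,(d_l,k_l); q) where
  ps = [(d_1,k_1),...,(d_l,k_l)]. Pivot i a (a < k_i) is the a-th pivot of type i,
  Leaf i a b (b < d_i) its leaves, Hair j (j < q) the hair vertices.\<close>
definition tree_V :: "(nat \<times> nat) list \<Rightarrow> nat \<Rightarrow> tvert set" where
  "tree_V ps q = {Center} \<union> {Hair j | j. j < q}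
     \<union> {Pivot i a | i a. i < length ps \<and> a < snd (ps ! i)}
     \<union> {Leaf i a b | i a b. i < length ps \<and> a < snd (ps ! i) \<and> b < fst (ps ! i)}"

definition tree_E0 :: "(nat \<times> nat) list \<Rightarrow> nat \<Rightarrow> tvert \<Rightarrow> tvert \<Rightarrow> bool" where
  "tree_E0 ps q x y \<longleftrightarrow>
     (x = Center \<and> (\<exists>j < q. y = Hair j)) \<or>
     (x = Center \<and> (\<exists>i a. i < length ps \<and> a < snd (ps ! i) \<and> y = Pivot i a)) \<or>
     (\<exists>i a b. i < length ps \<and> a < snd (ps ! i) \<and> b < fst (ps ! i) \<and>
        x = Pivot i a \<and> y = Leaf i a b)"

definition tree_E :: "(nat \<times> nat) list \<Rightarrow> nat \<Rightarrow> tvert \<Rightarrow> tvert \<Rightarrow> bool" where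
  "tree_E ps q x y \<longleftrightarrow> tree_E0 ps q x y \<or> tree_E0 ps q y x"

definition tree_RAAG :: "(nat \<times> nat) list \<Rightarrow> nat \<Rightarrow> tvert word set monoid" where
  "tree_RAAG ps q = RAAG (tree_V ps q) (tree_E ps q)"

end

theory Submission
  imports Defs
begin

text \<open>All the groups embed into the group of one infinite tree. Removing one of the two colour classes
  A of that tree presents the group as a free group on conjugates of the A-generators, extended by the
  free group on the other class, which permutes this basis; the reduced words form a tree on which
  the group acts. Using both trees, a nontrivial element with non-abelian centralizer must be conjugate
  to a power of an interior vertex (the center or a pivot), so a finite index subgroup H remembers the
  cyclic subgroups of its Bass-Serre tree. Let X be minus the Euler characteristic of the vertex
  groups of H modulo their centers, and for an edge let iota be the index in the edge group of the
  product of the two centers; both are invariants of H. If zeta is the index of the center of a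
  vertex group of H in that of the ambient vertex group, then for every vertex c of H with image v
  and every neighbour u of v the sum of zeta d / iota (c, d) over the neighbours d of c with
  image u is X c / chi v, where chi v + 1 is the degree of v. Two ambient groups give two solutions of
  these equations; pairing them shows that either the numbers of leaves at the pivots are mutual
  weighted averages of each other up to a common factor, hence proportional, or the two colour
  classes are interchanged and all pivots have equally many leaves.\<close>

section \<open>Subgroups, cosets and length functions in additive groups\<close>

text \<open>An isomorphism of H knows nothing of the ambient graph, so everything compared must be
  expressible inside H: vertices are subgroups, edges are pairs of them, and the rank of a free
  quotient is read off from the number of its homomorphisms to a group of order two. Two trees are
  needed because in one tree an element without fixed vertex only makes the commutators of its
  centralizer elliptic; a commutator elliptic in both trees is killed by a retraction. The local
  equations count cosets of H: zeta X c / chi v of them lie over a vertex class c and zeta c zeta d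
  / iota over an edge class (c, d); distributing the former over the edges towards u and cancelling
  zeta c gives the equation. Pairing two solutions means to weight an edge by zeta' of its source
  times zeta of its target over iota, and to evaluate the sum by one solution at the sources and by
  the other at the targets. What gets averaged are the reciprocals of the leaf numbers. Pivots with
  equally many leaves are ruled out at the end because the n_i increase strictly.\<close>

lemmas group_norm = add.assoc minus_add diff_conv_add_uminus minus_minus minus_add_cancel
  add_minus_cancel left_minus right_minus add_0_left add_0_right minus_zero

text \<open>\<open>group_norm\<close> turns differences into sums with inverses; the default rule in
  the other direction would make this loop.\<close>

declare add_uminus_conv_diff [simp del]

definition subgrp :: "'a::group_add set \<Rightarrow> bool" where
  "subgrp K \<longleftrightarrow> 0 \<in> K \<and> (\<forall>x\<in>K. \<forall>y\<in>K. x + y \<in> K) \<and> (\<forall>x\<in>K. - x \<in> K)"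

definition conj_set :: "'a::group_add \<Rightarrow> 'a set \<Rightarrow> 'a set" where
  "conj_set g S = (\<lambda>x. g + x - g) ` S"

definition cent :: "'a::group_add set \<Rightarrow> 'a \<Rightarrow> 'a set" where
  "cent H z = {x \<in> H. x + z = z + x}"

definition center :: "'a::group_add set \<Rightarrow> 'a set" where
  "center C = {z \<in> C. \<forall>x\<in>C. x + z = z + x}"

definition set_sum :: "'a::group_add set \<Rightarrow> 'a set \<Rightarrow> 'a set" where
  "set_sum A B = {a + b | a b. a \<in> A \<and> b \<in> B}"

definition rcoset :: "'a::group_add set \<Rightarrow> 'a \<Rightarrow> 'a set" where
  "rcoset K s = (\<lambda>k. k + s) ` K"

text \<open>\<open>K\<close> need not lie in \<open>S\<close>: for two subgroups this is the index
  of their intersection in \<open>S\<close>, with 0 standing for an infinite index.\<close>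

definition ncosets :: "'a::group_add set \<Rightarrow> 'a set \<Rightarrow> nat" where
  "ncosets K S = card (rcoset K ` S)"

primrec nmul :: "nat \<Rightarrow> 'a::group_add \<Rightarrow> 'a" where
  "nmul 0 x = 0"
| "nmul (Suc n) x = x + nmul n x"

lemma subgrpI:
  assumes "0 \<in> K" "\<And>x y. x \<in> K \<Longrightarrow> y \<in> K \<Longrightarrow> x + y \<in> K" "\<And>x. x \<in> K \<Longrightarrow> - x \<in> K"
  shows "subgrp K"
  using assms by (auto simp: subgrp_def)

lemma subgrp_zero: "subgrp K \<Longrightarrow> 0 \<in> K"
  and subgrp_add: "subgrp K \<Longrightarrow> x \<in> K \<Longrightarrow> y \<in> K \<Longrightarrow> x + y \<in> K"
  and subgrp_minus: "subgrp K \<Longrightarrow> x \<in> K \<Longrightarrow> - x \<in> K"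
  by (auto simp: subgrp_def)

lemma subgrp_diff: "subgrp K \<Longrightarrow> x \<in> K \<Longrightarrow> y \<in> K \<Longrightarrow> x - y \<in> K"
  by (metis diff_conv_add_uminus subgrp_add subgrp_minus)

lemmas subgrp_closed = subgrp_zero subgrp_add subgrp_minus subgrp_diff

lemma subgrp_nmul: "subgrp K \<Longrightarrow> x \<in> K \<Longrightarrow> nmul n x \<in> K"
  by (induction n) (auto intro: subgrp_closed)

lemma subgrp_Int: "subgrp K \<Longrightarrow> subgrp L \<Longrightarrow> subgrp (K \<inter> L)"
  by (auto simp: subgrp_def)

lemma subgrp_add_cancel_left: "subgrp K \<Longrightarrow> x \<in> K \<Longrightarrow> x + y \<in> K \<longleftrightarrow> y \<in> K"
  by (metis minus_add_cancel subgrp_add subgrp_minus)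

lemma subgrp_add_cancel_right: "subgrp K \<Longrightarrow> y \<in> K \<Longrightarrow> x + y \<in> K \<longleftrightarrow> x \<in> K"
  by (metis add_diff_cancel subgrp_add subgrp_diff)

lemma mem_conj_set: "x \<in> conj_set g S \<longleftrightarrow> - g + x + g \<in> S"
proof
  assume "- g + x + g \<in> S"
  moreover have "x = g + (- g + x + g) - g" by (simp add: group_norm)
  ultimately show "x \<in> conj_set g S" unfolding conj_set_def by blast
qed (auto simp: conj_set_def group_norm)

lemma conj_set_add: "conj_set (g + h) S = conj_set g (conj_set h S)"
  by (auto simp: mem_conj_set group_norm)

lemma conj_set_zero [simp]: "conj_set 0 S = S"
  by (auto simp: mem_conj_set)

lemma conj_set_Int: "conj_set g (S \<inter> T) = conj_set g S \<inter> conj_set g T"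
  by (auto simp: mem_conj_set)

lemma conj_set_inverse [simp]: "conj_set (- g) (conj_set g S) = S" "conj_set g (conj_set (- g) S) = S"
  by (simp_all flip: conj_set_add)

lemma subgrp_conj_set:
  assumes "subgrp S" shows "subgrp (conj_set g S)"
proof (rule subgrpI)
  show "x + y \<in> conj_set g S" if "x \<in> conj_set g S" "y \<in> conj_set g S" for x y
    using subgrp_add[OF assms that[unfolded mem_conj_set]] by (simp add: mem_conj_set group_norm)
  show "- x \<in> conj_set g S" if "x \<in> conj_set g S" for x
    using subgrp_minus[OF assms that[unfolded mem_conj_set]] by (simp add: mem_conj_set group_norm)
qed (use assms in \<open>auto simp: mem_conj_set subgrp_zero\<close>)

lemma conj_set_subgrp:
  assumes "subgrp S" "g \<in> S" shows "conj_set g S = S"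
  using assms by (auto simp: mem_conj_set subgrp_add_cancel_left subgrp_add_cancel_right subgrp_minus)

lemma commute_minus: "x + y = y + x \<Longrightarrow> - x + y = y + - (x::'a::group_add)"
proof -
  assume "x + y = y + x"
  have "- x + y = - x + (y + x) + - x" by (simp add: group_norm)
  also have "\<dots> = y + - x" by (simp flip: \<open>x + y = y + x\<close> add: group_norm)
  finally show ?thesis .
qed

lemma commute_add: "x + z = z + x \<Longrightarrow> y + z = z + y \<Longrightarrow> (x + y) + z = z + (x + (y::'a::group_add))"
  by (metis add.assoc)

lemma subgrp_cent:
  assumes "subgrp H" shows "subgrp (cent H z)"
proof (rule subgrpI)
  fix x y assume xy: "x \<in> cent H z" "y \<in> cent H z"
  then have "(x + y) + z = z + (x + y)" unfolding cent_def by (blast intro: commute_add)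
  then show "x + y \<in> cent H z" using xy assms by (simp add: cent_def subgrp_add)
next
  fix x assume x: "x \<in> cent H z"
  then have "- x + z = z + - x" unfolding cent_def by (blast intro: commute_minus)
  then show "- x \<in> cent H z" using x assms by (simp add: cent_def subgrp_minus)
qed (use assms in \<open>simp add: cent_def subgrp_zero\<close>)

lemma center_eq_cent: "center C = {z \<in> C. \<forall>x\<in>C. z \<in> cent C x}"
  by (auto simp: center_def cent_def)

lemma subgrp_center:
  assumes "subgrp C" shows "subgrp (center C)"
  using assms subgrp_cent[OF assms] unfolding center_eq_cent subgrp_def by blast

lemma subgrp_UNIV: "subgrp UNIV" by (simp add: subgrp_def)

lemma nmul_add: "nmul (m + n) x = nmul m x + nmul n x"
  by (induction m) (auto simp: add.assoc)

lemma nmul_commute: "x + z = z + x \<Longrightarrow> nmul n x + z = z + nmul n (x::'a::group_add)"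
  by (induction n) (auto simp: commute_add)

lemma nmul_conj: "nmul n (g + x - g) = g + nmul n x - (g::'a::group_add)"
  by (induction n) (auto simp: group_norm)

lemma mem_rcoset: "x \<in> rcoset K s \<longleftrightarrow> x - s \<in> K"
proof
  assume "x - s \<in> K"
  moreover have "x = (x - s) + s" by simp
  ultimately show "x \<in> rcoset K s" unfolding rcoset_def by blast
qed (auto simp: rcoset_def)

lemma rcoset_eq_iff: "subgrp K \<Longrightarrow> rcoset K s = rcoset K t \<longleftrightarrow> s - t \<in> K"
proof
  assume K: "subgrp K" and eq: "rcoset K s = rcoset K t"
  have "s \<in> rcoset K s" using K by (simp add: mem_rcoset subgrp_zero)
  then show "s - t \<in> K" using eq by (simp add: mem_rcoset)
next
  assume K: "subgrp K" and st: "s - t \<in> K"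
  have "x - s \<in> K \<longleftrightarrow> x - t \<in> K" for x
  proof -
    have "x - t = (x - s) + (s - t)" by (simp add: group_norm)
    then show ?thesis using subgrp_add_cancel_right[OF K st] by metis
  qed
  then show "rcoset K s = rcoset K t" by (auto simp: mem_rcoset)
qed

lemma rcoset_absorb: "subgrp K \<Longrightarrow> k \<in> K \<Longrightarrow> rcoset K (k + s) = rcoset K s"
  by (simp add: rcoset_eq_iff group_norm)

text \<open>Indices in different groups are compared through this, with \<open>f\<close> and
  \<open>g\<close> sending elements to their cosets; the map \<open>f x\<close> to
  \<open>g x\<close> is a well defined bijection.\<close>

lemma card_image_eq_of_kernel:
  assumes "\<And>x y. x \<in> S \<Longrightarrow> y \<in> S \<Longrightarrow> f x = f y \<longleftrightarrow> g x = g y"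
  shows "card (f ` S) = card (g ` S)"
proof (rule bij_betw_same_card)
  define h where "h = (\<lambda>y. g (SOME x. x \<in> S \<and> f x = y))"
  have h: "h (f x) = g x" if "x \<in> S" for x
  proof -
    have "\<exists>x'. x' \<in> S \<and> f x' = f x" using that by blast
    from someI_ex[OF this] show ?thesis unfolding h_def using assms that by blast
  qed
  show "bij_betw h (f ` S) (g ` S)"
    unfolding bij_betw_def inj_on_def using h assms by (force simp: image_image)
qed

lemma ncosets_cong:
  assumes "subgrp K" "subgrp L" "subgrp S" "K \<inter> S = L \<inter> S"
  shows "ncosets K S = ncosets L S"
  unfolding ncosets_def
proof (rule card_image_eq_of_kernel)
  fix x y assume "x \<in> S" "y \<in> S"
  then have "x - y \<in> S" using assms(3) by (simp add: subgrp_diff)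
  then show "rcoset K x = rcoset K y \<longleftrightarrow> rcoset L x = rcoset L y"
    using assms by (auto simp: rcoset_eq_iff)
qed

text \<open>Each coset of \<open>A\<close> in \<open>S\<close> arises exactly once by translating a
  coset of \<open>A\<close> in \<open>B\<close> by a fixed representative of a coset of
  \<open>B\<close> in \<open>S\<close>.\<close>

lemma ncosets_tower:
  assumes A: "subgrp A" and B: "subgrp B" and S: "subgrp S" and "A \<subseteq> B" "B \<subseteq> S"
  shows "ncosets A S = ncosets A B * ncosets B S"
proof -
  define r where "r = (\<lambda>q. SOME s. s \<in> S \<and> rcoset B s = q)"
  have r: "r q \<in> S" "rcoset B (r q) = q" if "q \<in> rcoset B ` S" for q
  proof -
    have "\<exists>s. s \<in> S \<and> rcoset B s = q" using that by blast
    from someI_ex[OF this] show "r q \<in> S" "rcoset B (r q) = q" unfolding r_def by blast+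
  qed
  define f where "f = (\<lambda>(p, q). (\<lambda>x. x + r q) ` p)"
  have f: "f (rcoset A b, q) = rcoset A (b + r q)" for b q
    by (auto simp: f_def rcoset_def image_image add.assoc)
  have "inj_on f (rcoset A ` B \<times> rcoset B ` S)"
  proof (rule inj_onI, clarify)
    fix b s b' s' assume *: "b \<in> B" "s \<in> S" "b' \<in> B" "s' \<in> S"
      and "f (rcoset A b, rcoset B s) = f (rcoset A b', rcoset B s')"
    then have a: "(b + r (rcoset B s)) - (b' + r (rcoset B s')) \<in> A"
      using A by (simp add: f rcoset_eq_iff)
    have "rcoset B (b + r (rcoset B s)) = rcoset B (b' + r (rcoset B s'))"
      using a assms rcoset_eq_iff by blast
    then have eq: "rcoset B s = rcoset B s'"
      using * B r by (simp add: rcoset_absorb)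
    with a have "b - b' \<in> A" by (simp add: group_norm)
    with eq show "rcoset A b = rcoset A b' \<and> rcoset B s = rcoset B s'"
      using A by (simp add: rcoset_eq_iff)
  qed
  moreover have "f ` (rcoset A ` B \<times> rcoset B ` S) = rcoset A ` S"
  proof (intro equalityI subsetI)
    fix q assume "q \<in> f ` (rcoset A ` B \<times> rcoset B ` S)"
    then obtain b s where bs: "b \<in> B" "s \<in> S" "q = f (rcoset A b, rcoset B s)" by auto
    then have "b + r (rcoset B s) \<in> S" using S assms r by (meson imageI subgrp_add subsetD)
    then show "q \<in> rcoset A ` S" using bs f by auto
  next
    fix q assume "q \<in> rcoset A ` S"
    then obtain s where s: "s \<in> S" "q = rcoset A s" by blast
    let ?t = "r (rcoset B s)"
    have "rcoset B ?t = rcoset B s" using s r by blast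
    then have "s - ?t \<in> B" using B by (metis rcoset_eq_iff)
    moreover have "q = f (rcoset A (s - ?t), rcoset B s)" using s f by simp
    ultimately show "q \<in> f ` (rcoset A ` B \<times> rcoset B ` S)" using s by blast
  qed
  ultimately have "card (rcoset A ` S) = card (rcoset A ` B \<times> rcoset B ` S)"
    by (metis card_image)
  then show ?thesis by (simp add: ncosets_def card_cartesian_product)
qed

text \<open>Left summands from \<open>K\<close> do not change cosets of \<open>K\<close>. Together
  with \<open>ncosets_tower\<close> this supplies the index formula of the second isomorphism
  theorem.\<close>

lemma ncosets_set_sum:
  assumes "subgrp K" "T \<subseteq> K" "0 \<in> T"
  shows "ncosets K (set_sum T R) = ncosets K R"
proof -
  have "rcoset K ` set_sum T R = rcoset K ` R"
  proof (intro equalityI subsetI)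
    fix q assume "q \<in> rcoset K ` set_sum T R"
    then obtain t r where "t \<in> T" "r \<in> R" "q = rcoset K (t + r)" by (auto simp: set_sum_def)
    then show "q \<in> rcoset K ` R" using assms rcoset_absorb by blast
  next
    fix q assume "q \<in> rcoset K ` R"
    moreover have "R \<subseteq> set_sum T R" using assms(3) by (force simp: set_sum_def)
    ultimately show "q \<in> rcoset K ` set_sum T R" by blast
  qed
  then show ?thesis by (simp add: ncosets_def)
qed

lemma finite_rcosets_mono:
  assumes "finite (rcoset K ` S)" "subgrp K" "subgrp L" "K \<subseteq> L"
  shows "finite (rcoset L ` S)"
proof -
  have "rcoset L ` S \<subseteq> (\<lambda>q. rcoset L (SOME x. x \<in> q)) ` (rcoset K ` S)"
  proof clarify
    fix s assume "s \<in> S"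
    have "s \<in> rcoset K s" using assms by (simp add: mem_rcoset subgrp_zero)
    then have "(SOME x. x \<in> rcoset K s) \<in> rcoset K s" by (metis someI)
    then have "(SOME x. x \<in> rcoset K s) - s \<in> L" using assms by (auto simp: mem_rcoset)
    then have "- ((SOME x. x \<in> rcoset K s) - s) \<in> L" using assms by (simp add: subgrp_minus del: minus_diff_eq)
    then have "rcoset L s = rcoset L (SOME x. x \<in> rcoset K s)" using assms by (simp add: rcoset_eq_iff)
    then show "rcoset L s \<in> (\<lambda>q. rcoset L (SOME x. x \<in> q)) ` (rcoset K ` S)" using \<open>s \<in> S\<close> by blast
  qed
  then show ?thesis using assms(1) finite_surj by blast
qed

lemma rcoset_conj_set: "rcoset (conj_set g K) s = (\<lambda>x. g + x) ` rcoset K (- g + s)"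
proof -
  have "x - s \<in> conj_set g K \<longleftrightarrow> x \<in> (\<lambda>x. g + x) ` rcoset K (- g + s)" for x
  proof -
    have "x \<in> (\<lambda>x. g + x) ` rcoset K (- g + s) \<longleftrightarrow> - g + x \<in> rcoset K (- g + s)"
      by (metis (no_types, lifting) add_minus_cancel image_iff minus_add_cancel)
    then show ?thesis by (simp add: mem_rcoset mem_conj_set group_norm)
  qed
  then show ?thesis by (auto simp: mem_rcoset)
qed

text \<open>Pigeonhole on the cosets of the multiples of x.\<close>
lemma exists_multiple_in_finite_index:
  assumes K: "subgrp K" and fin: "finite (rcoset K ` S)" and S: "subgrp S" and x: "x \<in> S"
  shows "\<exists>n>0. nmul n x \<in> K"
proof -
  have "\<not> inj_on (\<lambda>n. rcoset K (nmul n x)) UNIV"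
  proof
    assume "inj_on (\<lambda>n. rcoset K (nmul n x)) UNIV"
    moreover have "range (\<lambda>n. rcoset K (nmul n x)) \<subseteq> rcoset K ` S"
      using S x by (auto intro: subgrp_nmul)
    ultimately show False using fin by (meson finite_imageD finite_subset infinite_UNIV_nat)
  qed
  then obtain m n where "m < n" "rcoset K (nmul n x) = rcoset K (nmul m x)"
    unfolding inj_on_def by (metis linorder_neq_iff)
  then have "nmul n x - nmul m x \<in> K" using K by (simp add: rcoset_eq_iff)
  moreover have "nmul n x = nmul (n - m) x + nmul m x"
    using \<open>m < n\<close> by (metis le_add_diff_inverse2 less_imp_le nmul_add)
  ultimately show ?thesis using \<open>m < n\<close> by (metis add_diff_cancel zero_less_diff)
qed

text \<open>\<open>N x\<close> models the distance in a tree between a base point and its translate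
  by \<open>x\<close>, so that \<open>N (- x + y)\<close> is the distance of two points of the
  orbit. \<open>four_point\<close> is Gromov's condition for 0-hyperbolicity.\<close>

locale length_function =
  fixes N :: "'a::group_add \<Rightarrow> int"
  assumes N_zero [simp]: "N 0 = 0"
    and N_minus [simp]: "N (- x) = N x"
    and N_nonneg: "0 \<le> N x"
    and four_point: "N (- x + y) + N (- z + w) \<le> max (N (- x + z) + N (- y + w)) (N (- x + w) + N (- y + z))"
begin

definition D :: "'a \<Rightarrow> 'a \<Rightarrow> int" where "D x y = N (- x + y)"

lemma D_sym: "D x y = D y x"
proof -
  have "- (- x + y) = - y + x" by (simp only: group_norm)
  then show ?thesis unfolding D_def by (metis N_minus)
qed

lemma D_self [simp]: "D x x = 0"
  and D_nonneg: "0 \<le> D x y"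
  and D_zero_left [simp]: "D 0 x = N x"
  by (simp_all add: D_def N_nonneg)

lemma D_zero_right [simp]: "D x 0 = N x"
  by (simp add: D_sym[of x 0])

lemma D_shift: "D (g + x) (g + y) = D x y"
  by (simp add: D_def group_norm)

lemma four_point_D: "D x y + D z w \<le> max (D x z + D y w) (D x w + D y z)"
  using four_point[of x y z w] by (simp add: D_def)

text \<open>The four points can be split into two pairs in three ways. By 0-hyperbolicity the two
  largest of the three distance sums coincide, so if one sum is strictly smaller than another, the
  third equals the larger one.\<close>

lemma two_largest_equal:
  assumes "D x z + D y w < D x y + D z w"
  shows "D x w + D y z = D x y + D z w"
  using four_point_D[of x y z w] four_point_D[of x w y z] four_point_D[of x z y w] assms
  by (auto simp: D_sym max_def split: if_splits)

text \<open>If N grows linearly on the multiples of z, then z translates an axis through the base point;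
  s measures the signed translation of the elements commuting with z along that axis.\<close>
theorem translation_exists:
  assumes t: "t > 0" and axis: "\<And>k. N (nmul k z) = int k * t"
  obtains s :: "'a \<Rightarrow> int" where
    "\<And>x. x + z = z + x \<Longrightarrow> \<bar>s x\<bar> = N x"
    "\<And>x y. x + z = z + x \<Longrightarrow> y + z = z + y \<Longrightarrow> s (x + y) = s x + s y"
    "s z = t"
proof -
  let ?C = "{x. x + z = z + x}"
  let ?z = "\<lambda>k. nmul k z"
  \<comment> \<open>\<open>f k x\<close> is the distance from \<open>- ?z k\<close> to
    \<open>x\<close> minus that from \<open>- ?z k\<close> to 0: an approximation to the Busemann
    function of the repelling end of the axis.\<close>
  define f where "f = (\<lambda>k x. N (?z k + x) - int k * t)"
  have zcomm: "?z k + x = x + ?z k" if "x \<in> ?C" for k x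
    using nmul_commute[of z x k] that by simp
  have large: "N x < int k * t" if "nat (N x) < k" for x k
  proof -
    have "N x < int k" using that by linarith
    also have "int k \<le> int k * t" using t by (simp add: mult_le_cancel_left1)
    finally show ?thesis .
  qed
  have D1: "D x (?z k) = int k * t - f k x" if x: "x \<in> ?C" and k: "nat (N x) < k" for x k
  proof -
    have e: "D (?z k) (?z k + x) = N x" "D x (?z k + x) = int k * t"
      unfolding zcomm[OF x] using axis by (simp add: D_def group_norm flip: zcomm[OF x], simp add: D_def)
    have "D 0 (?z k + x) + D x (?z k) = D 0 (?z k) + D x (?z k + x)"
      using two_largest_equal[of 0 x "?z k" "?z k + x"] e large[OF k] axis[of k] by (simp add: D_sym mult.commute)
    then show ?thesis using e axis by (simp add: f_def)
  qed
  have D2: "D x (- ?z k) = int k * t + f k x" if x: "x \<in> ?C" for x k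
  proof -
    have "D x (- ?z k) = D (?z k + x) 0" using D_shift[of "?z k" x "- ?z k"] by (simp add: group_norm)
    then show ?thesis by (simp add: f_def)
  qed
  \<comment> \<open>By \<open>D1\<close> and \<open>D2\<close> both points lie on the geodesic from
    \<open>- ?z k\<close> to \<open>?z k\<close>, where \<open>f k\<close> is a coordinate.\<close>
  have D3: "D x y = \<bar>f k x - f k y\<bar>" 
    if x: "x \<in> ?C" "nat (N x) < k" and y: "y \<in> ?C" "nat (N y) < k" for x y k
  proof -
    have e: "D (?z k) (- ?z k) = 2 * (int k * t)"
    proof -
      have "D (?z k) (- ?z k) = D (?z k + ?z k) 0" using D_shift[of "?z k" "?z k" "- ?z k"] by simp
      also have "\<dots> = int (k + k) * t" using axis[of "k + k"] by (simp add: nmul_add)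
      finally show ?thesis by (simp add: algebra_simps)
    qed
    have n: "0 \<le> D x y" by (rule D_nonneg)
    show ?thesis
      using four_point_D[of x y "?z k" "- ?z k"] four_point_D[of x "?z k" y "- ?z k"]
        four_point_D[of x "- ?z k" y "?z k"] n
        D1[OF x] D1[OF y] D2[OF x(1)] D2[OF y(1)] e D_sym[of "?z k" y] D_sym[of "- ?z k" y]
        D_sym[of "- ?z k" "?z k"]
      by (auto simp: max_def abs_if split: if_splits)
  qed
  have f0: "f k 0 = 0" for k by (simp add: f_def axis)
  have Nf: "N x = \<bar>f k x\<bar>" if "x \<in> ?C" "nat (N x) < k" for x k
    using D3[OF that, of 0] that(2) f0 by (simp add: D_sym)
  have fz: "f k (?z j) = int j * t" for k j
    unfolding f_def nmul_add[symmetric] axis by (simp add: algebra_simps)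
  have zC: "?z j \<in> ?C" for j using nmul_commute[of z z j] by simp
  \<comment> \<open>The distance from \<open>x\<close> to \<open>- ?z j\<close> is measured once
    directly, by \<open>D2\<close>, and once in the coordinate \<open>f k\<close>, by
    \<open>D3\<close>; so the Busemann approximation stabilizes.\<close>
  have step: "f j x = f k x"
    if x: "x \<in> ?C" and j: "nat (N x) < j" and k: "nat (N x) < k" "j \<le> k" "nat (N (?z j)) < k" for x j k
  proof -
    have "?z k = ?z (k - j) + ?z j" using k by (simp flip: nmul_add)
    then have "?z k + - ?z j = ?z (k - j)" by (simp add: group_norm)
    then have fm: "f k (- ?z j) = - int j * t"
      using k axis[of "k - j"] by (simp add: f_def of_nat_diff algebra_simps)
    have mz: "- ?z j \<in> ?C" using commute_minus[of "?z j" z] zC by simp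
    have "int j * t + f j x = \<bar>f k x + int j * t\<bar>"
      using D3[OF x k(1) mz] D2[OF x, of j] k(3) fm by simp
    moreover have "\<bar>f k x\<bar> < int j * t" using Nf[OF x k(1)] large[OF j] by simp
    ultimately show ?thesis by linarith
  qed
  define s where "s = (\<lambda>x. f (Suc (nat (N x))) x)"
  have s: "f k x = s x" if x: "x \<in> ?C" "nat (N x) < k" for x k
  proof -
    define j where "j = Suc (nat (N x))"
    define K where "K = Suc (max (max k (nat (N (?z j)))) (max (nat (N x)) (max j (nat (N (?z k))))))"
    have "nat (N x) < j" by (simp add: j_def)
    moreover have "nat (N x) < K" "j \<le> K" "k \<le> K" "nat (N (?z j)) < K" "nat (N (?z k)) < K"
      by (simp_all add: K_def less_Suc_eq_le le_max_iff_disj le_SucI del: nmul.simps)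
    ultimately have "f j x = f K x" "f k x = f K x"
      using step x by blast+
    then show ?thesis by (simp add: s_def j_def)
  qed
  have sD: "D x y = \<bar>s x - s y\<bar>" if x: "x \<in> ?C" and y: "y \<in> ?C" for x y
  proof -
    define k where "k = Suc (max (nat (N x)) (nat (N y)))"
    have "nat (N x) < k" "nat (N y) < k" by (auto simp: k_def)
    then show ?thesis using D3[OF x _ y, of k] s[OF x, of k] s[OF y, of k] by simp
  qed
  have sz: "s (?z j) = int j * t" for j using fz by (simp add: s_def)
  have s_shift: "s (?z j + x) = int j * t + s x" if x: "x \<in> ?C" for j x
  proof -
    define k where "k = Suc (max (nat (N x)) (nat (N (?z j + x))))"
    have k: "nat (N x) < k" "nat (N (?z j + x)) < k" by (auto simp: k_def)
    have "?z j + x \<in> ?C" using x zC[of j] commute_add[of "?z j" z x] by simp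
    then have "s (?z j + x) = f k (?z j + x)" using s k by simp
    moreover have "N (?z k + (?z j + x)) = N (?z (k + j) + x)" by (simp add: nmul_add add.assoc)
    then have "f k (?z j + x) = f (k + j) x + int j * t" by (simp add: f_def distrib_right)
    moreover have "f (k + j) x = s x" using s[OF x] k by simp
    ultimately show ?thesis by simp
  qed
  show thesis
  proof
    show "\<bar>s x\<bar> = N x" if "x + z = z + x" for x
      using that Nf[of x "Suc (nat (N x))"] by (simp add: s_def)
    show "s z = t" using sz[of 1] by simp
    fix x y assume x: "x + z = z + x" and y: "y + z = z + y"
    have C: "x \<in> ?C" "y \<in> ?C" "x + y \<in> ?C" using x y commute_add by auto
    have eq: "\<bar>s y - int j * t\<bar> = \<bar>s (x + y) - (int j * t + s x)\<bar>" for j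
    proof -
      have xz: "x + ?z j \<in> ?C" using commute_add[of x z "?z j"] x zC by simp
      have "\<bar>s y - int j * t\<bar> = D y (?z j)" using sD[OF C(2) zC] sz by simp
      also have "\<dots> = D (x + y) (x + ?z j)" by (simp add: D_shift)
      also have "\<dots> = \<bar>s (x + y) - s (x + ?z j)\<bar>" by (rule sD[OF C(3) xz])
      also have "x + ?z j = ?z j + x" using zcomm C by simp
      finally show ?thesis using s_shift[OF C(1)] by simp
    qed
    \<comment> \<open>With this choice \<open>int j * t\<close> is at least
      \<open>\<bar>s y\<bar>\<close> and \<open>\<bar>s (x + y) - s x\<bar>\<close>, so both
      absolute values in \<open>eq\<close> open with the same sign.\<close>
    define j where "j = nat \<bar>s y\<bar> + nat \<bar>s (x + y) - s x\<bar>"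
    have "int j \<le> int j * t" using t by (simp add: mult_le_cancel_left1)
    then show "s (x + y) = s x + s y" using eq[of 0] eq[of j] by (simp add: j_def)
  qed
qed

text \<open>A path that is geodesic on two consecutive steps is geodesic in a tree. The induction
  applies the four-point condition to 0, \<open>z\<close>, the (k-1)-st and the k-th multiple of
  \<open>z\<close>, starting at k = 3.\<close>

lemma linear_growth:
  assumes "N (z + z) = 2 * N z" "N z > 0"
  shows "N (nmul k z) = int k * N z"
proof (induction k rule: less_induct)
  case (less k)
  consider "k = 0" | "k = 1" | "k = 2" | m where "k = Suc (Suc m)" "m > 0"
    by (metis One_nat_def Suc_1 not0_implies_Suc zero_less_iff_neq_zero)
  then show ?case
  proof cases
    case 4
    have k: "nmul k z = z + nmul (Suc m) z" "nmul k z = nmul (Suc m) z + z"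
      using nmul_commute[of z z "Suc m"] 4 by simp_all
    have e0: "D (nmul (Suc m) z) (nmul k z) = N z" unfolding k(2) by (simp add: D_def group_norm del: nmul.simps)
    have "D z (nmul k z) = N (nmul (Suc m) z)" unfolding k(1) by (simp add: D_def group_norm del: nmul.simps)
    with e0 have e: "D z (nmul k z) = int (Suc m) * N z" "D (nmul (Suc m) z) (nmul k z) = N z"
      "D z (nmul (Suc m) z) = int m * N z"
      using less.IH[of "Suc m"] less.IH[of m] 4 by (simp_all add: D_def group_norm)
    have "N z + N z < int (Suc m) * N z + int (Suc m) * N z"
      using assms 4 by (simp add: algebra_simps)
    then have "D 0 (nmul k z) + D z (nmul (Suc m) z) = D 0 (nmul (Suc m) z) + D z (nmul k z)"
      using two_largest_equal[of 0 z "nmul (Suc m) z" "nmul k z"] e less.IH[of "Suc m"] 4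
      by (simp add: D_sym del: nmul.simps)
    then show ?thesis using e less.IH[of "Suc m"] 4 by (simp add: algebra_simps del: nmul.simps)
  qed (use assms in \<open>simp_all add: numeral_2_eq_2\<close>)
qed

end

section \<open>The universal group\<close>

text \<open>The actions and the exponent sums below are shown in this way to depend only on the
  group element: it suffices to test the two elementary moves.\<close>

lemma raag_eq_invariant:
  assumes "raag_eq E w w'"
    and "\<And>xs ys v b. f (xs @ [(v, b), (v, \<not> b)] @ ys) = f (xs @ ys)"
    and "\<And>xs ys u v a b. E u v \<Longrightarrow> f (xs @ [(u, a), (v, b)] @ ys) = f (xs @ [(v, b), (u, a)] @ ys)"
  shows "f w = f w'"
  using assms(1)
proof induction
  case (cancel xs v b ys)
  show ?case by (rule assms(2))
next
  case (commute u v xs a b ys)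
  then show ?case by (rule assms(3))
qed simp_all

lemma raag_eq_context:
  assumes "raag_eq E w w'" shows "raag_eq E (us @ w @ vs) (us @ w' @ vs)"
  using assms
proof induction
  case (cancel xs v b ys)
  then show ?case using raag_eq.cancel[of E "us @ xs" v b "ys @ vs"] by simp
next
  case (commute u v xs a b ys)
  then show ?case using raag_eq.commute[of E u v "us @ xs" a b "ys @ vs"] by simp
qed (blast intro: raag_eq.refl raag_eq.sym raag_eq.trans)+

lemma raag_eq_append:
  "raag_eq E u u' \<Longrightarrow> raag_eq E w w' \<Longrightarrow> raag_eq E (u @ w) (u' @ w')"
  using raag_eq_context[of E u u' "[]" w] raag_eq_context[of E w w' u' "[]"]
  by (auto intro: raag_eq.trans)

text \<open>Deleting the letters outside \<open>S\<close> turns a derivation into a derivation. The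
  second relation \<open>E'\<close> allows a change of graph, which later embeds the group of an
  induced subgraph and proves the embedding injective.\<close>

lemma raag_eq_filter:
  assumes "raag_eq E w w'" "\<And>u v. u \<in> S \<Longrightarrow> v \<in> S \<Longrightarrow> E u v \<Longrightarrow> E' u v"
  shows "raag_eq E' (filter (\<lambda>p. fst p \<in> S) w) (filter (\<lambda>p. fst p \<in> S) w')"
  using assms(1)
proof induction
  case (cancel xs v b ys)
  then show ?case
    using raag_eq.cancel[of E' "filter (\<lambda>p. fst p \<in> S) xs" v b "filter (\<lambda>p. fst p \<in> S) ys"]
    by (auto intro: raag_eq.refl)
next
  case (commute u v xs a b ys)
  then show ?case
    using raag_eq.commute[of E' u v "filter (\<lambda>p. fst p \<in> S) xs" a b "filter (\<lambda>p. fst p \<in> S) ys"] assms(2)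
    by (auto intro: raag_eq.refl)
qed (blast intro: raag_eq.refl raag_eq.sym raag_eq.trans)+

definition word_inv :: "'v word \<Rightarrow> 'v word" where
  "word_inv w = rev (map (\<lambda>p. (fst p, \<not> snd p)) w)"

lemma raag_eq_word_inv_left: "raag_eq E (word_inv w @ w) []"
proof (induction w)
  case (Cons p w)
  obtain v b where p: "p = (v, b)" by (cases p)
  have "raag_eq E (word_inv w @ [(v, \<not> b), (v, \<not> \<not> b)] @ w) (word_inv w @ w)" by (rule raag_eq.cancel)
  then show ?case using Cons by (auto simp: word_inv_def p intro: raag_eq.trans)
qed (simp add: word_inv_def raag_eq.refl)

lemma raag_eq_word_inv:
  assumes "raag_eq E w w'" shows "raag_eq E (word_inv w) (word_inv w')"
  using assms
proof induction
  case (cancel xs v b ys)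
  then show ?case using raag_eq.cancel[of E "word_inv ys" v b "word_inv xs"] by (simp add: word_inv_def)
next
  case (commute u v xs a b ys)
  then show ?case
    using raag_eq.commute[of E u v "word_inv ys" "\<not> a" "\<not> b" "word_inv xs", THEN raag_eq.sym]
    by (simp add: word_inv_def)
qed (blast intro: raag_eq.refl raag_eq.sym raag_eq.trans)+

text \<open>Every tree of the theorem is an induced subgraph of this infinite tree (with the Hair
  vertices isolated), so all the groups in question are subgroups of a single one, which can
  be made into a type.\<close>
definition utree :: "tvert \<Rightarrow> tvert \<Rightarrow> bool" where
  "utree x y \<longleftrightarrow> (x = Center \<and> (\<exists>i a. y = Pivot i a)) \<or> (y = Center \<and> (\<exists>i a. x = Pivot i a)) \<or>
     (\<exists>i a b. x = Pivot i a \<and> y = Leaf i a b) \<or> (\<exists>i a b. y = Pivot i a \<and> x = Leaf i a b)"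

lemma utree_sym: "utree x y \<Longrightarrow> utree y x"
  by (auto simp: utree_def)

quotient_type ugroup = "tvert word" / "raag_eq utree"
  by (auto intro!: equivpI reflpI sympI transpI intro: raag_eq.refl raag_eq.sym raag_eq.trans)

instantiation ugroup :: group_add
begin

lift_definition zero_ugroup :: ugroup is "[]" .
lift_definition plus_ugroup :: "ugroup \<Rightarrow> ugroup \<Rightarrow> ugroup" is append by (rule raag_eq_append)
lift_definition uminus_ugroup :: "ugroup \<Rightarrow> ugroup" is word_inv by (rule raag_eq_word_inv)
definition minus_ugroup :: "ugroup \<Rightarrow> ugroup \<Rightarrow> ugroup" where "minus_ugroup x y = x + - y"

instance
proof
  show "- x + x = 0" for x :: ugroup by transfer (rule raag_eq_word_inv_left)
qed (transfer; simp add: raag_eq.refl minus_ugroup_def)+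

end

section \<open>Words, retractions and standard subgroups of the universal group\<close>

lift_definition el :: "tvert word \<Rightarrow> ugroup" is "\<lambda>w. w" .

abbreviation ltr :: "tvert \<Rightarrow> bool \<Rightarrow> ugroup" where "ltr v b \<equiv> el [(v, b)]"
abbreviation vgen :: "tvert \<Rightarrow> ugroup" where "vgen v \<equiv> el [(v, True)]"

lemma el_eq_iff: "el u = el w \<longleftrightarrow> raag_eq utree u w"
  by transfer simp

lemma el_Nil [simp]: "el [] = 0"
  by transfer (rule raag_eq.refl)

lemma el_append: "el (u @ w) = el u + el w"
  by transfer (rule raag_eq.refl)

lemma el_Cons: "el (p # w) = el [p] + el w"
  using el_append[of "[p]" w] by simp

lemma el_surj: obtains w where "x = el w"
  by transfer (auto intro: raag_eq.refl)

lemma ltr_Not: "ltr v (\<not> b) = - ltr v b"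
  by transfer (simp add: word_inv_def raag_eq.refl)

lemma ltr_vgen: "ltr v b = (if b then vgen v else - vgen v)"
  using ltr_Not[of v True] by simp

lemma ltr_commute:
  assumes "utree u v" shows "ltr u a + ltr v b = ltr v b + ltr u a"
proof -
  have "raag_eq utree ([] @ [(u, a), (v, b)] @ []) ([] @ [(v, b), (u, a)] @ [])"
    using assms by (rule raag_eq.commute)
  then show ?thesis by (simp flip: el_append add: el_eq_iff)
qed

text \<open>The retraction onto the subgroup generated by \<open>S\<close>, killing all other
  generators.\<close>

lift_definition ret :: "tvert set \<Rightarrow> ugroup \<Rightarrow> ugroup" is "\<lambda>S. filter (\<lambda>p. fst p \<in> S)"
  by (rule raag_eq_filter)

lemma ret_el: "ret S (el w) = el (filter (\<lambda>p. fst p \<in> S) w)"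
  by transfer (rule raag_eq.refl)

lemma ret_add: "ret S (x + y) = ret S x + ret S y"
  by transfer (simp add: raag_eq.refl)

lemma ret_zero [simp]: "ret S 0 = 0"
  by transfer (simp add: raag_eq.refl)

lemma ret_minus: "ret S (- x) = - ret S x"
  using ret_add[of S "- x" x] by (simp add: eq_neg_iff_add_eq_0)

lemma ret_diff: "ret S (x - y) = ret S x - ret S y"
  by (simp add: diff_conv_add_uminus ret_add ret_minus)

lemmas ret_hom = ret_add ret_minus ret_diff

lemma ret_nmul: "ret S (nmul n x) = nmul n (ret S x)"
  by (induction n) (simp_all add: ret_add)

lemma ret_ret: "ret S (ret T x) = ret (S \<inter> T) x"
  by transfer (simp add: raag_eq.refl conj_commute)

lemma ret_vgen: "ret S (vgen v) = (if v \<in> S then vgen v else 0)"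
  by (simp add: ret_el)

definition gen :: "tvert set \<Rightarrow> ugroup set" where
  "gen S = el ` {w. fst ` set w \<subseteq> S}"

lemma ret_in_gen: "ret S x \<in> gen S"
proof -
  obtain w where "x = el w" by (rule el_surj)
  then show ?thesis by (auto simp: ret_el gen_def intro!: imageI)
qed

text \<open>Membership in a standard subgroup becomes an equation. Since retractions compose by
  intersecting their vertex sets, this gives \<open>gen_Int\<close>.\<close>

lemma gen_iff_ret: "x \<in> gen S \<longleftrightarrow> ret S x = x"
proof
  assume "x \<in> gen S"
  then obtain w where w: "x = el w" "fst ` set w \<subseteq> S" by (auto simp: gen_def)
  then have "filter (\<lambda>p. fst p \<in> S) w = w" by (auto simp: filter_id_conv)
  then show "ret S x = x" using w by (simp add: ret_el)
qed (metis ret_in_gen)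

lemma subgrp_gen: "subgrp (gen S)"
  by (rule subgrpI) (simp_all add: gen_iff_ret ret_hom)

lemma gen_Int: "gen S \<inter> gen T = gen (S \<inter> T)"
proof (intro equalityI subsetI)
  fix x assume "x \<in> gen S \<inter> gen T"
  then show "x \<in> gen (S \<inter> T)" using ret_ret[of S T x] by (simp add: gen_iff_ret)
next
  fix x assume "x \<in> gen (S \<inter> T)"
  then show "x \<in> gen S \<inter> gen T"
    using ret_ret[of S "S \<inter> T" x] ret_ret[of T "S \<inter> T" x]
    by (simp add: gen_iff_ret Int_absorb1 Int_absorb2)
qed

lemma gen_mono: "S \<subseteq> T \<Longrightarrow> gen S \<subseteq> gen T"
  by (auto simp: gen_def)

lemma vgen_in_gen: "v \<in> S \<Longrightarrow> vgen v \<in> gen S"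
  by (simp add: gen_iff_ret ret_vgen)

lemma ltr_in_gen: "v \<in> S \<Longrightarrow> ltr v b \<in> gen S"
  by (metis ltr_vgen subgrp_gen subgrp_minus vgen_in_gen)

lemma gen_induct [consumes 1, case_names zero ltr]:
  assumes "x \<in> gen S" "P 0" "\<And>v b y. v \<in> S \<Longrightarrow> y \<in> gen S \<Longrightarrow> P y \<Longrightarrow> P (ltr v b + y)"
  shows "P x"
proof -
  have "P (el w)" if "fst ` set w \<subseteq> S" for w
    using that
  proof (induction w)
    case (Cons p w)
    then have "el w \<in> gen S" by (auto simp: gen_def)
    with Cons assms(3)[of "fst p" "el w" "snd p"] show ?case by (simp add: el_Cons[of p w])
  qed (simp add: assms)
  then show ?thesis using assms(1) by (auto simp: gen_def)
qed

lemma ugroup_induct [case_names zero ltr]: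
  assumes "P 0" "\<And>v b y. P y \<Longrightarrow> P (ltr v b + y)"
  shows "P x"
proof -
  have "x \<in> gen UNIV" by (rule el_surj[of x]) (auto simp: gen_def)
  then show ?thesis by (induction rule: gen_induct) (use assms in auto)
qed

lemma gen_subset:
  assumes "subgrp K" "\<And>v. v \<in> S \<Longrightarrow> vgen v \<in> K" shows "gen S \<subseteq> K"
proof
  fix x assume "x \<in> gen S"
  then show "x \<in> K"
  proof (induction rule: gen_induct)
    case (ltr v b y)
    then have "ltr v b \<in> K" using assms subgrp_minus[of K "vgen v"] by (subst ltr_vgen) auto
    with ltr show ?case using assms(1) subgrp_add by blast
  qed (use assms in \<open>simp add: subgrp_zero\<close>)
qed

lemma gen_empty: "gen {} = {0}"
  by (auto simp: gen_def)

lemma ret_gen_disjoint: "x \<in> gen T \<Longrightarrow> S \<inter> T = {} \<Longrightarrow> ret S x = 0"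
  using ret_ret[of S T x] ret_in_gen[of "{}"] by (simp add: gen_iff_ret gen_empty)

lemma commute_gen:
  assumes "\<And>v. v \<in> S \<Longrightarrow> vgen v + x = x + vgen v" "y \<in> gen S"
  shows "y + x = x + y"
proof -
  have "gen S \<subseteq> cent UNIV x"
    by (rule gen_subset[OF subgrp_cent[OF subgrp_UNIV]]) (use assms(1) in \<open>simp add: cent_def\<close>)
  then show ?thesis using assms(2) by (auto simp: cent_def)
qed

lemma gen_commute_gen:
  assumes "\<And>u v. u \<in> S \<Longrightarrow> v \<in> T \<Longrightarrow> utree u v \<or> u = v" "x \<in> gen S" "y \<in> gen T"
  shows "x + y = y + x"
proof (rule commute_gen[OF _ assms(2)])
  fix u assume u: "u \<in> S"
  have "y + vgen u = vgen u + y"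
    by (rule commute_gen[OF _ assms(3)]) (metis assms(1) ltr_commute u)
  then show "vgen u + y = y + vgen u" by simp
qed

lift_definition expo :: "tvert \<Rightarrow> ugroup \<Rightarrow> int" is
  "\<lambda>v w. sum_list (map (\<lambda>p. if fst p = v then if snd p then 1 else - 1 else 0) w)"
  by (erule raag_eq_invariant) auto

lemma expo_add: "expo v (x + y) = expo v x + expo v y"
  by transfer simp

lemma expo_zero [simp]: "expo v 0 = 0"
  by transfer simp

lemma expo_ltr: "expo v (ltr u b) = (if u = v then if b then 1 else - 1 else 0)"
  by transfer simp

lemma expo_minus: "expo v (- x) = - expo v x"
  using expo_add[of v x "- x"] by simp

definition lk :: "tvert \<Rightarrow> tvert set" where "lk v = {u. utree v u}"

lemma lk_simps:
  "lk Center = {Pivot i a | i a. True}"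
  "lk (Hair j) = {}"
  "lk (Pivot i a) = insert Center {Leaf i a b | b. True}"
  "lk (Leaf i a b) = {Pivot i a}"
  by (auto simp: lk_def utree_def)

section \<open>Trees of reduced words\<close>

text \<open>The letter \<open>((p, c), b)\<close> stands for the conjugate of \<open>p\<close>, or
  of its inverse if \<open>b\<close> is false, by any element of the coset \<open>c\<close> of
  \<open>gen (lk p)\<close>. As \<open>gen (lk p)\<close> centralizes \<open>p\<close>, the coset
  determines the conjugate, and distinct basis elements are literally distinct letters.\<close>

type_synonym letter = "(tvert \<times> ugroup set) \<times> bool"

definition linv :: "letter \<Rightarrow> letter" where "linv l = (fst l, \<not> snd l)"

text \<open>Left multiplication by a basis element in the free group of reduced words;
  \<open>move\<close> below is the action of the complementary factor on the basis.\<close>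

definition push :: "letter \<Rightarrow> letter list \<Rightarrow> letter list" where
  "push l w = (case w of [] \<Rightarrow> [l] | l' # w' \<Rightarrow> if l' = linv l then w' else l # w)"

definition move :: "ugroup \<Rightarrow> letter \<Rightarrow> letter" where
  "move x l = ((fst (fst l), (+) x ` snd (fst l)), snd l)"

fun reduced :: "letter list \<Rightarrow> bool" where
  "reduced [] = True"
| "reduced (l # w) = (reduced w \<and> (w = [] \<or> hd w \<noteq> linv l))"

fun lcp :: "'b list \<Rightarrow> 'b list \<Rightarrow> nat" where
  "lcp (x # xs) (y # ys) = (if x = y then Suc (lcp xs ys) else 0)"
| "lcp _ _ = 0"

text \<open>The path metric of the Cayley tree of the free group: edges append a letter on the
  right, so the geodesic between two words passes through their longest common prefix, and
  \<open>push\<close> acts on the left.\<close>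

definition tdist :: "'b list \<Rightarrow> 'b list \<Rightarrow> int" where
  "tdist u v = int (length u) + int (length v) - 2 * int (lcp u v)"

lemma linv_linv [simp]: "linv (linv l) = l"
  and linv_neq [simp]: "linv l \<noteq> l" "l \<noteq> linv l"
  and fst_linv [simp]: "fst (linv l) = fst l"
  and snd_linv [simp]: "snd (linv l) = (\<not> snd l)"
  by (auto simp: linv_def prod_eq_iff)

lemma reduced_push: "reduced w \<Longrightarrow> reduced (push l w)"
  by (cases w) (auto simp: push_def)

lemma set_push: "set (push l w) \<subseteq> insert l (set w)"
  by (cases w) (auto simp: push_def)

lemma push_push: "reduced w \<Longrightarrow> push l (push (linv l) w) = w"
  by (cases w; cases "tl w") (auto simp: push_def)

lemma move_linv [simp]: "linv (move x l) = move x (linv l)"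
  by (simp add: linv_def move_def)

lemma move_move [simp]: "move x (move y l) = move (x + y) l"
  by (simp add: move_def image_image add.assoc)

lemma move_zero [simp]: "move 0 l = l"
  by (simp add: move_def)

lemma move_inject [simp]: "move x l = move x l' \<longleftrightarrow> l = l'"
  by (metis left_minus move_move move_zero)

lemma push_move: "push (move x l) (map (move x) w) = map (move x) (push l w)"
  by (cases w) (auto simp: push_def)

lemma reduced_map_move: "reduced w \<Longrightarrow> reduced (map (move x) w)"
  by (induction w) (auto simp: hd_map)

lemma lcp_sym: "lcp u v = lcp v u"
  by (induction u v rule: lcp.induct) auto

lemma lcp_self [simp]: "lcp u u = length u"
  by (induction u) auto

lemma lcp_ultra: "min (lcp u v) (lcp v w) \<le> lcp u w"
proof (induction u v arbitrary: w rule: lcp.induct)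
  case (1 x xs y ys)
  then show ?case by (cases w) auto
qed auto

lemma lcp_map_inj: "inj f \<Longrightarrow> lcp (map f u) (map f v) = lcp u v"
  by (induction u v rule: lcp.induct) (auto simp: inj_eq)

text \<open>The common prefix length is the Gromov product at the empty word. It satisfies the
  ultrametric inequality \<open>lcp_ultra\<close>, of which the four-point condition is a formal
  consequence.\<close>

lemma tdist_four_point: "tdist x y + tdist z w \<le> max (tdist x z + tdist y w) (tdist x w + tdist y z)"
proof -
  have "min (lcp x z + lcp y w) (lcp x w + lcp y z) \<le> lcp x y + lcp z w"
    using lcp_ultra[of x z y] lcp_ultra[of x w y] lcp_ultra[of z x w] lcp_ultra[of z y w]
      lcp_ultra[of x y z] lcp_ultra[of x y w] lcp_ultra[of y x z] lcp_ultra[of y x w]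
      lcp_ultra[of x z w] lcp_ultra[of x w z] lcp_ultra[of y z w] lcp_ultra[of y w z]
    by (auto simp: lcp_sym[of y x] lcp_sym[of z x] lcp_sym[of w x] lcp_sym[of z y] lcp_sym[of w y]
        lcp_sym[of w z] min_def split: if_splits)
  then show ?thesis unfolding tdist_def by linarith
qed

lemma tdist_push:
  assumes "reduced u" "reduced v" shows "tdist (push l u) (push l v) = tdist u v"
proof -
  \<comment> \<open>If \<open>l\<close> cancels against one word and not against the other, then the
    rest of the first does not begin with \<open>l\<close>, because that word was reduced; so the
    new words have no common prefix.\<close>
  have lcp0: "lcp u' (l # v') = 0" "lcp (l # v') u' = 0" if "reduced (linv l # u')" for u' v'
    using that by (cases u'; auto)+
  show ?thesis
    using assms lcp0 by (cases u; cases v) (auto simp: push_def tdist_def)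
qed

lemma tdist_Nil [simp]: "tdist [] w = int (length w)"
  by (simp add: tdist_def)

section \<open>The action on the tree belonging to one colour class\<close>

locale side =
  fixes A :: "tvert set"
  assumes bipartite: "utree u v \<Longrightarrow> u \<in> A \<longleftrightarrow> v \<notin> A"
begin

definition valid :: "letter \<Rightarrow> bool" where
  "valid l \<longleftrightarrow> fst (fst l) \<in> A \<and> (\<exists>x\<in>gen (- A). snd (fst l) = (+) x ` gen (lk (fst (fst l))))"

definition verts :: "letter list set" where
  "verts = {w. reduced w \<and> (\<forall>l\<in>set w. valid l)}"

text \<open>A generator in \<open>A\<close> is the basis element with the coset of 0; a generator
  outside \<open>A\<close> permutes the basis by translating cosets.\<close>

definition step :: "tvert \<times> bool \<Rightarrow> letter list \<Rightarrow> letter list" where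
  "step p w = (if fst p \<in> A then push ((fst p, gen (lk (fst p))), snd p) w else map (move (el [p])) w)"

definition app :: "ugroup \<Rightarrow> letter list \<Rightarrow> letter list" where
  "app g w = foldr step (SOME u. el u = g) w"

lemma lk_disjoint: "v \<in> A \<Longrightarrow> lk v \<subseteq> - A"
  by (auto simp: lk_def bipartite)

lemma valid_base: "v \<in> A \<Longrightarrow> valid ((v, gen (lk v)), b)"
  using subgrp_zero[OF subgrp_gen] by (force simp: valid_def intro!: bexI[of _ 0])

lemma valid_move:
  assumes "valid l" "x \<in> gen (- A)" shows "valid (move x l)"
proof -
  obtain y where y: "y \<in> gen (- A)" "snd (fst l) = (+) y ` gen (lk (fst (fst l)))" "fst (fst l) \<in> A"
    using assms(1) by (auto simp: valid_def)
  have "(+) x ` snd (fst l) = (+) (x + y) ` gen (lk (fst (fst l)))"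
    by (simp add: y image_image add.assoc)
  then show ?thesis using y subgrp_add[OF subgrp_gen assms(2) y(1)] by (auto simp: valid_def move_def)
qed

lemma step_verts: "w \<in> verts \<Longrightarrow> step p w \<in> verts"
proof -
  assume w: "w \<in> verts"
  show ?thesis
  proof (cases "fst p \<in> A")
    case True
    then show ?thesis using w set_push[of "((fst p, gen (lk (fst p))), snd p)" w] valid_base[OF True]
      by (auto simp: verts_def step_def reduced_push)
  next
    case False
    then have "el [p] \<in> gen (- A)" using ltr_in_gen[of "fst p" "- A" "snd p"] by simp
    then show ?thesis using w False valid_move by (auto simp: verts_def step_def reduced_map_move)
  qed
qed

lemma foldr_step_verts: "w \<in> verts \<Longrightarrow> foldr step u w \<in> verts"
  by (induction u) (auto simp: step_verts)

lemma step_cancel: "w \<in> verts \<Longrightarrow> step (v, b) (step (v, \<not> b) w) = w"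
proof (cases "v \<in> A")
  case True
  then show "w \<in> verts \<Longrightarrow> ?thesis"
    using push_push[of w "((v, gen (lk v)), b)"] by (simp add: step_def verts_def linv_def)
next
  case False
  then show ?thesis by (simp add: step_def o_def ltr_Not map_idI)
qed

lemma move_base:
  assumes "x \<in> gen (lk v)" shows "move x ((v, gen (lk v)), b) = ((v, gen (lk v)), b)"
proof -
  have "(+) x ` gen (lk v) = gen (lk v)"
  proof (intro equalityI subsetI)
    fix y assume "y \<in> gen (lk v)"
    then have "- x + y \<in> gen (lk v)" using assms subgrp_closed[OF subgrp_gen] by blast
    then show "y \<in> (+) x ` gen (lk v)" by (metis add_minus_cancel image_eqI)
  qed (use assms subgrp_add[OF subgrp_gen] in blast)
  then show ?thesis by (simp add: move_def)
qed

text \<open>Exactly one of two adjacent generators lies in \<open>A\<close>, and the other one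
  belongs to the link of the first, hence fixes its letter by \<open>move_base\<close>.\<close>

lemma step_commute:
  assumes "utree u v" shows "step (u, a) (step (v, b) w) = step (v, b) (step (u, a) w)"
proof -
  have *: "step (u, a) (step (v, b) w) = step (v, b) (step (u, a) w)"
    if uv: "utree u v" and u: "u \<in> A" for u v a b
  proof -
    have "ltr v b \<in> gen (lk u)" using uv by (simp add: lk_def ltr_in_gen)
    from move_base[OF this] show ?thesis
      using u bipartite[OF uv] push_move[of "ltr v b" "((u, gen (lk u)), a)" w] by (simp add: step_def)
  qed
  show ?thesis using *[OF assms] *[OF utree_sym[OF assms]] bipartite[OF assms] by metis
qed

lemma app_el:
  assumes "w \<in> verts" shows "app (el u) w = foldr step u w"
proof -
  have inv: "foldr step u w = foldr step u' w" if "raag_eq utree u u'" for u u'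
    using that
  proof (rule raag_eq_invariant)
    show "foldr step (xs @ [(v, b), (v, \<not> b)] @ ys) w = foldr step (xs @ ys) w" for xs ys v b
      using step_cancel[OF foldr_step_verts[OF assms]] by simp
    show "foldr step (xs @ [(u, a), (v, b)] @ ys) w = foldr step (xs @ [(v, b), (u, a)] @ ys) w"
      if "utree u v" for xs ys u v a b
      using step_commute[OF that] by simp
  qed
  have "el (SOME u'. el u' = el u) = el u" by (metis (mono_tags) someI)
  from inv[OF el_eq_iff[THEN iffD1, OF this]] show ?thesis by (simp add: app_def)
qed

lemma app_verts: "w \<in> verts \<Longrightarrow> app g w \<in> verts"
  by (simp add: app_def foldr_step_verts)

lemma app_add: "w \<in> verts \<Longrightarrow> app (g + h) w = app g (app h w)"
proof -
  assume w: "w \<in> verts"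
  obtain u v where uv: "g = el u" "h = el v" by (metis el_surj)
  have "app (g + h) w = foldr step (u @ v) w" unfolding uv el_append[symmetric] by (rule app_el[OF w])
  then show ?thesis using app_el[OF w] app_el[OF foldr_step_verts[OF w]] by (simp add: uv)
qed

lemma app_zero: "w \<in> verts \<Longrightarrow> app 0 w = w"
  using app_el[of w "[]"] by simp

lemma app_ltr: "w \<in> verts \<Longrightarrow> app (ltr v b) w = step (v, b) w"
  using app_el[of w "[(v, b)]"] by simp

lemma Nil_verts [simp]: "[] \<in> verts"
  by (simp add: verts_def)

lemma app_stab: "x \<in> gen (- A) \<Longrightarrow> w \<in> verts \<Longrightarrow> app x w = map (move x) w"
proof (induction rule: gen_induct)
  case zero
  then show ?case by (simp add: app_zero map_idI)
next
  case (ltr v b y)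
  then have "app (ltr v b + y) w = step (v, b) (map (move y) w)"
    using app_verts[of w y] by (simp add: app_add app_ltr)
  then show ?case using ltr by (simp add: step_def o_def)
qed

lemma tdist_step:
  assumes "u \<in> verts" "v \<in> verts" shows "tdist (step p u) (step p v) = tdist u v"
proof -
  have "inj (move (el [p]))" by (simp add: inj_def)
  then have "tdist (map (move (el [p])) u) (map (move (el [p])) v) = tdist u v"
    by (simp add: tdist_def lcp_map_inj)
  then show ?thesis using assms by (simp add: step_def verts_def tdist_push)
qed

lemma tdist_app:
  assumes "u \<in> verts" "v \<in> verts" shows "tdist (app g u) (app g v) = tdist u v"
proof (induction g rule: ugroup_induct)
  case (ltr x b y)
  then show ?case using assms by (simp add: app_add app_ltr app_verts tdist_step)
qed (simp add: app_zero assms)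

definition len :: "ugroup \<Rightarrow> int" where "len g = int (length (app g []))"

lemma len_diff: "len (- x + y) = tdist (app x []) (app y [])"
proof -
  have "tdist (app x []) (app y []) = tdist (app (- x) (app x [])) (app (- x) (app y []))"
    by (simp add: tdist_app app_verts)
  then show ?thesis by (simp add: len_def app_zero flip: app_add)
qed

sublocale length_function len
proof
  show len0: "len 0 = 0" by (simp add: len_def app_zero)
  show "len (- x) = len x" for x
    using len_diff[of x 0] by (simp add: len_def app_zero tdist_def lcp_sym)
  show "0 \<le> len x" for x by (simp add: len_def)
  show "len (- x + y) + len (- z + w) \<le> max (len (- x + z) + len (- y + w)) (len (- x + w) + len (- y + z))"
    for x y z w unfolding len_diff by (rule tdist_four_point)
qed

text \<open>The element x + vgen p - x translates along the edge labelled by the coset x + gen (lk p);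
  it does not depend on the representative x.\<close>
definition lelt :: "letter \<Rightarrow> ugroup" where
  "lelt l = (let x = SOME x. x \<in> snd (fst l) in x + ltr (fst (fst l)) (snd l) - x)"

definition sec :: "letter list \<Rightarrow> ugroup" where
  "sec w = foldr (\<lambda>l y. lelt l + y) w 0"

lemma sec_simps [simp]: "sec [] = 0" "sec (l # w) = lelt l + sec w"
  by (simp_all add: sec_def)

lemma lelt_eq:
  assumes "c = (+) x ` gen (lk p)"
  shows "lelt ((p, c), b) = x + ltr p b - x"
proof -
  define y where "y = (SOME y. y \<in> c)"
  have "x \<in> c" using assms subgrp_zero[OF subgrp_gen, of "lk p"] by force
  then have "y \<in> c" unfolding y_def by (rule someI)
  then obtain q where q: "q \<in> gen (lk p)" "y = x + q" using assms by auto
  have "q + ltr p b = ltr p b + q"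
    by (rule gen_commute_gen[OF _ q(1), of "{p}"]) (auto simp: lk_def utree_sym ltr_in_gen)
  then have "q + ltr p b - q = ltr p b" by (simp add: group_norm)
  then have "x + (q + ltr p b - q) - x = x + ltr p b - x" by simp
  then show ?thesis by (simp add: lelt_def flip: y_def) (simp add: q group_norm)
qed

lemma lelt_linv:
  assumes "valid l" shows "lelt (linv l) = - lelt l"
proof -
  obtain p c b x where l: "l = ((p, c), b)" "c = (+) x ` gen (lk p)"
    using assms by (metis prod.collapse valid_def)
  then have "linv l = ((p, c), \<not> b)" by (simp add: linv_def)
  then show ?thesis using l lelt_eq[OF l(2)] by (simp add: ltr_Not group_norm)
qed

lemma lelt_move: "valid l \<Longrightarrow> lelt (move y l) = y + lelt l - y"
proof -
  assume "valid l"
  then obtain p c b x where l: "l = ((p, c), b)" "c = (+) x ` gen (lk p)"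
    by (metis prod.collapse valid_def)
  then have "(+) y ` c = (+) (y + x) ` gen (lk p)" by (simp add: image_image add.assoc)
  from lelt_eq[OF this] show ?thesis using l lelt_eq[OF l(2)] by (simp add: move_def group_norm)
qed

lemma sec_push:
  assumes "w \<in> verts" "valid l" shows "sec (push l w) = lelt l + sec w"
  using assms lelt_linv[OF assms(2)] by (cases w) (auto simp: push_def group_norm)

lemma sec_map_move:
  assumes "\<And>l. l \<in> set w \<Longrightarrow> valid l" shows "sec (map (move y) w) = y + sec w - y"
  using assms by (induction w) (auto simp: lelt_move group_norm)

text \<open>\<open>sec w\<close> carries the base vertex to \<open>w\<close>. Choosing
  \<open>sec\<close> is compatible with the action up to the factor \<open>gen (- A)\<close>; for
  the empty word this shows that nothing outside \<open>gen (- A)\<close> fixes the base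
  vertex.\<close>

lemma sec_app:
  assumes "w \<in> verts" shows "- sec (app g w) + g + sec w \<in> gen (- A)"
proof (induction g rule: ugroup_induct)
  case zero
  then show ?case using assms subgrp_zero[OF subgrp_gen] by (simp add: app_zero)
next
  case (ltr v b y)
  let ?T = "app y w"
  have T: "?T \<in> verts" using assms by (rule app_verts)
  have "- sec (step (v, b) ?T) + ltr v b + sec ?T \<in> gen (- A)"
  proof (cases "v \<in> A")
    case True
    have "lelt ((v, gen (lk v)), b) = 0 + ltr v b - 0" by (rule lelt_eq) simp
    then show ?thesis using True sec_push[OF T valid_base[OF True]] subgrp_zero[OF subgrp_gen]
      by (simp add: step_def group_norm)
  next
    case False
    have "sec (map (move (ltr v b)) ?T) = ltr v b + sec ?T - ltr v b"
      using T by (intro sec_map_move) (auto simp: verts_def)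
    then have "- sec (step (v, b) ?T) + ltr v b + sec ?T = ltr v b"
      using False by (simp add: step_def group_norm)
    then show ?thesis using False by (simp add: ltr_in_gen)
  qed
  from subgrp_add[OF subgrp_gen this ltr] show ?case
    using assms T by (simp add: app_add app_ltr group_norm)
qed

lemma fixes_Nil_iff: "app g [] = [] \<longleftrightarrow> g \<in> gen (- A)"
  using sec_app[of "[]" g] app_stab[of g "[]"] by auto

lemma len_eq_0_iff: "len g = 0 \<longleftrightarrow> g \<in> gen (- A)"
  by (simp add: len_def flip: fixes_Nil_iff)

lemma app_lelt:
  assumes "valid l" "w \<in> verts" shows "app (lelt l) w = push l w"
proof -
  obtain p b x where l: "l = ((p, (+) x ` gen (lk p)), b)" "p \<in> A" "x \<in> gen (- A)"
    using assms(1) by (metis prod.collapse valid_def)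
  have mx: "- x \<in> gen (- A)" using l subgrp_minus[OF subgrp_gen] by blast
  have "app (lelt l) w = app x (app (ltr p b) (app (- x) w))"
    unfolding l(1) lelt_eq[OF HOL.refl] using assms
    by (simp add: group_norm app_add app_verts)
  also have "\<dots> = map (move x) (push ((p, gen (lk p)), b) (map (move (- x)) w))"
  proof -
    have "app (ltr p b) (app (- x) w) = push ((p, gen (lk p)), b) (map (move (- x)) w)"
      using l(2) mx assms(2) by (simp add: app_ltr[OF app_verts] step_def) (simp add: app_stab)
    then show ?thesis
      using app_stab[OF l(3) app_verts[OF app_verts[OF assms(2)], of "ltr p b" "- x"]] by simp
  qed
  also have "\<dots> = push l w"
    by (simp add: push_move[symmetric] o_def map_idI) (simp add: l move_def)
  finally show ?thesis .
qed

end

section \<open>Axes of hyperbolic elements and centralizers of elliptic ones\<close>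

context side
begin

text \<open>If conjugating cannot shorten z, then the paths from the base point to its images under z
  and - z leave along different edges, unless z inverts an edge, which is impossible as A-letters
  keep their sign.\<close>
lemma minimal_conjugate:
  assumes min: "\<And>g. len z \<le> len (- g + z + g)" and z: "len z > 0"
  shows "len (z + z) = 2 * len z"
proof -
  let ?v = "app z []" and ?u = "app (- z) []"
  have luv: "length ?u = length ?v" using N_minus[of z] by (simp add: len_def)
  have dzz: "len (z + z) = tdist ?u ?v" using len_diff[of "- z" z] by simp
  show ?thesis
  proof (cases "hd ?u = hd ?v")
    case False
    then have "lcp ?u ?v = 0" by (cases ?u; cases ?v) auto
    then show ?thesis using luv unfolding dzz tdist_def by (simp add: len_def)
  next
    case True
    define b where "b = hd ?v"
    obtain v' where v': "?v = b # v'" using z by (cases ?v) (auto simp: len_def b_def)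
    have "?u \<noteq> []" using luv v' by (metis length_0_conv list.distinct(1))
    then have u': "?u = b # tl ?u" unfolding b_def True[symmetric] by (rule list.collapse[symmetric])
    have "?v \<in> verts" "?u \<in> verts" by (simp_all add: app_verts)
    then have b: "valid b" "[b] \<in> verts" using v' by (auto simp: verts_def)
    \<comment> \<open>\<open>k\<close> moves the base vertex along the first edge \<open>b\<close>
      of the path to its image under \<open>z\<close>, which by assumption is also the first edge
      towards the image under \<open>- z\<close>.\<close>
    define k where "k = lelt b"
    have kb: "app k [] = [b]" using app_lelt[OF b(1), of "[]"] by (simp add: k_def push_def)
    have "D 0 k = 1" using kb by (simp add: len_def)
    moreover have "D k z = len z - 1" using kb v' by (simp add: D_def len_diff) (simp add: tdist_def len_def)
    moreover have "D z (z + k) = 1" using \<open>D 0 k = 1\<close> D_shift[of z 0 k] by simp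
    moreover have "D 0 (z + k) = len z - 1"
    proof -
      have "D 0 (z + k) = D (- z) k" using D_shift[of "- z" 0 "z + k"] by (simp add: group_norm)
      also have "\<dots> = tdist ?u [b]" by (simp only: D_def len_diff kb)
      also have "\<dots> = int (length ?u) - 1" by (subst (1 2) u') (simp add: tdist_def)
      finally show ?thesis using luv by (simp add: len_def)
    qed
    moreover have "len z \<le> D k (z + k)" using min[of k] by (simp add: D_def group_norm)
    moreover have "D 0 z + D k (z + k) \<le> max (D 0 k + D z (z + k)) (D 0 (z + k) + D z k)"
      by (rule four_point_D)
    \<comment> \<open>The four-point condition yields
      \<open>2 * len z \<le> max 2 (2 * len z - 2)\<close>.\<close>
    ultimately have "len z = 1" using z D_sym[of z k] by (auto simp: max_def split: if_splits)
    then have "length ?v = 1" "length ?u = 1" using luv by (simp_all add: len_def)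
    then have v: "?v = [b]" and u: "?u = [b]" using v' u' by (simp, metis One_nat_def diff_Suc_1 length_0_conv length_tl)
    have "- sec ?v + z \<in> gen (- A)" using sec_app[of "[]" z] by simp
    then obtain q where q: "q \<in> gen (- A)" "- k + z = q" by (simp add: v k_def)
    then have zk: "z = k + q" by (metis add_minus_cancel)
    have "app z [b] = push b [move q b]"
      using b q by (simp add: zk app_add app_stab) 
        (metis app_lelt app_stab app_verts k_def list.map(1) list.map(2))
    moreover have "app z [b] = []" using u app_add[of "[]" z "- z"] by (simp add: app_zero)
    \<comment> \<open>The second letter would have to cancel the first, but \<open>move\<close>
      keeps the sign of a letter while \<open>linv\<close> changes it.\<close>
    moreover have "move q b \<noteq> linv b" by (auto simp: move_def linv_def dest: arg_cong[of _ _ snd])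
    ultimately show ?thesis by (simp add: push_def)
  qed
qed

text \<open>A conjugate of least length exists because lengths are natural numbers, and it is
  positive because no conjugate fixes the base vertex. The axis of that conjugate passes through the
  base vertex, so a commuting element of translation 0 fixes this vertex.\<close>

theorem hyperbolic_translation:
  assumes "\<And>g. - g + z + g \<notin> gen (- A)"
  obtains s :: "ugroup \<Rightarrow> int" where
    "\<And>x. x + z = z + x \<Longrightarrow> s x = 0 \<Longrightarrow> \<exists>g. - g + x + g \<in> gen (- A)"
    "\<And>x y. x + z = z + x \<Longrightarrow> y + z = z + y \<Longrightarrow> s (x + y) = s x + s y"
    "s z > 0"
proof -
  obtain g where g: "\<And>h. nat (len (- g + z + g)) \<le> nat (len (- h + z + h))"
    using ex_has_least_nat[of "\<lambda>_. True" undefined "\<lambda>g. nat (len (- g + z + g))"] by blast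
  define z' where "z' = - g + z + g"
  have min: "len z' \<le> len (- h + z' + h)" for h
    using g[of "g + h"] N_nonneg by (simp add: z'_def group_norm nat_le_eq_zle)
  have pos: "len z' > 0"
    using assms[of g] N_nonneg[of z'] len_eq_0_iff[of z'] by (simp add: z'_def less_le)
  obtain s where s: "\<And>x. x + z' = z' + x \<Longrightarrow> \<bar>s x\<bar> = len x"
    "\<And>x y. x + z' = z' + x \<Longrightarrow> y + z' = z' + y \<Longrightarrow> s (x + y) = s x + s y" "s z' = len z'"
    using translation_exists[OF pos linear_growth[OF minimal_conjugate[OF min pos] pos]] by metis
  have comm: "(- g + x + g) + z' = z' + (- g + x + g)" if "x + z = z + x" for x
  proof -
    have "(- g + x + g) + z' = - g + (x + z) + g" "z' + (- g + x + g) = - g + (z + x) + g"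
      by (simp_all add: z'_def group_norm)
    then show ?thesis using that by simp
  qed
  show ?thesis
  proof (rule that[of "\<lambda>x. s (- g + x + g)"])
    show "\<exists>g. - g + x + g \<in> gen (- A)" if "x + z = z + x" "s (- g + x + g) = 0" for x
      using s(1)[OF comm[OF that(1)]] that(2) len_eq_0_iff by auto
    show "s (- g + (x + y) + g) = s (- g + x + g) + s (- g + y + g)"
      if "x + z = z + x" "y + z = z + y" for x y
      using s(2)[OF comm[OF that(1)] comm[OF that(2)]] by (simp add: group_norm)
    show "0 < s (- g + z + g)" using s(3) pos by (simp add: z'_def)
  qed
qed

text \<open>The retraction onto \<open>A\<close> kills \<open>gen (- A)\<close>, but turns a
  conjugate of \<open>x\<close> into another conjugate of \<open>x\<close>.\<close>

lemma gen_disjoint: "x \<in> gen A \<Longrightarrow> - g + x + g \<in> gen (- A) \<Longrightarrow> x = 0"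
proof -
  assume x: "x \<in> gen A" and "- g + x + g \<in> gen (- A)"
  then have "ret A (- g + x + g) = 0" by (simp add: ret_gen_disjoint)
  then have "- ret A g + x + ret A g = 0" using x by (simp add: ret_hom gen_iff_ret)
  then have "ret A g + (- ret A g + x + ret A g) - ret A g = 0" by simp
  then show "x = 0" by (simp add: group_norm)
qed

text \<open>The signed translation is additive on the centralizer of \<open>z\<close>, so it
  vanishes on commutators.\<close>

lemma commutator_elliptic:
  assumes z: "\<And>g. - g + z + g \<notin> gen (- A)" and x: "x + z = z + x" and y: "y + z = z + y"
  shows "\<exists>g. - g + (x + y - x - y) + g \<in> gen (- A)"
proof -
  obtain s :: "ugroup \<Rightarrow> int" where s:
    "\<And>x. x + z = z + x \<Longrightarrow> s x = 0 \<Longrightarrow> \<exists>g. - g + x + g \<in> gen (- A)"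
    "\<And>x y. x + z = z + x \<Longrightarrow> y + z = z + y \<Longrightarrow> s (x + y) = s x + s y" "s z > 0"
    using hyperbolic_translation[OF z] by metis
  have C: "subgrp (cent UNIV z)" by (simp add: subgrp_cent subgrp_UNIV)
  have mC: "a \<in> cent UNIV z \<longleftrightarrow> a + z = z + a" for a by (simp add: cent_def)
  have "s 0 = 0" using s(2)[of 0 0] by simp
  then have sm: "s (- a) = - s a" if "a + z = z + a" for a
    using s(2)[OF that commute_minus[OF that]] by simp
  have "s (x + y + (- x + - y)) = 0"
    using s(2) sm x y C subgrp_add[OF C] subgrp_minus[OF C] unfolding mC by simp
  moreover have "(x + y + (- x + - y)) + z = z + (x + y + (- x + - y))"
  proof -
    have "x \<in> cent UNIV z" "y \<in> cent UNIV z" using x y by (simp_all add: mC)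
    then have "x + y + (- x + - y) \<in> cent UNIV z"
      by (intro subgrp_add[OF C] subgrp_minus[OF C])
    then show ?thesis by (simp only: mC)
  qed
  moreover have "x + y - x - y = x + y + (- x + - y)" by (simp add: group_norm)
  ultimately show ?thesis using s(1) by metis
qed

text \<open>No two vertices of \<open>A\<close> are adjacent, so \<open>gen A\<close> is free; this
  is commutativity of centralizers in a free group. By \<open>gen_disjoint\<close> nonzero elements
  of \<open>gen A\<close> are hyperbolic, and their commuting commutators, being elliptic, are
  0.\<close>

lemma commute_if_hyperbolic:
  assumes "z \<in> gen A" "z \<noteq> 0" "x \<in> gen A" "y \<in> gen A" "x + z = z + x" "y + z = z + y"
  shows "x + y = y + x"
proof -
  obtain g where "- g + (x + y - x - y) + g \<in> gen (- A)"
    using commutator_elliptic[of z x y] gen_disjoint assms by metis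
  moreover have "x + y - x - y \<in> gen A" using assms by (simp add: subgrp_closed[OF subgrp_gen])
  ultimately have "x + y - x - y = 0" using gen_disjoint by blast
  then have "x + y - x - y + y + x = y + x" by simp
  then show ?thesis by (simp add: group_norm)
qed

text \<open>The powers of \<open>v\<close> move the base vertex along a line whose edges all carry
  the same letter; hence its displacement is the absolute exponent sum.\<close>

lemma app_cyclic:
  assumes v: "v \<in> A" and "x \<in> gen {v}"
  shows "app x [] = replicate (nat \<bar>expo v x\<bar>) ((v, gen (lk v)), 0 < expo v x)"
  using assms(2)
proof (induction rule: gen_induct)
  case zero
  then show ?case by (simp add: app_zero)
next
  case (ltr u b y)
  let ?e = "expo v y"
  have a: "app (ltr u b + y) [] = push ((v, gen (lk v)), b) (replicate (nat \<bar>?e\<bar>) ((v, gen (lk v)), 0 < ?e))"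
    using app_ltr[OF app_verts[OF Nil_verts], of v b y] ltr v by (simp add: app_add step_def)
  have e: "expo v (ltr u b + y) = (if b then 1 else - 1) + ?e" using ltr by (simp add: expo_add expo_ltr)
  show ?case
  proof (cases "nat \<bar>?e\<bar>")
    case 0
    then show ?thesis unfolding a e by (simp add: push_def)
  next
    case (Suc n)
    then have "?e = int (Suc n) \<or> ?e = - int (Suc n)" by linarith
    then show ?thesis unfolding a e
      by (cases b) (auto simp: push_def linv_def nat_add_distrib replicate_app_Cons_same)
  qed
qed

lemma len_cyclic: "v \<in> A \<Longrightarrow> x \<in> gen {v} \<Longrightarrow> len x = \<bar>expo v x\<bar>"
  by (simp add: len_def app_cyclic)

lemma expo_cyclic_eq_0: "v \<in> A \<Longrightarrow> x \<in> gen {v} \<Longrightarrow> expo v x = 0 \<Longrightarrow> x = 0"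
  using len_cyclic[of v x] len_eq_0_iff[of x] gen_mono[of "{v}" A] gen_disjoint[of x 0] by auto

lemma expo_nmul: "expo v (nmul n x) = int n * expo v x"
  by (induction n) (simp_all add: expo_add algebra_simps)

lemma nmul_vgen: "nmul n (vgen v) \<in> gen {v}"
  by (simp add: subgrp_nmul[OF subgrp_gen] vgen_in_gen)

text \<open>The axis of a nonzero power z of v passes through the base point, and v translates along it
  by one.\<close>
lemma cent_cyclic:
  assumes v: "v \<in> A" and z: "z \<in> gen {v}" "z \<noteq> 0" and x: "x \<in> gen A" "x + z = z + x"
  shows "x \<in> gen {v}"
proof -
  have e: "expo v z \<noteq> 0" using expo_cyclic_eq_0 v z by blast
  have "nmul k z \<in> gen {v}" for k by (rule subgrp_nmul[OF subgrp_gen z(1)])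
  then have "len (nmul k z) = int k * \<bar>expo v z\<bar>" for k
    by (simp add: len_cyclic[OF v] expo_nmul abs_mult)
  moreover have "0 < \<bar>expo v z\<bar>" using e by simp
  ultimately obtain s where s: "\<And>x. x + z = z + x \<Longrightarrow> \<bar>s x\<bar> = len x"
    "\<And>x y. x + z = z + x \<Longrightarrow> y + z = z + y \<Longrightarrow> s (x + y) = s x + s y"
    using translation_exists[of "\<bar>expo v z\<bar>" z] by metis
  have comm: "y + z = z + y" if "y \<in> gen {v}" for y
    by (rule gen_commute_gen[OF _ that z(1)]) simp
  have "vgen v \<in> gen {v}" by (simp add: vgen_in_gen)
  then have s1: "\<bar>s (vgen v)\<bar> = 1" using s(1)[OF comm] by (simp add: len_cyclic[OF v] expo_ltr)
  have s0: "s 0 = 0" using s(2)[of 0 0] by simp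
  have sn: "s (nmul n (vgen v)) = int n * s (vgen v)" for n
  proof (induction n)
    case (Suc n)
    then show ?case using s(2)[OF comm comm, of "vgen v" "nmul n (vgen v)"] nmul_vgen vgen_in_gen[of v "{v}"]
      by (simp add: algebra_simps)
  qed (simp add: s0)
  have sm: "s (- a) = - s a" if "a + z = z + a" for a
    using s(2)[OF that commute_minus[OF that]] s0 by simp
  \<comment> \<open>Since \<open>v\<close> translates by one in absolute value, some power of
    \<open>v\<close> has the translation of \<open>x\<close> up to sign; \<open>y\<close> corrects
    the sign, and \<open>x + - y\<close> then fixes the base vertex.\<close>
  define m where "m = nmul (nat \<bar>s x\<bar>) (vgen v)"
  have m: "m \<in> gen {v}" "\<bar>s m\<bar> = \<bar>s x\<bar>" using s1 by (simp_all add: m_def sn nmul_vgen abs_mult)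
  define y where "y = (if s m = s x then m else - m)"
  have y: "y \<in> gen {v}" using m subgrp_minus[OF subgrp_gen] by (simp add: y_def)
  have sy: "s y = s x" using m sm[OF comm[OF m(1)]] by (auto simp: y_def)
  have ym: "- y \<in> gen {v}" using y by (rule subgrp_minus[OF subgrp_gen])
  have "s (x + - y) = 0" using s(2)[OF x(2) comm[OF ym]] sm[OF comm[OF y]] sy by simp
  then have "len (x + - y) = 0" using s(1)[OF commute_add[OF x(2) comm[OF ym]]] by simp
  moreover have "gen {v} \<subseteq> gen A" using v by (intro gen_mono) simp
  then have "x + - y \<in> gen A" using x ym subgrp_add[OF subgrp_gen] by blast
  ultimately have "x + - y = 0" using gen_disjoint[of "x + - y" 0] by (simp add: len_eq_0_iff)
  then show ?thesis using y by (metis eq_neg_iff_add_eq_0 minus_minus)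
qed

text \<open>An element commuting with z in gen (- A) moves the base point along z-fixed edges.\<close>
lemma cent_elliptic:
  assumes z: "z \<in> gen (- A)" and x: "x + z = z + x" and K: "subgrp K"
    and fixed: "\<And>p a. p \<in> A \<Longrightarrow> a \<in> gen (- A) \<Longrightarrow> - a + z + a \<in> gen (lk p) \<Longrightarrow> a + vgen p - a \<in> K"
  obtains k q where "x = k + q" "k \<in> K" "q \<in> gen (- A)"
proof -
  let ?w = "app x []"
  have w: "?w \<in> verts" by (simp add: app_verts)
  \<comment> \<open>\<open>z\<close> fixes the base vertex and commutes with \<open>x\<close>, so it
    fixes the image of the base vertex under \<open>x\<close>, letter by letter.\<close>
  have "map (move z) ?w = ?w"
    using app_stab[OF z w] app_add[of "[]" z x] app_add[of "[]" x z] app_stab[OF z, of "[]"] x by simp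
  then have "map (move z) ?w = map (\<lambda>l. l) ?w" by (simp only: list.map_ident)
  then have fix_z: "move z l = l" if "l \<in> set ?w" for l
    unfolding map_eq_conv using that by blast
  have "lelt l \<in> K" if l: "l \<in> set ?w" for l
  proof -
    obtain p b a where lp: "l = ((p, (+) a ` gen (lk p)), b)" "p \<in> A" "a \<in> gen (- A)"
      using w l by (auto simp: verts_def) (metis prod.collapse valid_def)
    have "z + a \<in> (+) z ` (+) a ` gen (lk p)" using subgrp_zero[OF subgrp_gen] by force
    also have "\<dots> = (+) a ` gen (lk p)" using fix_z[OF l] by (simp add: lp(1) move_def)
    finally have "- a + z + a \<in> gen (lk p)" by (auto simp: add.assoc)
    from fixed[OF lp(2,3) this] have "a + vgen p - a \<in> K" "- (a + vgen p - a) \<in> K"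
      using subgrp_minus[OF K] by blast+
    then show ?thesis unfolding lp(1) lelt_eq[OF HOL.refl]
      by (cases b) (simp_all add: ltr_Not[of p True, simplified] group_norm)
  qed
  moreover have "(\<And>l. l \<in> set u \<Longrightarrow> lelt l \<in> K) \<Longrightarrow> sec u \<in> K" for u
    by (induction u) (simp_all add: subgrp_zero[OF K] subgrp_add[OF K])
  ultimately have "sec ?w \<in> K" by blast
  moreover have "- sec ?w + x \<in> gen (- A)" using sec_app[of "[]" x] by simp
  ultimately show ?thesis using that[of "sec ?w" "- sec ?w + x"] by simp
qed

end

section \<open>Centralizers\<close>

context side
begin

text \<open>The multiples \<open>s z\<close> of \<open>u\<close> and \<open>s u\<close> of
  \<open>z\<close> have the same translation along the common axis, hence are equal. The retraction
  annihilates the first and fixes the second, so \<open>s u = 0\<close> and then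
  \<open>u = 0\<close>.\<close>

lemma eq_0_if_retract_fixes_commuting:
  assumes z: "z \<in> gen A" "z \<noteq> 0" "ret S z = z" and u: "u \<in> gen A" "u + z = z + u" "ret S u = 0"
  shows "u = 0"
proof -
  have "- g + z + g \<notin> gen (- A)" for g using gen_disjoint z by blast
  then obtain s :: "ugroup \<Rightarrow> int" where s:
    "\<And>x. x + z = z + x \<Longrightarrow> s x = 0 \<Longrightarrow> \<exists>g. - g + x + g \<in> gen (- A)"
    "\<And>x y. x + z = z + x \<Longrightarrow> y + z = z + y \<Longrightarrow> s (x + y) = s x + s y" "s z > 0"
    using hyperbolic_translation by metis
  have s0: "s 0 = 0" using s(2)[of 0 0] by simp
  have sn: "s (nmul n a) = int n * s a" if "a + z = z + a" for n a
  proof (induction n)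
    case (Suc n)
    then show ?case using s(2)[OF that nmul_commute[OF that]] by (simp add: algebra_simps)
  qed (simp add: s0)
  have sm: "s (- a) = - s a" if "a + z = z + a" for a
    using s(2)[OF that commute_minus[OF that]] s0 by simp
  have zero: "x = 0" if "x \<in> gen A" "x + z = z + x" "s x = 0" for x
    using s(1)[OF that(2,3)] gen_disjoint that(1) by blast
  have *: "u = 0" if u: "u \<in> gen A" "u + z = z + u" "ret S u = 0" and "s u \<ge> 0" for u
  proof -
    let ?a = "nmul (nat (s z)) u" and ?b = "nmul (nat (s u)) z"
    have a: "?a + z = z + ?a" by (rule nmul_commute[OF u(2)])
    have b: "?b + z = z + ?b" by (rule nmul_commute) simp
    have "s (?a + - ?b) = 0"
      using s(2)[OF a commute_minus[OF b]] sm[OF b] sn[OF u(2)] sn[of z] \<open>s u \<ge> 0\<close> s(3) by simp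
    moreover have "?a + - ?b \<in> gen A" using u z by (intro subgrp_closed[OF subgrp_gen] subgrp_nmul[OF subgrp_gen])
    ultimately have "?a + - ?b = 0"
      using zero commute_add[OF a commute_minus[OF b]] by blast
    then have "ret S (?a + - ?b) = 0" by simp
    moreover have "nmul n (0::ugroup) = 0" for n by (induction n) simp_all
    ultimately have "?b = 0" by (simp add: ret_hom ret_nmul u z)
    then have "s u = 0" using sn[of z "nat (s u)"] s0 s(3) \<open>s u \<ge> 0\<close> by simp
    then show ?thesis using zero u by blast
  qed
  show ?thesis
  proof (cases "s u \<ge> 0")
    case False
    then have "- u = 0"
      using *[of "- u"] u sm[OF u(2)] commute_minus[OF u(2)] subgrp_minus[OF subgrp_gen] by (simp add: ret_minus)
    then show ?thesis by simp
  qed (use * u in blast)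
qed

end

definition Piv :: "tvert set" where "Piv = {Pivot i a | i a. True}"

text \<open>The two trees: the base vertex has stabilizer \<open>gen (- Piv)\<close> in the tree of
  \<open>P\<close> and \<open>gen Piv\<close> in the tree of \<open>Q\<close>.\<close>

interpretation P: side Piv
  by unfold_locales (auto simp: Piv_def utree_def)

interpretation Q: side "- Piv"
  rewrites "- (- Piv) = Piv"
  by unfold_locales (auto simp: Piv_def utree_def)

definition interior :: "tvert \<Rightarrow> bool" where "interior v \<longleftrightarrow> v = Center \<or> v \<in> Piv"

definition star :: "tvert \<Rightarrow> tvert set" where "star v = insert v (lk v)"

lemma Center_notin_Piv [simp]: "Center \<notin> Piv"
  by (auto simp: Piv_def)

lemma lk_Center: "lk Center = Piv"
  by (simp add: lk_simps Piv_def)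

text \<open>The second case covers the hair vertices, which are isolated here, the third one the
  leaves.\<close>

lemma non_pivot_cases:
  assumes "p \<in> - Piv"
  obtains "p = Center" | "lk p = {}" | v where "v \<in> Piv" "lk p = {v}" "p \<in> lk v"
proof (cases p)
  case (Leaf i a b)
  then show thesis using that(3)[of "Pivot i a"] by (auto simp: Piv_def lk_simps)
qed (use assms that in \<open>auto simp: Piv_def lk_simps\<close>)

lemma gen_star_commute: "x \<in> gen (star v) \<Longrightarrow> z \<in> gen {v} \<Longrightarrow> x + z = z + x"
  by (rule gen_commute_gen[of "star v" "{v}"]) (auto simp: star_def lk_def utree_sym)

lemma gen_single_commute: "x \<in> gen {v} \<Longrightarrow> z \<in> gen {v} \<Longrightarrow> x + z = z + x"
  by (rule gen_commute_gen[of "{v}" "{v}"]) auto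

lemma lk_commute: "x \<in> gen (lk v) \<Longrightarrow> z \<in> gen {v} \<Longrightarrow> x + z = z + x"
  using gen_star_commute gen_mono[of "lk v" "star v"] by (auto simp: star_def)

lemma conj_commute: "x + z = z + x \<Longrightarrow> (- g + x + g) + (- g + z + g) = (- g + z + g) + (- g + x + (g::'a::group_add))"
proof -
  assume "x + z = z + x"
  then have "- g + (x + z) + g = - g + (z + x) + g" by simp
  then show ?thesis by (simp only: group_norm)
qed

lemma conj_eq_0: "- g + z + g = 0 \<Longrightarrow> z = (0::'a::group_add)"
proof -
  assume "- g + z + g = 0"
  then have "g + (- g + z + g) - g = 0" by simp
  then show ?thesis by (simp add: group_norm)
qed

text \<open>An element of \<open>gen S\<close> is fixed by the retraction, so the conjugator may be
  replaced by its retract.\<close>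

lemma conj_in_gen: "- g + x + g \<in> gen S \<Longrightarrow> - g + x + g = - ret S g + ret S x + ret S g"
  by (metis gen_iff_ret ret_add ret_minus)

lemma commute_conj_eq: "- a + z + a = - b + z + b \<Longrightarrow> (a - b) + z = z + (a - (b::'a::group_add))"
proof -
  assume "- a + z + a = - b + z + b"
  then have "a + (- a + z + a) - b = a + (- b + z + b) - b" by simp
  then show ?thesis by (simp add: group_norm)
qed

text \<open>In the tree of \<open>Q\<close> the element \<open>z\<close> fixes the base vertex. The
  only edges it fixes belong to \<open>Center\<close> and to leaves at \<open>v\<close> with trivial
  conjugator, so \<open>x\<close> is an element of \<open>gen (lk v)\<close> plus some
  \<open>q\<close> in the free group \<open>gen Piv\<close>; \<open>q\<close> commutes with
  \<open>z\<close> and is therefore a power of \<open>v\<close>.\<close>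

lemma cent_pivot:
  assumes v: "v \<in> Piv" and z: "z \<in> gen {v}" "z \<noteq> 0" and x: "x + z = z + x"
  shows "x \<in> gen (star v)"
proof -
  have zP: "z \<in> gen Piv" using z v gen_mono[of "{v}" Piv] by auto
  obtain k q where kq: "x = k + q" "k \<in> gen (lk v)" "q \<in> gen Piv"
  proof (rule Q.cent_elliptic[OF zP x subgrp_gen[of "lk v"]])
    fix p a assume p: "p \<in> - Piv" and a: "a \<in> gen Piv" "- a + z + a \<in> gen (lk p)"
    from p show "a + vgen p - a \<in> gen (lk v)"
    proof (cases rule: non_pivot_cases)
      case 1
      have "a + vgen p = vgen p + a"
        by (rule lk_commute[of _ p]) (use a 1 in \<open>simp_all add: lk_Center vgen_in_gen\<close>)
      moreover have "p \<in> lk v" using 1 v by (auto simp: Piv_def lk_simps)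
      ultimately show ?thesis by (simp add: vgen_in_gen)
    next
      case 2
      then have "- a + z + a = 0" using a by (simp add: gen_empty)
      from conj_eq_0[OF this] show ?thesis using z by simp
    next
      case (3 v')
      have e: "- a + z + a = - ret {v'} a + ret {v'} z + ret {v'} a"
        by (rule conj_in_gen) (use a 3 in simp)
      have "v' = v"
      proof (rule ccontr)
        assume "v' \<noteq> v"
        then have "ret {v'} z = 0" using z by (intro ret_gen_disjoint) auto
        then show False using e conj_eq_0[of a z] z by simp
      qed
      moreover have "- r + z + r = - 0 + z + 0" if "r \<in> gen {v}" for r
        using gen_single_commute[OF z(1) that] by (simp add: add.assoc)
      moreover have "ret {v} z = z" using z by (simp add: gen_iff_ret)
      ultimately have "- a + z + a = - 0 + z + 0" using e ret_in_gen by metis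
      from commute_conj_eq[OF this] have "a \<in> gen {v}"
        using P.cent_cyclic[OF v z a(1)] by simp
      then have "vgen p + a = a + vgen p"
        using 3 \<open>v' = v\<close> by (intro lk_commute[of _ v]) (simp_all add: vgen_in_gen)
      then have "a + vgen p - a = vgen p" by (metis add_diff_cancel)
      then show ?thesis using 3 \<open>v' = v\<close> by (simp add: vgen_in_gen)
    qed
  qed
  have k: "k + z = z + k" using kq z lk_commute by blast
  have "q = - k + x" using kq by simp
  then have "q + z = z + q" using commute_add[OF commute_minus[OF k] x] by simp
  then have "q \<in> gen {v}" using P.cent_cyclic[OF v z kq(3)] by blast
  moreover have "gen {v} \<subseteq> gen (star v)" "gen (lk v) \<subseteq> gen (star v)"
    by (auto intro!: gen_mono simp: star_def)
  ultimately show ?thesis using kq subgrp_add[OF subgrp_gen] by blast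
qed

text \<open>The same argument in the tree of \<open>P\<close>. Here \<open>z\<close> can fix the
  edge of a pivot \<open>p\<close> and a conjugator \<open>a\<close> only if \<open>a\<close> lies
  in \<open>gen (lk p)\<close>: the difference of \<open>a\<close> and its retract commutes with
  \<open>z\<close>, hence is a power of \<open>Center\<close>, which lies in the link of
  \<open>p\<close>.\<close>

lemma cent_Center:
  assumes z: "z \<in> gen {Center}" "z \<noteq> 0" and x: "x + z = z + x"
  shows "x \<in> gen (star Center)"
proof -
  have C: "Center \<in> - Piv" by simp
  have zQ: "z \<in> gen (- Piv)" using z gen_mono[of "{Center}" "- Piv"] by auto
  obtain k q where kq: "x = k + q" "k \<in> gen Piv" "q \<in> gen (- Piv)"
  proof (rule P.cent_elliptic[OF zQ x subgrp_gen[of Piv]])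
    fix p a assume p: "p \<in> Piv" and a: "a \<in> gen (- Piv)" "- a + z + a \<in> gen (lk p)"
    have Cp: "Center \<in> lk p" using p by (auto simp: Piv_def lk_simps)
    then have zp: "z \<in> gen (lk p)" using z gen_mono[of "{Center}" "lk p"] by auto
    let ?r = "ret (lk p) a"
    have "- a + z + a = - ?r + z + ?r" using conj_in_gen[OF a(2)] zp by (simp add: gen_iff_ret)
    from commute_conj_eq[OF this] have "a - ?r \<in> gen {Center}"
    proof (rule Q.cent_cyclic[OF C z, rotated])
      have "?r \<in> gen (- Piv)" using ret_in_gen gen_mono[OF P.lk_disjoint[OF p]] by blast
      then show "a - ?r \<in> gen (- Piv)" using a by (simp add: subgrp_diff[OF subgrp_gen])
    qed
    then have "a - ?r \<in> gen (lk p)" using gen_mono[of "{Center}" "lk p"] Cp by auto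
    then have "(a - ?r) + ?r \<in> gen (lk p)" using ret_in_gen subgrp_add[OF subgrp_gen] by blast
    then have "a + vgen p = vgen p + a" by (intro lk_commute[of _ p]) (simp_all add: vgen_in_gen)
    then have "a + vgen p - a = vgen p" by simp
    then show "a + vgen p - a \<in> gen Piv" using p by (simp add: vgen_in_gen)
  qed
  have k: "k + z = z + k" using kq z lk_commute[of k Center z] by (simp add: lk_Center)
  have "q = - k + x" using kq by simp
  then have "q + z = z + q" using commute_add[OF commute_minus[OF k] x] by simp
  then have "q \<in> gen {Center}" using Q.cent_cyclic[OF C z kq(3)] by blast
  moreover have "gen {Center} \<subseteq> gen (star Center)" "gen Piv \<subseteq> gen (star Center)"
    by (auto intro!: gen_mono simp: star_def lk_Center)
  ultimately show ?thesis using kq subgrp_add[OF subgrp_gen] by blast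
qed

theorem cent_interior:
  assumes "interior v" "z \<in> gen {v}" "z \<noteq> 0"
  shows "x + z = z + x \<longleftrightarrow> x \<in> gen (star v)"
  using assms cent_pivot cent_Center gen_star_commute by (auto simp: interior_def)

lemma four_commute:
  fixes k q k' q' :: "'a::group_add"
  assumes "k + k' = k' + k" "k + q' = q' + k" "q + k' = k' + q" "q + q' = q' + q"
  shows "(k + q) + (k' + q') = (k' + q') + (k + q)"
  using commute_add[OF commute_add[OF assms(1,3), symmetric, THEN HOL.sym] HOL.refl]
  by (metis add.assoc assms)

text \<open>If no conjugate of \<open>z\<close> is a power of a pivot, \<open>z\<close> fixes no
  edge of a leaf in the tree of \<open>Q\<close>. Then each centralizing element is a power of
  \<open>Center\<close> plus an element of \<open>gen Piv\<close> centralizing \<open>z\<close>, and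
  such elements commute with each other.\<close>

lemma noncommuting_cent_Piv:
  assumes z: "z \<in> gen Piv" "z \<noteq> 0" and x: "x + z = z + x" and y: "y + z = z + y"
    and xy: "x + y \<noteq> y + x"
  shows "\<exists>g v. v \<in> Piv \<and> - g + z + g \<in> gen {v}"
proof (rule ccontr)
  assume contra: "\<not> ?thesis"
  have decomp: "\<exists>k q. x = k + q \<and> k \<in> gen {Center} \<and> q \<in> gen Piv \<and> q + z = z + q"
    if x: "x + z = z + x" for x
  proof -
    obtain k q where kq: "x = k + q" "k \<in> gen {Center}" "q \<in> gen Piv"
    proof (rule Q.cent_elliptic[OF z(1) x subgrp_gen[of "{Center}"]])
      fix p a assume p: "p \<in> - Piv" and a: "a \<in> gen Piv" "- a + z + a \<in> gen (lk p)"
      from p show "a + vgen p - a \<in> gen {Center}"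
      proof (cases rule: non_pivot_cases)
        case 1
        have "a + vgen p = vgen p + a"
          by (rule lk_commute[of _ p]) (use a 1 in \<open>simp_all add: lk_Center vgen_in_gen\<close>)
        then show ?thesis by (simp add: vgen_in_gen 1)
      next
        case 2
        then have "- a + z + a = 0" using a by (simp add: gen_empty)
        from conj_eq_0[OF this] show ?thesis using z by simp
      next
        case (3 v)
        then show ?thesis using contra a by auto
      qed
    qed
    have "z + k = k + z" using kq z lk_commute[of z Center k] by (simp add: lk_Center)
    from commute_add[OF commute_minus[OF this[symmetric]] x] show ?thesis using kq by auto
  qed
  obtain k q k' q' where kq: "x = k + q" "k \<in> gen {Center}" "q \<in> gen Piv" "q + z = z + q"
    and kq': "y = k' + q'" "k' \<in> gen {Center}" "q' \<in> gen Piv" "q' + z = z + q'"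
    using decomp[OF x] decomp[OF y] by blast
  have "q + q' = q' + q" by (rule P.commute_if_hyperbolic[OF z kq(3) kq'(3) kq(4) kq'(4)])
  moreover have "k + k' = k' + k" by (rule gen_single_commute[OF kq(2) kq'(2)])
  moreover have "k + q' = q' + k" "q + k' = k' + q"
    using lk_commute[of q' Center k] lk_commute[of q Center k'] kq kq' by (simp_all add: lk_Center)
  ultimately show False using xy four_commute kq(1) kq'(1) by blast
qed

text \<open>If no conjugate of \<open>z\<close> is a power of \<open>Center\<close>, all edges at
  the base vertex fixed by \<open>z\<close> in the tree of \<open>P\<close> carry the same letter up
  to sign. Without such an edge the centralizer lies in the free group \<open>gen (- Piv)\<close>;
  with one it splits into powers of a conjugate of \<open>p\<close> and elements commuting with
  these. Both are abelian.\<close>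

lemma noncommuting_cent_non_Piv:
  assumes z: "z \<in> gen (- Piv)" "z \<noteq> 0" and x: "x + z = z + x" and y: "y + z = z + y"
    and xy: "x + y \<noteq> y + x"
  shows "\<exists>g. - g + z + g \<in> gen {Center}"
proof (rule ccontr)
  assume contra: "\<not> ?thesis"
  \<comment> \<open>\<open>F p a\<close> says that \<open>z\<close> fixes the edge of the letter
    given by \<open>p\<close> and the coset of \<open>a\<close>.\<close>
  define F where "F = (\<lambda>p a. p \<in> Piv \<and> a \<in> gen (- Piv) \<and> - a + z + a \<in> gen (lk p))"
  have lkP: "gen (lk p) \<subseteq> gen (- Piv)" if "p \<in> Piv" for p by (rule gen_mono[OF P.lk_disjoint[OF that]])
  have unique: "p' = p \<and> - a + a' \<in> gen (lk p)" if F: "F p a" "F p' a'" for p a p' a'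
  proof -
    define z1 b where "z1 = - a + z + a" and "b = - a + a'"
    have z1: "z1 \<in> gen (lk p)" "z1 \<in> gen (- Piv)" "z1 \<noteq> 0"
      using F lkP z conj_eq_0[of a z] by (auto simp: F_def z1_def)
    have b: "b \<in> gen (- Piv)" using F subgrp_closed[OF subgrp_gen] by (auto simp: F_def b_def)
    have "- b + z1 + b = - a' + z + a'" by (simp add: b_def z1_def group_norm)
    then have zb: "- b + z1 + b \<in> gen (lk p')" using F by (simp add: F_def)
    let ?r = "ret (lk p') b"
    have e: "- b + z1 + b = - ?r + ret (lk p') z1 + ?r" by (rule conj_in_gen[OF zb])
    have "p' = p"
    proof (rule ccontr)
      assume "p' \<noteq> p"
      \<comment> \<open>Different pivots have only \<open>Center\<close> as a common neighbour, so
        retracting from one link to the other would make \<open>z\<close> conjugate to a power of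
        \<open>Center\<close>.\<close>
      then have "lk p' \<inter> lk p = {Center}" using F by (auto simp: F_def Piv_def lk_simps)
      moreover have "ret (lk p') z1 = ret (lk p' \<inter> lk p) z1"
        using z1 ret_ret[of "lk p'" "lk p" z1] by (simp add: gen_iff_ret)
      ultimately have c: "ret (lk p') z1 \<in> gen {Center}" using ret_in_gen by metis
      have "?r + (- b + z1 + b) - ?r = ret (lk p') z1" unfolding e by (simp add: group_norm)
      then have "- (a + b - ?r) + z + (a + b - ?r) = ret (lk p') z1"
        by (simp add: z1_def group_norm)
      then show False using c contra by metis
    qed
    \<comment> \<open>For equal pivots, \<open>b\<close> and its retract conjugate \<open>z1\<close>
      to the same element, so their difference commutes with \<open>z1\<close> and is killed by the
      retraction that fixes \<open>z1\<close>.\<close>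
    moreover have "b - ?r = 0"
    proof (rule Q.eq_0_if_retract_fixes_commuting[OF z1(2,3)])
      show r: "ret (lk p') z1 = z1" using z1 \<open>p' = p\<close> by (simp add: gen_iff_ret)
      have "?r \<in> gen (- Piv)" using ret_in_gen lkP F by (auto simp: F_def)
      then show "b - ?r \<in> gen (- Piv)" using b by (simp add: subgrp_diff[OF subgrp_gen])
      show "(b - ?r) + z1 = z1 + (b - ?r)" using commute_conj_eq[of b z1 ?r] e r by simp
      show "ret (lk p') (b - ?r) = 0" by (simp add: ret_diff ret_ret)
    qed
    then have "b = ?r" by simp
    then have "b \<in> gen (lk p')" using ret_in_gen by metis
    ultimately show ?thesis by (simp add: b_def)
  qed
  show False
  proof (cases "\<exists>p a. F p a")
    case False
    have "x \<in> gen (- Piv)" if x: "x + z = z + x" for x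
    proof (rule P.cent_elliptic[OF z(1) x, of "{0}"])
      show "subgrp {0}" by (simp add: subgrp_def)
    qed (use False in \<open>auto simp: F_def\<close>)
    then show False using Q.commute_if_hyperbolic[OF z _ _ x y] x y xy by blast
  next
    case True
    then obtain p a where F: "F p a" by blast
    let ?K = "conj_set a (gen {p})"
    have decomp: "\<exists>k q. x = k + q \<and> k \<in> ?K \<and> q \<in> gen (- Piv) \<and> q + z = z + q \<and> - a + q + a \<in> gen (lk p)"
      if x: "x + z = z + x" for x
    proof -
      obtain k q where kq: "x = k + q" "k \<in> ?K" "q \<in> gen (- Piv)"
      proof (rule P.cent_elliptic[OF z(1) x subgrp_conj_set[OF subgrp_gen]])
        fix p' a' assume "p' \<in> Piv" "a' \<in> gen (- Piv)" "- a' + z + a' \<in> gen (lk p')"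
        then have F': "F p' a'" by (simp add: F_def)
        from unique[OF F F'] have u: "p' = p" "- a + a' \<in> gen (lk p)" by auto
        have "(- a + a') + vgen p = vgen p + (- a + a')"
          by (rule lk_commute[OF u(2)]) (simp add: vgen_in_gen)
        then have "(- a + a') + vgen p - (- a + a') = vgen p" by simp
        then have "- a + (a' + vgen p' - a') + a = vgen p" using u(1) by (simp add: group_norm)
        then show "a' + vgen p' - a' \<in> ?K" by (simp add: mem_conj_set vgen_in_gen)
      qed
      have "(- a + z + a) + (- a + k + a) = (- a + k + a) + (- a + z + a)"
        using F kq by (intro lk_commute[of _ p]) (auto simp: F_def mem_conj_set)
      then have "a + ((- a + z + a) + (- a + k + a)) - a = a + ((- a + k + a) + (- a + z + a)) - a" by simp
      then have k: "k + z = z + k" by (simp add: group_norm)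
      have qz: "q + z = z + q" using commute_add[OF commute_minus[OF k] x] kq by simp
      \<comment> \<open>As \<open>q\<close> commutes with \<open>z\<close>, it carries the fixed
        edge to a fixed edge, which by uniqueness is the same one.\<close>
      have "- (q + a) + z + (q + a) = - a + (- q + (z + q)) + a" by (simp add: group_norm)
      also have "\<dots> = - a + z + a" by (simp flip: qz add: group_norm)
      finally have "F p (q + a)" using F kq subgrp_add[OF subgrp_gen] by (auto simp: F_def)
      from unique[OF F this] have "- a + q + a \<in> gen (lk p)" by (simp add: add.assoc)
      then show ?thesis using kq qz by blast
    qed
    obtain k q k' q' where kq: "x = k + q" "k \<in> ?K" "q \<in> gen (- Piv)" "q + z = z + q" "- a + q + a \<in> gen (lk p)"
      and kq': "y = k' + q'" "k' \<in> ?K" "q' \<in> gen (- Piv)" "q' + z = z + q'" "- a + q' + a \<in> gen (lk p)"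
      using decomp[OF x] decomp[OF y] by blast
    have lift: "s + t = t + s" if "(- a + s + a) + (- a + t + a) = (- a + t + a) + (- a + s + a)" for s t
    proof -
      have "a + ((- a + s + a) + (- a + t + a)) - a = a + ((- a + t + a) + (- a + s + a)) - a"
        using that by simp
      then show ?thesis by (simp add: group_norm)
    qed
    have "q + q' = q' + q" by (rule Q.commute_if_hyperbolic[OF z kq(3) kq'(3) kq(4) kq'(4)])
    moreover have "k + k' = k' + k"
      by (rule lift, rule gen_single_commute[of _ p]) (use kq kq' in \<open>simp_all add: mem_conj_set\<close>)
    moreover have "q + k' = k' + q" "q' + k = k + q'"
      by (rule lift, rule lk_commute[of _ p]; use kq kq' in \<open>simp add: mem_conj_set\<close>)+
    ultimately show False using xy four_commute[of k k' q' q] kq(1) kq'(1) by metis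
  qed
qed

text \<open>A non-abelian centralizer forces z to be elliptic in one of the two trees: otherwise
  commutators of elements of the centralizer are elliptic in both, hence trivial.\<close>
theorem noncommuting_cent:
  assumes z: "z \<noteq> 0" and x: "x + z = z + x" and y: "y + z = z + y" and xy: "x + y \<noteq> y + x"
  shows "\<exists>g v. interior v \<and> - g + z + g \<in> gen {v}"
proof -
  have conj: "(- g + x + g) + (- g + z + g) = (- g + z + g) + (- g + x + g)"
    "(- g + y + g) + (- g + z + g) = (- g + z + g) + (- g + y + g)"
    "(- g + x + g) + (- g + y + g) \<noteq> (- g + y + g) + (- g + x + g)" "- g + z + g \<noteq> 0" for g
  proof -
    show "(- g + x + g) + (- g + y + g) \<noteq> (- g + y + g) + (- g + x + g)"
    proof
      assume "(- g + x + g) + (- g + y + g) = (- g + y + g) + (- g + x + g)"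
      from conj_commute[OF this, of "- g"] show False using xy by (simp add: group_norm)
    qed
  qed (use conj_commute[OF x] conj_commute[OF y] conj_eq_0[of g z] z in auto)
  have comp: "- (g + h) + z + (g + h) = - h + (- g + z + g) + h" for g h by (simp add: group_norm)
  consider g where "- g + z + g \<in> gen Piv" | g where "- g + z + g \<in> gen (- Piv)"
    | "\<And>g. - g + z + g \<notin> gen Piv" "\<And>g. - g + z + g \<notin> gen (- Piv)" by blast
  then show ?thesis
  proof cases
    case (1 g)
    from noncommuting_cent_Piv[OF this conj(4,1,2,3)] show ?thesis
      unfolding comp[symmetric] interior_def by blast
  next
    case (2 g)
    from noncommuting_cent_non_Piv[OF this conj(4,1,2,3)] show ?thesis
      unfolding comp[symmetric] interior_def by blast
  next
    case 3
    let ?k = "x + y - x - y"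
    obtain g h where g: "- g + ?k + g \<in> gen (- Piv)" and h: "- h + ?k + h \<in> gen Piv"
      using P.commutator_elliptic[OF 3(2) x y] Q.commutator_elliptic[OF 3(1) x y] by blast
    have "- (- h + g) + (- h + ?k + h) + (- h + g) = - g + ?k + g" by (simp add: group_norm)
    then have "- h + ?k + h = 0" using P.gen_disjoint[OF h, of "- h + g"] g by simp
    then have "?k = 0" by (rule conj_eq_0)
    then have "x + y - x - y + y + x = y + x" by simp
    then show ?thesis using xy by (simp add: group_norm)
  qed
qed

section \<open>Counting homomorphisms to a group of order two\<close>

text \<open>Homomorphisms from C to the group of order two that vanish on Z, given by their kernels.\<close>
definition hom2 :: "'a::group_add set \<Rightarrow> 'a set \<Rightarrow> 'a set set" where
  "hom2 C Z = {S. S \<subseteq> C \<and> Z \<subseteq> S \<and> (\<forall>x\<in>C. \<forall>y\<in>C. x + y \<in> S \<longleftrightarrow> (x \<in> S \<longleftrightarrow> y \<in> S))}"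

lemma card_hom2_image:
  fixes f :: "'a::group_add \<Rightarrow> 'b::group_add"
  assumes C: "subgrp C" and inj: "inj_on f C" and "Z \<subseteq> C"
    and hom: "\<And>x y. x \<in> C \<Longrightarrow> y \<in> C \<Longrightarrow> f (x + y) = f x + f y"
  shows "card (hom2 (f ` C) (f ` Z)) = card (hom2 C Z)"
proof -
  have mem: "f x \<in> f ` S \<longleftrightarrow> x \<in> S" if "x \<in> C" "S \<subseteq> C" for x S
    using that inj by (meson image_eqI inj_on_image_mem_iff)
  have "hom2 (f ` C) (f ` Z) = (`) f ` hom2 C Z"
  proof (intro equalityI subsetI)
    fix T assume T: "T \<in> hom2 (f ` C) (f ` Z)"
    define S where "S = {x \<in> C. f x \<in> T}"
    have "T = f ` S" using T by (auto simp: S_def hom2_def)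
    moreover have "S \<in> hom2 C Z"
      using T assms(3) hom subgrp_add[OF C] by (fastforce simp: S_def hom2_def)
    ultimately show "T \<in> (`) f ` hom2 C Z" by blast
  next
    fix T assume "T \<in> (`) f ` hom2 C Z"
    then obtain S where S: "S \<in> hom2 C Z" "T = f ` S" by blast
    have SC: "S \<subseteq> C" using S by (simp add: hom2_def)
    have "f x + f y \<in> f ` S \<longleftrightarrow> (f x \<in> f ` S \<longleftrightarrow> f y \<in> f ` S)" if "x \<in> C" "y \<in> C" for x y
      using S that subgrp_add[OF C that] SC by (simp add: hom2_def mem flip: hom)
    then show "T \<in> hom2 (f ` C) (f ` Z)" using S SC by (auto simp: hom2_def)
  qed
  moreover have "inj_on ((`) f) (hom2 C Z)"
    using inj by (intro inj_onI) (auto simp: hom2_def inj_on_image_eq_iff)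
  ultimately show ?thesis by (simp add: card_image)
qed

lemma gen_induct_right [consumes 1, case_names zero ltr]:
  assumes "x \<in> gen S" "P 0" "\<And>v b y. v \<in> S \<Longrightarrow> y \<in> gen S \<Longrightarrow> P y \<Longrightarrow> P (y + ltr v b)"
  shows "P x"
proof -
  have "- x \<in> gen S" using assms(1) by (rule subgrp_minus[OF subgrp_gen])
  then have "P (- (- x))"
  proof (induction rule: gen_induct)
    case (ltr v b y)
    then have "P (- y + ltr v (\<not> b))" using assms(3) subgrp_minus[OF subgrp_gen] by blast
    then show ?case by (simp add: ltr_Not minus_add)
  qed (use assms in simp)
  then show ?thesis by simp
qed

text \<open>Modulo \<open>gen {c}\<close> the group \<open>S\<close> is free on \<open>R\<close> and
  \<open>K\<close> has finite index in it. The aim is Schreier's index formula for the rank of the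
  quotient of \<open>K\<close>, obtained by counting instead of by constructing a basis.\<close>

locale schreier =
  fixes c :: tvert and R :: "tvert set" and K :: "ugroup set"
  assumes interior_c: "interior c" and R: "R \<subseteq> lk c" and finR: "finite R"
    and K: "subgrp K" and cK: "gen {c} \<subseteq> K" and KS: "K \<subseteq> gen (insert c R)"
    and fin: "finite (rcoset K ` gen (insert c R))"
begin

abbreviation S :: "ugroup set" where "S \<equiv> gen (insert c R)"
abbreviation Om :: "ugroup set set" where "Om \<equiv> rcoset K ` S"

lemma S: "subgrp S" by (rule subgrp_gen)

lemma c_commute: "t \<in> gen {c} \<Longrightarrow> x \<in> S \<Longrightarrow> t + x = x + t"
proof -
  assume t: "t \<in> gen {c}" and "x \<in> S"
  moreover have "S \<subseteq> gen (star c)" by (rule gen_mono) (use R in \<open>auto simp: star_def\<close>)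
  ultimately show "t + x = x + t" using gen_star_commute[of x c t] by auto
qed

lemma RS: "v \<in> R \<Longrightarrow> ltr v b \<in> S"
  by (rule ltr_in_gen) simp

lemma R_adjacent: "v \<in> R \<Longrightarrow> utree c v"
  using R by (auto simp: lk_def)

lemma R_not_adjacent: "u \<in> R \<Longrightarrow> v \<in> R \<Longrightarrow> \<not> utree u v"
  using R_adjacent P.bipartite by metis

definition rep :: "ugroup set \<Rightarrow> ugroup" where "rep q = (SOME s. s \<in> S \<and> rcoset K s = q)"

lemma rep: "q \<in> Om \<Longrightarrow> rep q \<in> S" "q \<in> Om \<Longrightarrow> rcoset K (rep q) = q"
proof -
  have "rep q \<in> S \<and> rcoset K (rep q) = q" if "q \<in> Om"
  proof -
    from that have "\<exists>s. s \<in> S \<and> rcoset K s = q" by blast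
    from someI_ex[OF this] show ?thesis by (simp add: rep_def)
  qed
  then show "q \<in> Om \<Longrightarrow> rep q \<in> S" "q \<in> Om \<Longrightarrow> rcoset K (rep q) = q" by blast+
qed

lemma diff_rep: "x \<in> S \<Longrightarrow> x - rep (rcoset K x) \<in> K"
  using rep[of "rcoset K x"] rcoset_eq_iff[OF K, of x "rep (rcoset K x)"] by auto

text \<open>Functions theta on S (to the group of order two) with theta (k + x) - theta x = phi k for
  a homomorphism phi on K that vanishes on c. They are counted in two ways: by phi and the values on
  coset representatives, and by theta 0 and the differences theta (x + v) - theta x, v in R.\<close>
definition thetas :: "ugroup set set" where
  "thetas = {T. T \<subseteq> S \<and> (\<forall>k\<in>K. \<forall>x\<in>S. (k + x \<in> T \<longleftrightarrow> k \<in> T) \<longleftrightarrow> (x \<in> T \<longleftrightarrow> 0 \<in> T)) \<and>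
     (\<forall>t\<in>gen {c}. t \<in> T \<longleftrightarrow> 0 \<in> T)}"

lemma thetasD: "T \<in> thetas \<Longrightarrow> k \<in> K \<Longrightarrow> x \<in> S \<Longrightarrow> (k + x \<in> T \<longleftrightarrow> k \<in> T) \<longleftrightarrow> (x \<in> T \<longleftrightarrow> 0 \<in> T)"
  and thetas_c: "T \<in> thetas \<Longrightarrow> t \<in> gen {c} \<Longrightarrow> t \<in> T \<longleftrightarrow> 0 \<in> T"
  and thetas_S: "T \<in> thetas \<Longrightarrow> T \<subseteq> S"
  by (simp_all add: thetas_def)

lemma card_thetas_1: "card thetas = card (hom2 K (gen {c})) * 2 ^ card Om"
proof -
  \<comment> \<open>A set encodes a function to the group of order two with membership as the
    neutral value, so logical equivalence is the group operation. \<open>F\<close> normalizes by the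
    value at 0 on \<open>K\<close> and records the values at representatives.\<close>
  define F where "F = (\<lambda>T. ({k \<in> K. k \<in> T \<longleftrightarrow> 0 \<in> T}, {q \<in> Om. rep q \<in> T}))"
  define G where "G = (\<lambda>(Ph, U). {x \<in> S. (x - rep (rcoset K x) \<in> Ph) \<longleftrightarrow> rcoset K x \<in> U})"
  have GF: "G (F T) = T" if T: "T \<in> thetas" for T
  proof -
    have "x \<in> G (F T) \<longleftrightarrow> x \<in> T" if x: "x \<in> S" for x
    proof -
      let ?r = "rep (rcoset K x)"
      have "(x - ?r + ?r \<in> T \<longleftrightarrow> x - ?r \<in> T) \<longleftrightarrow> (?r \<in> T \<longleftrightarrow> 0 \<in> T)"
        using thetasD[OF T diff_rep[OF x], of ?r] rep x by blast
      then show ?thesis using x diff_rep[OF x] by (auto simp: G_def F_def)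
    qed
    moreover have "G (F T) \<subseteq> S" by (auto simp: G_def F_def)
    ultimately show ?thesis using thetas_S[OF T] by blast
  qed
  have F: "F T \<in> hom2 K (gen {c}) \<times> Pow Om" if T: "T \<in> thetas" for T
  proof -
    have "x + y \<in> T \<longleftrightarrow> (x \<in> T \<longleftrightarrow> (y \<in> T \<longleftrightarrow> 0 \<in> T))" if "x \<in> K" "y \<in> K" for x y
      using thetasD[OF T that(1), of y] that(2) KS by blast
    then show ?thesis using cK thetas_c[OF T] subgrp_add[OF K] by (auto simp: F_def hom2_def)
  qed
  have G: "G (Ph, U) \<in> thetas" "F (G (Ph, U)) = (Ph, U)"
    if Ph: "Ph \<in> hom2 K (gen {c})" and U: "U \<subseteq> Om" for Ph U
  proof -
    let ?T = "G (Ph, U)"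
    have PhK: "Ph \<subseteq> K" "\<And>x y. x \<in> K \<Longrightarrow> y \<in> K \<Longrightarrow> x + y \<in> Ph \<longleftrightarrow> (x \<in> Ph \<longleftrightarrow> y \<in> Ph)"
      "\<And>t. t \<in> gen {c} \<Longrightarrow> t \<in> Ph" using Ph by (auto simp: hom2_def)
    have T: "x \<in> ?T \<longleftrightarrow> (x - rep (rcoset K x) \<in> Ph \<longleftrightarrow> rcoset K x \<in> U)" if "x \<in> S" for x
      using that by (simp add: G_def)
    have kT: "k + x \<in> ?T \<longleftrightarrow> (k \<in> Ph \<longleftrightarrow> x \<in> ?T)" if k: "k \<in> K" and x: "x \<in> S" for k x
    proof -
      have kx: "k + x \<in> S" using k x KS subgrp_add[OF S] by blast
      have q: "rcoset K (k + x) = rcoset K x" using k by (rule rcoset_absorb[OF K])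
      have "k + x - rep (rcoset K x) = k + (x - rep (rcoset K x))" by (simp add: group_norm)
      then have "k + x - rep (rcoset K x) \<in> Ph \<longleftrightarrow> (k \<in> Ph \<longleftrightarrow> x - rep (rcoset K x) \<in> Ph)"
        using PhK(2)[OF k diff_rep[OF x]] by simp
      then show ?thesis using T[OF kx] T[OF x] q by auto
    qed
    have S0: "0 \<in> S" by (rule subgrp_zero[OF S])
    have k0: "k \<in> ?T \<longleftrightarrow> (k \<in> Ph \<longleftrightarrow> 0 \<in> ?T)" if "k \<in> K" for k using kT[OF that S0] by simp
    show "?T \<in> thetas"
    proof -
      have "(k + x \<in> ?T \<longleftrightarrow> k \<in> ?T) \<longleftrightarrow> (x \<in> ?T \<longleftrightarrow> 0 \<in> ?T)" if "k \<in> K" "x \<in> S" for k x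
        using kT[OF that] k0[OF that(1)] by blast
      moreover have "t \<in> ?T \<longleftrightarrow> 0 \<in> ?T" if "t \<in> gen {c}" for t
        using k0[of t] PhK(3)[OF that] cK that by blast
      moreover have "?T \<subseteq> S" by (auto simp: G_def)
      ultimately show ?thesis unfolding thetas_def by blast
    qed
    have "rep q \<in> ?T \<longleftrightarrow> q \<in> U" if "q \<in> Om" for q
      using T[OF rep(1)[OF that]] rep(2)[OF that] PhK(3)[OF subgrp_zero[OF subgrp_gen]] by simp
    then have "{q \<in> Om. rep q \<in> ?T} = U" using U by blast
    moreover have "{k \<in> K. k \<in> ?T \<longleftrightarrow> 0 \<in> ?T} = Ph" using k0 PhK(1) by blast
    ultimately show "F ?T = (Ph, U)" by (simp add: F_def)
  qed
  have "bij_betw F thetas (hom2 K (gen {c}) \<times> Pow Om)"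
  proof (rule bij_betw_byWitness[where f' = G])
    show "\<forall>T\<in>thetas. G (F T) = T" using GF by blast
    show "\<forall>p\<in>hom2 K (gen {c}) \<times> Pow Om. F (G p) = p" using G(2) by (auto simp del: split_paired_All)
    show "F ` thetas \<subseteq> hom2 K (gen {c}) \<times> Pow Om" using F by blast
    show "G ` (hom2 K (gen {c}) \<times> Pow Om) \<subseteq> thetas" using G(1) by blast
  qed
  then have "card thetas = card (hom2 K (gen {c}) \<times> Pow Om)" by (rule bij_betw_same_card)
  then show ?thesis using fin by (simp add: card_cartesian_product card_Pow)
qed

text \<open>A walk in the Schreier graph that carries a bit: crossing the edge \<open>(q, v)\<close>
  from \<open>q\<close> to its translate by \<open>v\<close> flips the bit iff the edge belongs to
  \<open>E\<close>. An inverse letter crosses backwards the edge that starts at the new coset, and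
  letters outside \<open>R\<close> do nothing.\<close>

definition rstep :: "(ugroup set \<times> tvert) set \<Rightarrow> ugroup set \<times> bool \<Rightarrow> tvert \<times> bool \<Rightarrow> ugroup set \<times> bool" where
  "rstep E st p = (if fst p \<in> R then
      let q = fst st; q' = (\<lambda>y. y + el [p]) ` q in
        (q', snd st \<noteq> (((if snd p then q else q'), fst p) \<in> E)) else st)"

definition ract :: "(ugroup set \<times> tvert) set \<Rightarrow> ugroup \<Rightarrow> ugroup set \<times> bool \<Rightarrow> ugroup set \<times> bool" where
  "ract E x st = foldl (rstep E) st (SOME w. el w = x)"

text \<open>No two vertices of \<open>R\<close> are adjacent, so every commutation move involves a
  letter that acts trivially; this is where freeness on \<open>R\<close> enters.\<close>

lemma ract_el: "ract E (el u) st = foldl (rstep E) st u"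
proof -
  have inv: "foldl (rstep E) st u = foldl (rstep E) st u'" if "raag_eq utree u u'" for u u'
    using that
  proof (rule raag_eq_invariant)
    show "foldl (rstep E) st (xs @ [(v, b), (v, \<not> b)] @ ys) = foldl (rstep E) st (xs @ ys)" for xs ys v b
    proof -
      have "rstep E (rstep E st' (v, b)) (v, \<not> b) = st'" for st'
        by (cases b; cases st')
          (auto simp: rstep_def Let_def image_image group_norm ltr_Not[of v True, simplified])
      then show ?thesis by simp
    qed
    show "foldl (rstep E) st (xs @ [(u, a), (v, b)] @ ys) = foldl (rstep E) st (xs @ [(v, b), (u, a)] @ ys)"
      if "utree u v" for xs ys u v a b
    proof -
      have "u \<notin> R \<or> v \<notin> R" using that R_not_adjacent by blast
      then have "rstep E (rstep E st' (u, a)) (v, b) = rstep E (rstep E st' (v, b)) (u, a)" for st'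
        by (auto simp: rstep_def)
      then show ?thesis by simp
    qed
  qed
  have "el (SOME u'. el u' = el u) = el u" by (metis (mono_tags) someI)
  from inv[OF el_eq_iff[THEN iffD1, OF this]] show ?thesis by (simp add: ract_def)
qed

lemma ract_add: "ract E (x + y) st = ract E y (ract E x st)"
proof -
  obtain u v where uv: "x = el u" "y = el v" by (metis el_surj)
  show ?thesis unfolding uv el_append[symmetric] ract_el by simp
qed

lemma ract_zero: "ract E 0 st = st"
  using ract_el[of E "[]"] by simp

lemma ract_ltr: "ract E (ltr v b) st = rstep E st (v, b)"
  using ract_el[of E "[(v, b)]"] by simp

lemma ract_Not: "ract E x (q, \<not> e) = (fst (ract E x (q, e)), \<not> snd (ract E x (q, e)))"
proof -
  obtain w where x: "x = el w" by (rule el_surj)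
  have "rstep E (fst st, \<not> snd st) p = (fst (rstep E st p), \<not> snd (rstep E st p))" for st p
    by (auto simp: rstep_def Let_def)
  then have "foldl (rstep E) (fst st, \<not> snd st) w = (fst (foldl (rstep E) st w), \<not> snd (foldl (rstep E) st w))" for st
  proof (induction w arbitrary: st)
    case (Cons p w)
    then show ?case by (metis foldl_Cons fst_conv snd_conv)
  qed simp
  from this[of "(q, e)"] show ?thesis by (simp add: x ract_el)
qed

lemma c_notin_R: "c \<notin> R"
  using R_adjacent[of c] P.bipartite[of c c] by blast

lemma ract_c: "t \<in> gen {c} \<Longrightarrow> ract E t st = st"
  by (induction rule: gen_induct) (auto simp: ract_zero ract_add ract_ltr rstep_def c_notin_R)

lemma rcoset_translate: "(\<lambda>y. y + x) ` rcoset K s = rcoset K (s + x)"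
  by (simp add: rcoset_def image_image add.assoc)

lemma rcoset_add_c: "t \<in> gen {c} \<Longrightarrow> s \<in> S \<Longrightarrow> rcoset K (s + t) = rcoset K s"
  using rcoset_absorb[OF K, of t s] cK c_commute by auto

lemma fst_ract: "x \<in> S \<Longrightarrow> s \<in> S \<Longrightarrow> fst (ract E x (rcoset K s, e)) = rcoset K (s + x)"
proof (induction rule: gen_induct_right)
  case (ltr v b y)
  then have IH: "fst (ract E y (rcoset K s, e)) = rcoset K (s + y)" by simp
  show ?case
  proof (cases "v = c")
    case True
    then have "ltr v b \<in> gen {c}" by (simp add: ltr_in_gen)
    then show ?thesis using IH ract_c rcoset_add_c[of "ltr v b" "s + y"] ltr subgrp_add[OF S]
      by (simp add: ract_add add.assoc)
  next
    case False
    then show ?thesis using ltr IH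
      by (simp add: ract_add ract_ltr rstep_def Let_def rcoset_translate add.assoc)
  qed
qed (simp add: ract_zero)

definition theta :: "bool \<Rightarrow> (ugroup set \<times> tvert) set \<Rightarrow> ugroup set" where
  "theta e E = {x \<in> S. snd (ract E x (K, e))}"

lemma rcoset_K_0: "rcoset K 0 = K" by (simp add: rcoset_def)

lemma theta_0: "0 \<in> theta e E \<longleftrightarrow> e"
  by (simp add: theta_def ract_zero subgrp_zero[OF S])

lemma theta_in_thetas: "theta e E \<in> thetas"
proof -
  have K1: "fst (ract E k (K, e)) = K" if "k \<in> K" for k
    using fst_ract[of k 0 E e] that KS subgrp_zero[OF S] rcoset_absorb[OF K that, of 0]
    by (auto simp: rcoset_K_0)
  have snd': "snd (ract E x (K, e')) \<longleftrightarrow> (snd (ract E x (K, e)) \<longleftrightarrow> (e' \<longleftrightarrow> e))" for x e'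
    using ract_Not[of E x K e] by (cases e; cases e') auto
  have "k + x \<in> theta e E \<longleftrightarrow> (x \<in> theta e E \<longleftrightarrow> (k \<in> theta e E \<longleftrightarrow> e))" if "k \<in> K" "x \<in> S" for k x
  proof -
    have "ract E k (K, e) = (K, snd (ract E k (K, e)))" using K1[OF that(1)] by (simp add: prod_eq_iff)
    then have "ract E (k + x) (K, e) = ract E x (K, snd (ract E k (K, e)))" by (simp add: ract_add)
    moreover have "k \<in> S" "k + x \<in> S" using that KS subgrp_add[OF S] by auto
    ultimately show ?thesis using snd'[of x "snd (ract E k (K, e))"] that by (simp add: theta_def)
  qed
  moreover have "t \<in> theta e E \<longleftrightarrow> e" if "t \<in> gen {c}" for t
    using that ract_c cK KS by (auto simp: theta_def)
  ultimately show ?thesis by (auto simp: thetas_def theta_0) (auto simp: theta_def)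
qed

lemma theta_edge:
  assumes "x \<in> S" "v \<in> R"
  shows "(x + vgen v \<in> theta e E \<longleftrightarrow> x \<in> theta e E) \<longleftrightarrow> (rcoset K x, v) \<notin> E"
proof -
  have "x + vgen v \<in> S" using assms RS subgrp_add[OF S] by blast
  moreover have "fst (ract E x (K, e)) = rcoset K x"
    using fst_ract[OF assms(1) subgrp_zero[OF S], of E e] by (simp add: rcoset_K_0)
  ultimately show ?thesis using assms by (auto simp: theta_def ract_add ract_ltr rstep_def Let_def)
qed

text \<open>Translating by an element of \<open>K\<close> changes a function in
  \<open>thetas\<close> by a constant, so its difference along an edge depends only on the
  coset.\<close>

lemma thetas_edge:
  assumes T: "T \<in> thetas" and x: "x \<in> S" and v: "v \<in> R"
  defines "r \<equiv> rep (rcoset K x)"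
  shows "(x + vgen v \<in> T \<longleftrightarrow> x \<in> T) \<longleftrightarrow> (r + vgen v \<in> T \<longleftrightarrow> r \<in> T)"
proof -
  let ?k = "x - r"
  have k: "?k \<in> K" unfolding r_def by (rule diff_rep[OF x])
  have r: "r \<in> S" "r + vgen v \<in> S" using rep(1) x RS[OF v] subgrp_add[OF S] by (auto simp: r_def)
  have e: "?k + r = x" "?k + (r + vgen v) = x + vgen v" by (simp_all add: group_norm)
  show ?thesis using thetasD[OF T k r(1), unfolded e] thetasD[OF T k r(2), unfolded e] by blast
qed

lemma thetas_eqI:
  assumes T: "T \<in> thetas" "T' \<in> thetas" and 0: "0 \<in> T \<longleftrightarrow> 0 \<in> T'"
    and edge: "\<And>x v. x \<in> S \<Longrightarrow> v \<in> R \<Longrightarrow> (x + vgen v \<in> T \<longleftrightarrow> x \<in> T) \<longleftrightarrow> (x + vgen v \<in> T' \<longleftrightarrow> x \<in> T')"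
  shows "T = T'"
proof -
  have "x \<in> T \<longleftrightarrow> x \<in> T'" if "x \<in> S" for x
    using that
  proof (induction rule: gen_induct_right)
    case (ltr v b y)
    show ?case
    proof (cases "v = c")
      case True
      then have t: "ltr v b \<in> gen {c}" by (simp add: ltr_in_gen)
      have "y + ltr v b \<in> T \<longleftrightarrow> y \<in> T" if "T \<in> thetas" for T
        using thetasD[OF that, of "ltr v b" y] thetas_c[OF that t] c_commute[OF t ltr(2)] cK t ltr by auto
      then show ?thesis using T ltr by blast
    next
      case False
      then have v: "v \<in> R" using ltr by simp
      show ?thesis
      proof (cases b)
        case True
        then have "ltr v b = vgen v" by simp
        then show ?thesis using edge[OF ltr(2) v] ltr(3) by metis
      next
        case b: False
        have e: "y + ltr v b + vgen v = y" using b by (simp add: ltr_Not[of v True, simplified] add.assoc)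
        show ?thesis using edge[OF subgrp_add[OF S ltr(2) RS[OF v, of b]] v, unfolded e] ltr(3) by blast
      qed
    qed
  qed (use 0 in simp)
  then show ?thesis using thetas_S T by blast
qed

text \<open>The value at 0 and the differences along the edges of the Schreier graph can be
  prescribed arbitrarily: walking from the coset \<open>K\<close> with the edge set \<open>E\<close>
  realizes them.\<close>

lemma card_thetas_2: "card thetas = 2 * 2 ^ (card Om * card R)"
proof -
  define F where "F = (\<lambda>T. ((0::ugroup) \<in> T, {(q, v). q \<in> Om \<and> v \<in> R \<and> \<not> (rep q + vgen v \<in> T \<longleftrightarrow> rep q \<in> T)}))"
  have "F (theta e E) = (e, E)" if "E \<subseteq> Om \<times> R" for e E
  proof -
    have "(rep q + vgen v \<in> theta e E \<longleftrightarrow> rep q \<in> theta e E) \<longleftrightarrow> (q, v) \<notin> E" if "q \<in> Om" "v \<in> R" for q v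
      using theta_edge[OF rep(1)[OF that(1)] that(2)] rep(2)[OF that(1)] by simp
    then have "{(q, v). q \<in> Om \<and> v \<in> R \<and> \<not> (rep q + vgen v \<in> theta e E \<longleftrightarrow> rep q \<in> theta e E)}
        = {(q, v). q \<in> Om \<and> v \<in> R \<and> (q, v) \<in> E}" by blast
    also have "\<dots> = E" using that by blast
    finally show ?thesis by (simp add: F_def theta_0)
  qed
  moreover have "(case F T of (e, E) \<Rightarrow> theta e E) = T" if T: "T \<in> thetas" for T
  proof -
    obtain e E where FT: "F T = (e, E)" by (cases "F T")
    have "theta e E = T"
    proof (rule thetas_eqI[OF theta_in_thetas T])
      show "0 \<in> theta e E \<longleftrightarrow> 0 \<in> T" using FT by (auto simp: theta_0 F_def)
      fix x v assume xv: "x \<in> S" "v \<in> R"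
      have "(rcoset K x, v) \<in> E \<longleftrightarrow> \<not> (x + vgen v \<in> T \<longleftrightarrow> x \<in> T)"
        using FT xv thetas_edge[OF T xv] by (auto simp: F_def)
      then show "(x + vgen v \<in> theta e E \<longleftrightarrow> x \<in> theta e E) \<longleftrightarrow> (x + vgen v \<in> T \<longleftrightarrow> x \<in> T)"
        using theta_edge[OF xv] by blast
    qed
    then show ?thesis using FT by simp
  qed
  ultimately have "bij_betw F thetas (UNIV \<times> Pow (Om \<times> R))"
    by (intro bij_betw_byWitness[where f' = "\<lambda>(e, E). theta e E"])
      (auto simp: theta_in_thetas simp del: split_paired_All, auto simp: F_def)
  then have "card thetas = card ((UNIV::bool set) \<times> Pow (Om \<times> R))" by (rule bij_betw_same_card)
  then show ?thesis using fin finR by (simp add: card_cartesian_product card_Pow)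
qed

text \<open>With n cosets and r elements in \<open>R\<close> the number of homomorphisms is 2 to the
  power n (r - 1) + 1, the exponent being Schreier's rank.\<close>

theorem card_hom2: "card (hom2 K (gen {c})) * 2 ^ card Om = 2 * 2 ^ (card Om * card R)"
  using card_thetas_1 card_thetas_2 by simp

end

section \<open>Vertices and edges of a finite index subgroup\<close>

text \<open>A vertex of H is the centralizer of a nontrivial element with non-abelian centralizer; in the
  Bass-Serre tree these correspond to the vertices of the interior of the defining tree. Two
  vertices form an edge if their centers commute.\<close>
definition special :: "'a::group_add set \<Rightarrow> 'a set" where
  "special H = {z \<in> H. z \<noteq> 0 \<and> (\<exists>x\<in>cent H z. \<exists>y\<in>cent H z. x + y \<noteq> y + x)}"

definition vertices :: "'a::group_add set \<Rightarrow> 'a set set" where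
  "vertices H = cent H ` special H"

definition edges :: "'a::group_add set \<Rightarrow> ('a set \<times> 'a set) set" where
  "edges H = {(C, D). C \<in> vertices H \<and> D \<in> vertices H \<and> C \<noteq> D \<and> center C \<subseteq> D}"

definition vclass :: "'a::group_add set \<Rightarrow> 'a set \<Rightarrow> 'a set set" where
  "vclass H C = (\<lambda>h. conj_set h C) ` H"

definition eclass :: "'a::group_add set \<Rightarrow> 'a set \<times> 'a set \<Rightarrow> ('a set \<times> 'a set) set" where
  "eclass H p = (\<lambda>h. (conj_set h (fst p), conj_set h (snd p))) ` H"

text \<open>For a vertex group the quotient by the center is free and the count is 2 to the power of
  its rank; \<open>xval\<close> is that rank minus one.\<close>

definition xval :: "'a::group_add set \<Rightarrow> real" where
  "xval C = log 2 (real (card (hom2 C (center C)))) - 1"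

definition iota :: "'a::group_add set \<times> 'a set \<Rightarrow> real" where
  "iota p = real (ncosets (set_sum (center (fst p)) (center (snd p))) (fst p \<inter> snd p))"

lemma center_conj_set: "center (conj_set g C) = conj_set g (center C)"
proof -
  have "(\<forall>x\<in>conj_set g C. x + z = z + x) \<longleftrightarrow> (\<forall>x\<in>C. x + (- g + z + g) = (- g + z + g) + x)" for z
  proof -
    have "(g + x - g) + z = z + (g + x - g) \<longleftrightarrow> x + (- g + z + g) = (- g + z + g) + x" for x
    proof -
      have "(g + x - g) + z = g + (x + (- g + z + g)) - g" "z + (g + x - g) = g + ((- g + z + g) + x) - g"
        by (simp_all only: group_norm)
      then show ?thesis by (simp only: diff_conv_add_uminus add_right_cancel add_left_cancel)
    qed
    then show ?thesis by (simp add: conj_set_def)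
  qed
  then show ?thesis by (simp only: set_eq_iff center_def mem_conj_set mem_Collect_eq simp_thms)
qed

lemma set_sum_conj_set: "set_sum (conj_set g A) (conj_set g B) = conj_set g (set_sum A B)"
proof (intro equalityI subsetI)
  fix x assume "x \<in> set_sum (conj_set g A) (conj_set g B)"
  then obtain a b where "a \<in> A" "b \<in> B" "x = (g + a - g) + (g + b - g)"
    by (auto simp: set_sum_def conj_set_def)
  then have "a + b \<in> set_sum A B" "x = g + (a + b) - g" by (auto simp: set_sum_def group_norm)
  then show "x \<in> conj_set g (set_sum A B)" by (auto simp: conj_set_def)
next
  fix x assume "x \<in> conj_set g (set_sum A B)"
  then obtain a b where "a \<in> A" "b \<in> B" "x = g + (a + b) - g"
    by (auto simp: set_sum_def conj_set_def)
  then have "g + a - g \<in> conj_set g A" "g + b - g \<in> conj_set g B" "x = (g + a - g) + (g + b - g)"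
    by (auto simp: conj_set_def group_norm)
  then show "x \<in> set_sum (conj_set g A) (conj_set g B)" unfolding set_sum_def by blast
qed

lemma card_image_rcoset_cong:
  assumes K: "subgrp K" and L: "subgrp L"
    and "\<And>x y. x \<in> S \<Longrightarrow> y \<in> S \<Longrightarrow> f x - f y \<in> K \<longleftrightarrow> g x - g y \<in> L"
  shows "card ((\<lambda>x. rcoset K (f x)) ` S) = card ((\<lambda>x. rcoset L (g x)) ` S)"
  by (rule card_image_eq_of_kernel) (simp add: rcoset_eq_iff K L assms(3))

lemma ncosets_conj_set:
  assumes "subgrp K" shows "ncosets (conj_set g K) (conj_set g S) = ncosets K S"
proof -
  have "ncosets (conj_set g K) (conj_set g S) = card ((\<lambda>x. rcoset (conj_set g K) (g + x - g)) ` S)"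
    by (simp add: ncosets_def conj_set_def[of g S] image_image)
  also have "\<dots> = card ((\<lambda>x. rcoset K x) ` S)"
    by (rule card_image_rcoset_cong) (use assms in \<open>simp_all add: subgrp_conj_set mem_conj_set group_norm\<close>)
  finally show ?thesis by (simp add: ncosets_def)
qed

lemma xval_conj_set:
  assumes "subgrp C" shows "xval (conj_set g C) = xval C"
proof -
  have "card (hom2 ((\<lambda>x. g + x - g) ` C) ((\<lambda>x. g + x - g) ` center C)) = card (hom2 C (center C))"
  proof (rule card_hom2_image[OF assms])
    show "inj_on (\<lambda>x. g + x - g) C"
      by (simp add: inj_on_def diff_conv_add_uminus)
  qed (auto simp: center_def group_norm)
  then show ?thesis by (simp add: xval_def center_conj_set) (simp add: conj_set_def)
qed

lemma set_sumI: "a \<in> A \<Longrightarrow> b \<in> B \<Longrightarrow> a + b \<in> set_sum A B"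
  by (auto simp: set_sum_def)

lemma subgrp_set_sum:
  assumes A: "subgrp A" and B: "subgrp B" and comm: "\<And>a b. a \<in> A \<Longrightarrow> b \<in> B \<Longrightarrow> a + b = b + a"
  shows "subgrp (set_sum A B)"
proof (rule subgrpI)
  show "0 \<in> set_sum A B" using subgrp_zero[OF A] subgrp_zero[OF B] by (force simp: set_sum_def)
next
  fix x y assume "x \<in> set_sum A B" "y \<in> set_sum A B"
  then obtain a b a' b' where ab: "a \<in> A" "b \<in> B" "x = a + b" "a' \<in> A" "b' \<in> B" "y = a' + b'"
    by (auto simp: set_sum_def)
  have "x + y = a + (b + a') + b'" using ab by (simp add: add.assoc)
  also have "b + a' = a' + b" using comm[of a' b] ab by simp
  also have "a + (a' + b) + b' = (a + a') + (b + b')" by (simp add: add.assoc)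
  finally show "x + y \<in> set_sum A B" using ab subgrp_add[OF A] subgrp_add[OF B] by (simp add: set_sumI)
next
  fix x assume "x \<in> set_sum A B"
  then obtain a b where ab: "a \<in> A" "b \<in> B" "x = a + b" by (auto simp: set_sum_def)
  then have "- x = - a + - b" using comm[of a b] by (metis minus_add)
  then show "- x \<in> set_sum A B" using ab subgrp_minus[OF A] subgrp_minus[OF B] by (simp add: set_sumI)
qed

lemma set_sum_subset: "subgrp S \<Longrightarrow> A \<subseteq> S \<Longrightarrow> B \<subseteq> S \<Longrightarrow> set_sum A B \<subseteq> S"
  by (auto simp: set_sum_def subgrp_add subset_iff)

lemma set_sum_left: "subgrp B \<Longrightarrow> A \<subseteq> set_sum A B"
  by (force simp: set_sum_def dest: subgrp_zero)

lemma set_sum_right: "subgrp A \<Longrightarrow> B \<subseteq> set_sum A B"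
  by (force simp: set_sum_def dest: subgrp_zero)

lemma gen_insert:
  assumes "R \<subseteq> lk v" shows "gen (insert v R) = set_sum (gen {v}) (gen R)"
proof
  have "subgrp (set_sum (gen {v}) (gen R))"
    using subgrp_set_sum[OF subgrp_gen subgrp_gen] lk_commute gen_mono[OF assms] by (metis subsetD)
  then show "gen (insert v R) \<subseteq> set_sum (gen {v}) (gen R)"
    using set_sum_left[OF subgrp_gen] set_sum_right[OF subgrp_gen] vgen_in_gen
    by (intro gen_subset) blast+
qed (intro set_sum_subset subgrp_gen gen_mono; blast)

lemma expo_conj: "expo v (- g + x + g) = expo v x"
  by (simp add: expo_add expo_minus)

lemma expo_other: "x \<in> gen {u} \<Longrightarrow> u \<noteq> v \<Longrightarrow> expo v x = 0"
  by (induction rule: gen_induct) (auto simp: expo_add expo_ltr)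

lemma expo_eq_0: "x \<in> gen {v} \<Longrightarrow> expo v x = 0 \<Longrightarrow> x = 0"
  using P.expo_cyclic_eq_0[of v x] Q.expo_cyclic_eq_0[of v x] by blast

lemma nmul_vgen_neq_0: "0 < n \<Longrightarrow> nmul n (vgen v) \<noteq> 0"
proof
  assume "0 < n" "nmul n (vgen v) = 0"
  then have "expo v (nmul n (vgen v)) = 0" by simp
  then show False using \<open>0 < n\<close> by (simp add: P.expo_nmul expo_ltr)
qed

text \<open>The link of a vertex lies in a single colour class, so it generates a free group, where
  a power of a generator has cyclic centralizer.\<close>

lemma cent_lk:
  assumes "u \<in> lk v" "x \<in> gen (lk v)" "0 < n" "x + nmul n (vgen u) = nmul n (vgen u) + x"
  shows "x \<in> gen {u}"
proof -
  have n: "nmul n (vgen u) \<in> gen {u}" "nmul n (vgen u) \<noteq> 0"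
    using P.nmul_vgen nmul_vgen_neq_0 assms(3) by auto
  show ?thesis
  proof (cases "v \<in> Piv")
    case True
    then have l: "lk v \<subseteq> - Piv" by (rule P.lk_disjoint)
    then show ?thesis using Q.cent_cyclic[OF _ n _ assms(4)] assms gen_mono[OF l] by blast
  next
    case False
    then have l: "lk v \<subseteq> Piv" using P.bipartite by (auto simp: lk_def)
    then show ?thesis using P.cent_cyclic[OF _ n _ assms(4)] assms gen_mono[OF l] by blast
  qed
qed

lemma star_Int_star: "utree v u \<Longrightarrow> star v \<inter> star u = {v, u}"
  using P.bipartite by (auto simp: star_def lk_def) (metis P.bipartite utree_sym)+

text \<open>Two neighbours at each interior vertex make the vertex groups non-abelian and keep their
  centers down to powers of that vertex. The covering by stars of interior vertices is what makes
  the graph of classes connected.\<close>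

definition good :: "tvert set \<Rightarrow> bool" where
  "good V \<longleftrightarrow> finite V \<and> Center \<in> V \<and> (\<forall>v\<in>V. interior v \<longrightarrow> 2 \<le> card (V \<inter> lk v)) \<and>
     (\<forall>v\<in>V. \<exists>p\<in>V. interior p \<and> v \<in> star p)"

section \<open>Vertex and edge groups as intersections with conjugates of standard subgroups\<close>

locale finite_index =
  fixes V :: "tvert set" and H :: "ugroup set"
  assumes good: "good V" and H: "subgrp H" and HV: "H \<subseteq> gen V" and fin: "finite (rcoset H ` gen V)"
begin

definition I :: "tvert set" where "I = {v \<in> V. interior v}"

text \<open>The stabilizer in \<open>H\<close> of the translate by \<open>g\<close> of the vertex
  \<open>v\<close> of the Bass-Serre tree; \<open>Zw\<close> will be its center.\<close>

definition Cw :: "tvert \<Rightarrow> ugroup \<Rightarrow> ugroup set" where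
  "Cw v g = H \<inter> conj_set g (gen (V \<inter> star v))"

definition Zw :: "tvert \<Rightarrow> ugroup \<Rightarrow> ugroup set" where
  "Zw v g = H \<inter> conj_set g (gen {v})"

lemma ID: "v \<in> I \<Longrightarrow> v \<in> V" "v \<in> I \<Longrightarrow> interior v" by (auto simp: I_def)

lemma finV: "finite V" using good by (simp add: good_def)

lemma two_neighbours:
  assumes "v \<in> I"
  obtains u w where "u \<in> V \<inter> lk v" "w \<in> V \<inter> lk v" "u \<noteq> w"
proof -
  have "2 \<le> card (V \<inter> lk v)" using assms good by (auto simp: good_def I_def)
  then show ?thesis using that by (metis card_2_iff' card_le_Suc0_iff_eq finV finite_Int not_less_eq_eq numeral_2_eq_2)
qed

lemma exists_multiple:
  assumes "x \<in> gen V" "g \<in> gen V" shows "\<exists>n>0. g + nmul n x - g \<in> H"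
  using exists_multiple_in_finite_index[OF H fin subgrp_gen, of "g + x - g"] assms
  by (simp add: nmul_conj subgrp_closed[OF subgrp_gen])

lemma subgrp_Cw: "subgrp (Cw v g)" and subgrp_Zw: "subgrp (Zw v g)"
  by (simp_all add: Cw_def Zw_def H subgrp_Int subgrp_conj_set subgrp_gen)

lemma mem_Cw: "x \<in> Cw v g \<longleftrightarrow> x \<in> H \<and> - g + x + g \<in> gen (V \<inter> star v)"
  and mem_Zw: "x \<in> Zw v g \<longleftrightarrow> x \<in> H \<and> - g + x + g \<in> gen {v}"
  by (simp_all add: Cw_def Zw_def mem_conj_set)

lemma conj_mem_V: "g \<in> gen V \<Longrightarrow> x \<in> H \<Longrightarrow> - g + x + g \<in> gen V"
  using HV by (intro subgrp_add[OF subgrp_gen] subgrp_minus[OF subgrp_gen]) auto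

lemma conj_commute_iff: "(- g + x + g) + (- g + z + g) = (- g + z + g) + (- g + x + g) \<longleftrightarrow> x + z = z + (x::ugroup)"
proof
  assume "(- g + x + g) + (- g + z + g) = (- g + z + g) + (- g + x + g)"
  from conj_commute[OF this, of "- g"] show "x + z = z + x" by (simp add: group_norm)
qed (rule conj_commute)

lemma cent_eq_Cw:
  assumes v: "v \<in> I" and g: "g \<in> gen V" and z: "z \<in> Zw v g" "z \<noteq> 0"
  shows "cent H z = Cw v g"
proof -
  have z': "- g + z + g \<in> gen {v}" "- g + z + g \<noteq> 0" using z conj_eq_0[of g z] by (auto simp: mem_Zw)
  have "x \<in> cent H z \<longleftrightarrow> x \<in> Cw v g" if x: "x \<in> H" for x
  proof -
    have "x + z = z + x \<longleftrightarrow> - g + x + g \<in> gen (star v)"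
      using cent_interior[OF ID(2)[OF v] z', of "- g + x + g"] conj_commute_iff[of g x z] by simp
    also have "\<dots> \<longleftrightarrow> - g + x + g \<in> gen (V \<inter> star v)"
      using conj_mem_V[OF g x] gen_Int[of V "star v"] by blast
    finally show ?thesis using x by (simp add: mem_Cw cent_def)
  qed
  then show ?thesis by (auto simp: cent_def mem_Cw)
qed

lemma Zw_nonzero:
  assumes v: "v \<in> I" and g: "g \<in> gen V"
  obtains z where "z \<in> Zw v g" "z \<noteq> 0"
proof -
  obtain n where n: "n > 0" "g + nmul n (vgen v) - g \<in> H"
    using exists_multiple[OF vgen_in_gen g] ID[OF v] by blast
  have e: "- g + (g + nmul n (vgen v) - g) + g = nmul n (vgen v)" by (simp add: group_norm)
  have "g + nmul n (vgen v) - g \<noteq> 0"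
  proof
    assume "g + nmul n (vgen v) - g = 0"
    with e have "nmul n (vgen v) = 0" by simp
    then show False using nmul_vgen_neq_0 n by blast
  qed
  moreover have "g + nmul n (vgen v) - g \<in> Zw v g" using n e P.nmul_vgen by (simp add: mem_Zw)
  ultimately show ?thesis using that by blast
qed

lemma neighbour_multiple:
  assumes v: "v \<in> I" and g: "g \<in> gen V" and u: "u \<in> V \<inter> lk v"
  obtains n where "n > 0" "g + nmul n (vgen u) - g \<in> Cw v g"
proof -
  obtain n where n: "n > 0" "g + nmul n (vgen u) - g \<in> H"
    using exists_multiple[OF vgen_in_gen g] u by blast
  have "- g + (g + nmul n (vgen u) - g) + g = nmul n (vgen u)" by (simp add: group_norm)
  moreover have "nmul n (vgen u) \<in> gen (V \<inter> star v)"
    using P.nmul_vgen gen_mono[of "{u}" "V \<inter> star v"] u by (auto simp: star_def)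
  ultimately show ?thesis using that n by (simp add: mem_Cw)
qed

text \<open>By finite index the group contains conjugates of powers of two different neighbours of
  \<open>v\<close>, which do not commute because the link is free.\<close>

lemma Cw_nonabelian:
  assumes v: "v \<in> I" and g: "g \<in> gen V"
  shows "\<exists>x\<in>Cw v g. \<exists>y\<in>Cw v g. x + y \<noteq> y + x"
proof -
  obtain u w where uw: "u \<in> V \<inter> lk v" "w \<in> V \<inter> lk v" "u \<noteq> w" using two_neighbours[OF v] .
  obtain n m where n: "n > 0" "g + nmul n (vgen u) - g \<in> Cw v g" and m: "m > 0" "g + nmul m (vgen w) - g \<in> Cw v g"
    using neighbour_multiple[OF v g uw(1)] neighbour_multiple[OF v g uw(2)] by metis
  have "nmul m (vgen w) + nmul n (vgen u) \<noteq> nmul n (vgen u) + nmul m (vgen w)"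
  proof
    assume c: "nmul m (vgen w) + nmul n (vgen u) = nmul n (vgen u) + nmul m (vgen w)"
    have "nmul m (vgen w) \<in> gen (lk v)" using P.nmul_vgen gen_mono[of "{w}" "lk v"] uw by blast
    then have "nmul m (vgen w) \<in> gen {u}" using cent_lk[OF _ _ n(1) c] uw by blast
    then have "expo w (nmul m (vgen w)) = 0" using expo_other uw by metis
    then show False using m by (simp add: P.expo_nmul expo_ltr)
  qed
  then have "(g + nmul m (vgen w) - g) + (g + nmul n (vgen u) - g) \<noteq> (g + nmul n (vgen u) - g) + (g + nmul m (vgen w) - g)"
    using conj_commute_iff[of "- g" "nmul m (vgen w)" "nmul n (vgen u)"] by (simp add: diff_conv_add_uminus)
  then show ?thesis using n m by blast
qed

lemma Zw_special:
  assumes "v \<in> I" "g \<in> gen V" "z \<in> Zw v g" "z \<noteq> 0" shows "z \<in> special H"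
  using Cw_nonabelian[OF assms(1,2)] cent_eq_Cw[OF assms] assms by (auto simp: special_def mem_Zw)

lemma special_Zw:
  assumes "z \<in> special H"
  obtains v g where "v \<in> I" "g \<in> gen V" "z \<in> Zw v g" "z \<noteq> 0"
proof -
  obtain x y where z: "z \<in> H" "z \<noteq> 0" and xy: "x + z = z + x" "y + z = z + y" "x + y \<noteq> y + x"
    using assms by (auto simp: special_def cent_def)
  obtain g v where gv: "interior v" "- g + z + g \<in> gen {v}" using noncommuting_cent[OF z(2) xy] by blast
  \<comment> \<open>The conjugator found in the universal group may leave \<open>gen V\<close>; the
    retraction onto \<open>V\<close> fixes \<open>z\<close> and brings the conjugator back.\<close>
  have zV: "ret V z = z" using z HV gen_iff_ret by blast
  have e: "- ret V g + z + ret V g = ret V (- g + z + g)" by (simp add: ret_hom zV)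
  have "v \<in> V"
  proof (rule ccontr)
    assume "v \<notin> V"
    then have "ret V (- g + z + g) = 0" using gv by (intro ret_gen_disjoint) auto
    then show False using e conj_eq_0[of "ret V g" z] z by simp
  qed
  moreover from this have "ret V (- g + z + g) = - g + z + g"
    using gv gen_mono[of "{v}" V] by (auto simp flip: gen_iff_ret)
  ultimately show ?thesis using that[of v "ret V g"] gv e z ret_in_gen by (simp add: I_def mem_Zw)
qed

lemma vertices_eq: "vertices H = {Cw v g | v g. v \<in> I \<and> g \<in> gen V}"
proof (intro equalityI subsetI)
  fix C assume "C \<in> vertices H"
  then obtain z where "z \<in> special H" "C = cent H z" by (auto simp: vertices_def)
  then show "C \<in> {Cw v g | v g. v \<in> I \<and> g \<in> gen V}" using special_Zw cent_eq_Cw by (smt (verit) mem_Collect_eq)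
next
  fix C assume "C \<in> {Cw v g | v g. v \<in> I \<and> g \<in> gen V}"
  then obtain v g where vg: "v \<in> I" "g \<in> gen V" "C = Cw v g" by blast
  obtain z where "z \<in> Zw v g" "z \<noteq> 0" using Zw_nonzero[OF vg(1,2)] .
  then show "C \<in> vertices H" using Zw_special cent_eq_Cw vg by (force simp: vertices_def)
qed

lemma Zw_subset_Cw: "v \<in> I \<Longrightarrow> Zw v g \<subseteq> Cw v g"
  using gen_mono[of "{v}" "V \<inter> star v"] ID by (auto simp: mem_Cw mem_Zw star_def)

text \<open>Split a central element into a power of \<open>v\<close> and an element \<open>f\<close>
  of the free group on the link. \<open>f\<close> commutes with powers of two different neighbours,
  so it is a power of both and hence 0.\<close>

lemma center_Cw:
  assumes v: "v \<in> I" and g: "g \<in> gen V" shows "center (Cw v g) = Zw v g"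
proof (intro equalityI subsetI)
  fix y assume y: "y \<in> center (Cw v g)"
  then have yC: "y \<in> Cw v g" by (simp add: center_def)
  obtain u w where uw: "u \<in> V \<inter> lk v" "w \<in> V \<inter> lk v" "u \<noteq> w" using two_neighbours[OF v] .
  have "- g + y + g \<in> gen (star v)" using yC gen_mono[of "V \<inter> star v" "star v"] by (auto simp: mem_Cw)
  then obtain t f where tf: "- g + y + g = t + f" "t \<in> gen {v}" "f \<in> gen (lk v)"
    using gen_insert[of "lk v" v] by (auto simp: star_def set_sum_def)
  have *: "f \<in> gen {u}" if u: "u \<in> V \<inter> lk v" for u
  proof -
    obtain n where n: "n > 0" "g + nmul n (vgen u) - g \<in> Cw v g" using neighbour_multiple[OF v g u] .
    have "(g + nmul n (vgen u) - g) + y = y + (g + nmul n (vgen u) - g)" using y n by (simp add: center_def)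
    then have "(- g + (g + nmul n (vgen u) - g) + g) + (- g + y + g) = (- g + y + g) + (- g + (g + nmul n (vgen u) - g) + g)"
      by (rule conj_commute)
    then have 1: "(t + f) + nmul n (vgen u) = nmul n (vgen u) + (t + f)" unfolding tf(1) by (simp add: group_norm)
    have nl: "nmul n (vgen u) \<in> gen (lk v)" using P.nmul_vgen gen_mono[of "{u}" "lk v"] u by blast
    have "t + nmul n (vgen u) = nmul n (vgen u) + t" using lk_commute[OF nl tf(2)] by simp
    from commute_add[OF commute_minus[OF this] 1] have "f + nmul n (vgen u) = nmul n (vgen u) + f" by (simp add: group_norm)
    then show ?thesis using cent_lk[OF _ tf(3) n(1)] u by blast
  qed
  have "f \<in> gen ({u} \<inter> {w})" using *[OF uw(1)] *[OF uw(2)] gen_Int by blast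
  then have "f = 0" using uw(3) by (simp add: gen_empty)
  then show "y \<in> Zw v g" using tf yC by (simp add: mem_Zw mem_Cw)
next
  fix y assume y: "y \<in> Zw v g"
  have "x + y = y + x" if x: "x \<in> Cw v g" for x
  proof -
    have "- g + x + g \<in> gen (star v)" using x gen_mono[of "V \<inter> star v" "star v"] by (auto simp: mem_Cw)
    moreover have "- g + y + g \<in> gen {v}" using y by (simp add: mem_Zw)
    ultimately have "(- g + x + g) + (- g + y + g) = (- g + y + g) + (- g + x + g)" by (rule gen_star_commute)
    then show ?thesis by (simp only: conj_commute_iff)
  qed
  then show "y \<in> center (Cw v g)" using y Zw_subset_Cw[OF v] by (auto simp: center_def)
qed

lemma conj_Cw: "h \<in> H \<Longrightarrow> conj_set h (Cw v g) = Cw v (h + g)"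
  by (simp add: Cw_def conj_set_Int conj_set_add conj_set_subgrp[OF H])

lemma Cw_shift: "s \<in> gen (V \<inter> star v) \<Longrightarrow> Cw v (g + s) = Cw v g"
  by (simp add: Cw_def conj_set_add conj_set_subgrp[OF subgrp_gen])

text \<open>A nonzero central element reveals \<open>v\<close> by its exponent sums. Its two
  conjugates have the same exponent at \<open>v\<close>, hence are equal, so \<open>- g + k\<close>
  centralizes a power of \<open>v\<close> and \<open>cent_interior\<close> applies.\<close>

lemma Cw_eq_iff:
  assumes v: "v \<in> I" "g \<in> gen V" and w: "w \<in> I" "k \<in> gen V"
  shows "Cw v g = Cw w k \<longleftrightarrow> v = w \<and> - g + k \<in> gen (V \<inter> star v)"
proof
  assume "Cw v g = Cw w k"
  then have Z: "Zw v g = Zw w k" using center_Cw v w by metis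
  obtain z where z: "z \<in> Zw v g" "z \<noteq> 0" using Zw_nonzero[OF v] .
  let ?a = "- g + z + g" and ?b = "- k + z + k"
  have a: "?a \<in> gen {v}" "?a \<noteq> 0" "?b \<in> gen {w}" using z Z conj_eq_0[of g z] by (auto simp: mem_Zw)
  have "expo v ?b \<noteq> 0" using expo_eq_0[OF a(1)] a(2) by (auto simp: expo_conj)
  then have vw: "v = w" using expo_other[OF a(3)] by metis
  have "- ?b \<in> gen {v}" using subgrp_minus[OF subgrp_gen a(3)] vw by (simp only:)
  then have "?a + - ?b \<in> gen {v}" by (rule subgrp_add[OF subgrp_gen a(1)])
  moreover have "expo v (?a + - ?b) = 0" by (simp add: expo_add[of v ?a] expo_minus[of v ?b] expo_conj)
  ultimately have "?a + - ?b = 0" by (rule expo_eq_0)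
  then have ab: "?a = ?b" by (simp add: eq_neg_iff_add_eq_0[symmetric])
  have "(- g + k) + ?b = ?a + (- g + k)" by (simp add: group_norm)
  then have "(- g + k) + ?a = ?a + (- g + k)" using ab by simp
  then have "- g + k \<in> gen (star v)" using cent_interior[OF ID(2)[OF v(1)] a(1,2)] by blast
  moreover have "- g + k \<in> gen V" using v w by (intro subgrp_add[OF subgrp_gen] subgrp_minus[OF subgrp_gen])
  ultimately show "v = w \<and> - g + k \<in> gen (V \<inter> star v)" using vw gen_Int by blast
next
  assume "v = w \<and> - g + k \<in> gen (V \<inter> star v)"
  then show "Cw v g = Cw w k" using Cw_shift[of "- g + k" v g] by auto
qed

text \<open>The vertex classes over \<open>v\<close> are thus the double cosets of \<open>H\<close>
  and \<open>gen (V \<inter> star v)\<close> in \<open>gen V\<close>;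
  \<open>eclass_Cw_eq_iff\<close> does the same for edges with \<open>gen {v, u}\<close>.\<close>

lemma vclass_Cw_eq_iff:
  assumes v: "v \<in> I" "g \<in> gen V" and w: "w \<in> I" "k \<in> gen V"
  shows "vclass H (Cw v g) = vclass H (Cw w k) \<longleftrightarrow> v = w \<and> (\<exists>h\<in>H. - g + (h + k) \<in> gen (V \<inter> star v))"
proof -
  have "vclass H (Cw v g) = vclass H (Cw w k) \<longleftrightarrow> (\<exists>h\<in>H. Cw v g = conj_set h (Cw w k))"
  proof
    assume "vclass H (Cw v g) = vclass H (Cw w k)"
    moreover have "Cw v g \<in> vclass H (Cw v g)" using subgrp_zero[OF H] by (force simp: vclass_def)
    ultimately show "\<exists>h\<in>H. Cw v g = conj_set h (Cw w k)" by (auto simp: vclass_def)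
  next
    assume "\<exists>h\<in>H. Cw v g = conj_set h (Cw w k)"
    then obtain h where h: "h \<in> H" "Cw v g = conj_set h (Cw w k)" by blast
    have "vclass H (conj_set h C) = vclass H C" for C
    proof (intro equalityI subsetI)
      fix D assume "D \<in> vclass H C"
      then obtain k where "k \<in> H" "D = conj_set (k - h) (conj_set h C)" 
        by (auto simp: vclass_def simp flip: conj_set_add)
      then show "D \<in> vclass H (conj_set h C)" using h subgrp_diff[OF H] by (auto simp: vclass_def)
    qed (use h subgrp_add[OF H] in \<open>auto simp: vclass_def simp flip: conj_set_add\<close>)
    then show "vclass H (Cw v g) = vclass H (Cw w k)" using h by simp
  qed
  moreover have "Cw v g = conj_set h (Cw w k) \<longleftrightarrow> v = w \<and> - g + (h + k) \<in> gen (V \<inter> star v)" if h: "h \<in> H" for h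
  proof -
    have "h + k \<in> gen V" using h HV w subgrp_add[OF subgrp_gen] by blast
    then show ?thesis using Cw_eq_iff[OF v w(1)] conj_Cw[OF h] by simp
  qed
  ultimately show ?thesis by blast
qed

lemma adjacent_star: "utree v u \<Longrightarrow> v \<in> star u" "utree v u \<Longrightarrow> u \<in> star v" "utree v u \<Longrightarrow> v \<noteq> u"
  using P.bipartite[of v u] utree_sym[of v u] by (auto simp: star_def lk_def)

text \<open>The point is that both ends can be written with the same \<open>g\<close>. Commuting
  centers put a conjugate of a power of \<open>v\<close> into \<open>gen (star u)\<close>;
  correcting \<open>g2\<close> by the retract of the conjugator keeps the second vertex and makes
  \<open>g\<close> serve for the first one too.\<close>

lemma edges_eq: "edges H = {(Cw v g, Cw u g) | v u g. v \<in> I \<and> u \<in> I \<and> utree v u \<and> g \<in> gen V}"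
proof (intro equalityI subsetI)
  fix e assume e: "e \<in> edges H"
  then obtain C D where CD: "e = (C, D)" "C \<in> vertices H" "D \<in> vertices H" "C \<noteq> D" "center C \<subseteq> D"
    by (auto simp: edges_def)
  obtain v g1 u g2 where vu: "v \<in> I" "g1 \<in> gen V" "C = Cw v g1" "u \<in> I" "g2 \<in> gen V" "D = Cw u g2"
    using CD by (auto simp: vertices_eq)
  obtain z where z: "z \<in> Zw v g1" "z \<noteq> 0" using Zw_nonzero[OF vu(1,2)] .
  then have "z \<in> D" using CD center_Cw vu by blast
  then have w: "- g2 + z + g2 \<in> gen (star u)" 
    using vu gen_mono[of "V \<inter> star u" "star u"] by (auto simp: mem_Cw)
  let ?w1 = "- g1 + z + g1" and ?b = "- g1 + g2"
  have w1: "?w1 \<in> gen {v}" using z by (simp add: mem_Zw)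
  have bw: "- ?b + ?w1 + ?b = - g2 + z + g2" by (simp add: group_norm)
  let ?r = "ret (star u) ?b"
  have e2: "- g2 + z + g2 = - ?r + ret (star u) ?w1 + ?r"
    using conj_in_gen[of ?b ?w1 "star u"] w bw by simp
  have v_star: "v \<in> star u"
  proof (rule ccontr)
    assume "v \<notin> star u"
    then have "ret (star u) ?w1 = 0" using w1 by (intro ret_gen_disjoint) auto
    then show False using e2 conj_eq_0[of g2 z] z by simp
  qed
  then have w1r: "ret (star u) ?w1 = ?w1" using w1 gen_mono[of "{v}" "star u"] by (auto simp flip: gen_iff_ret)
  have b: "?b \<in> gen V" using vu by (intro subgrp_add[OF subgrp_gen] subgrp_minus[OF subgrp_gen])
  have "ret V ?r = ?r"
    using b ret_ret[of V "star u" ?b] ret_ret[of "star u" V ?b] by (simp add: gen_iff_ret Int_commute)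
  then have r: "?r \<in> gen (V \<inter> star u)" using ret_in_gen gen_Int by (metis IntI gen_iff_ret)
  define g where "g = g2 + - ?r"
  have g: "g \<in> gen V" unfolding g_def using vu r gen_mono[of "V \<inter> star u" V]
    by (intro subgrp_add[OF subgrp_gen] subgrp_minus[OF subgrp_gen]) auto
  have "- g + z + g = ?r + (- g2 + z + g2) + - ?r" by (simp add: g_def group_norm)
  also have "\<dots> = ?w1" unfolding e2 w1r by (simp add: group_norm)
  finally have "z \<in> Zw v g" using z by (simp add: mem_Zw)
  then have C: "C = Cw v g" using cent_eq_Cw[OF vu(1) g] cent_eq_Cw[OF vu(1,2)] z vu by metis
  have D: "D = Cw u g" using vu Cw_shift[OF subgrp_minus[OF subgrp_gen r]] by (simp add: g_def)
  have "v \<noteq> u" using CD C D by auto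
  then have "utree v u" using v_star utree_sym by (auto simp: star_def lk_def)
  then show "e \<in> {(Cw v g, Cw u g) | v u g. v \<in> I \<and> u \<in> I \<and> utree v u \<and> g \<in> gen V}"
    using CD C D vu g by blast
next
  fix e assume "e \<in> {(Cw v g, Cw u g) | v u g. v \<in> I \<and> u \<in> I \<and> utree v u \<and> g \<in> gen V}"
  then obtain v u g where e: "e = (Cw v g, Cw u g)" "v \<in> I" "u \<in> I" "utree v u" "g \<in> gen V" by blast
  have "Zw v g \<subseteq> Cw u g"
    using adjacent_star(1)[OF e(4)] ID(1)[OF e(2)] gen_mono[of "{v}" "V \<inter> star u"] by (auto simp: mem_Zw mem_Cw)
  moreover have "Cw v g \<noteq> Cw u g" using Cw_eq_iff[OF e(2,5,3,5)] adjacent_star(3)[OF e(4)] by blast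
  ultimately show "e \<in> edges H" using e center_Cw by (auto simp: edges_def vertices_eq)
qed

lemma eclass_Cw_eq_iff:
  assumes v: "v \<in> I" "u \<in> I" "utree v u" "g \<in> gen V" and w: "v' \<in> I" "u' \<in> I" "utree v' u'" "k \<in> gen V"
  shows "eclass H (Cw v g, Cw u g) = eclass H (Cw v' k, Cw u' k) \<longleftrightarrow>
    v = v' \<and> u = u' \<and> (\<exists>h\<in>H. - g + (h + k) \<in> gen {v, u})"
proof -
  have "eclass H (Cw v g, Cw u g) = eclass H (Cw v' k, Cw u' k) \<longleftrightarrow>
     (\<exists>h\<in>H. Cw v g = conj_set h (Cw v' k) \<and> Cw u g = conj_set h (Cw u' k))"
  proof
    assume "eclass H (Cw v g, Cw u g) = eclass H (Cw v' k, Cw u' k)"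
    moreover have "(Cw v g, Cw u g) \<in> eclass H (Cw v g, Cw u g)"
      using subgrp_zero[OF H] by (force simp: eclass_def)
    ultimately show "\<exists>h\<in>H. Cw v g = conj_set h (Cw v' k) \<and> Cw u g = conj_set h (Cw u' k)"
      by (auto simp: eclass_def)
  next
    assume "\<exists>h\<in>H. Cw v g = conj_set h (Cw v' k) \<and> Cw u g = conj_set h (Cw u' k)"
    then obtain h where h: "h \<in> H" "Cw v g = conj_set h (Cw v' k)" "Cw u g = conj_set h (Cw u' k)" by blast
    have "eclass H (conj_set h C, conj_set h D) = eclass H (C, D)" for C D
    proof (intro equalityI subsetI)
      fix p assume "p \<in> eclass H (C, D)"
      then obtain k where "k \<in> H" "p = (conj_set (k - h) (conj_set h C), conj_set (k - h) (conj_set h D))"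
        by (auto simp: eclass_def simp flip: conj_set_add)
      then show "p \<in> eclass H (conj_set h C, conj_set h D)"
        using h subgrp_diff[OF H] by (auto simp: eclass_def)
    qed (use h subgrp_add[OF H] in \<open>auto simp: eclass_def simp flip: conj_set_add\<close>)
    then show "eclass H (Cw v g, Cw u g) = eclass H (Cw v' k, Cw u' k)" using h by simp
  qed
  moreover have "Cw v g = conj_set h (Cw v' k) \<and> Cw u g = conj_set h (Cw u' k) \<longleftrightarrow>
      v = v' \<and> u = u' \<and> - g + (h + k) \<in> gen {v, u}" if h: "h \<in> H" for h
  proof -
    have hk: "h + k \<in> gen V" using h HV w subgrp_add[OF subgrp_gen] by blast
    have "gen {v, u} = gen (V \<inter> star v) \<inter> gen (V \<inter> star u)"
    proof -
      have "{v, u} = (V \<inter> star v) \<inter> (V \<inter> star u)" using star_Int_star[OF v(3)] ID v by blast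
      then show ?thesis by (simp add: gen_Int)
    qed
    then show ?thesis
      using Cw_eq_iff[OF v(1,4) w(1) hk] Cw_eq_iff[OF v(2,4) w(2) hk] conj_Cw[OF h] by auto
  qed
  ultimately show ?thesis by blast
qed

end

section \<open>Local equations\<close>

text \<open>The second isomorphism theorem: restriction to \<open>K\<close> is a bijection, because
  a homomorphism vanishing on \<open>T\<close> is determined by its values on
  \<open>K\<close>.\<close>

lemma card_hom2_set_sum:
  assumes K: "subgrp K" and T: "subgrp T" and comm: "\<And>k t. k \<in> K \<Longrightarrow> t \<in> T \<Longrightarrow> k + t = t + k"
  shows "card (hom2 (set_sum K T) T) = card (hom2 K (K \<inter> T))"
proof -
  have KT: "K \<subseteq> set_sum K T" "T \<subseteq> set_sum K T" using set_sum_left[OF T] set_sum_right[OF K] by auto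
  have F: "S \<inter> K \<in> hom2 K (K \<inter> T)" "set_sum (S \<inter> K) T = S" if S: "S \<in> hom2 (set_sum K T) T" for S
  proof -
    have S': "T \<subseteq> S" "S \<subseteq> set_sum K T" 
      "\<And>x y. x \<in> set_sum K T \<Longrightarrow> y \<in> set_sum K T \<Longrightarrow> x + y \<in> S \<longleftrightarrow> (x \<in> S \<longleftrightarrow> y \<in> S)"
      using S by (auto simp: hom2_def)
    have "x + y \<in> S \<inter> K \<longleftrightarrow> (x \<in> S \<inter> K \<longleftrightarrow> y \<in> S \<inter> K)" if "x \<in> K" "y \<in> K" for x y
      using S'(3)[of x y] KT that subgrp_add[OF K that] by auto
    then show "S \<inter> K \<in> hom2 K (K \<inter> T)" using S' by (auto simp: hom2_def)
    have kt: "k + t \<in> S \<longleftrightarrow> k \<in> S" if "k \<in> K" "t \<in> T" for k t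
      using S'(3)[of k t] S'(1) KT that by auto
    show "set_sum (S \<inter> K) T = S"
    proof (intro equalityI subsetI)
      fix x assume "x \<in> S"
      then obtain k t where "k \<in> K" "t \<in> T" "x = k + t" using S'(2) by (auto simp: set_sum_def)
      then show "x \<in> set_sum (S \<inter> K) T" using kt \<open>x \<in> S\<close> by (auto simp: set_sumI)
    qed (auto simp: set_sum_def kt)
  qed
  have G: "set_sum S T \<in> hom2 (set_sum K T) T" "set_sum S T \<inter> K = S" if S: "S \<in> hom2 K (K \<inter> T)" for S
  proof -
    have S': "K \<inter> T \<subseteq> S" "S \<subseteq> K" "\<And>x y. x \<in> K \<Longrightarrow> y \<in> K \<Longrightarrow> x + y \<in> S \<longleftrightarrow> (x \<in> S \<longleftrightarrow> y \<in> S)"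
      using S by (auto simp: hom2_def)
    have kt: "k + t \<in> set_sum S T \<longleftrightarrow> k \<in> S" if kt: "k \<in> K" "t \<in> T" for k t
    proof
      assume "k + t \<in> set_sum S T"
      then obtain s t' where st: "s \<in> S" "t' \<in> T" "k + t = s + t'" by (auto simp: set_sum_def)
      have "- s + (k + t) - t = - s + (s + t') - t" using st by simp
      then have e: "- s + k = t' - t" by (simp add: group_norm)
      have "- s + k \<in> K" using st kt S' subgrp_minus[OF K] subgrp_add[OF K] by blast
      moreover have "t' - t \<in> T" using st kt subgrp_diff[OF T] by blast
      ultimately have "- s + k \<in> S" using e S'(1) by auto
      then have "s + (- s + k) \<in> S" using S'(3)[of s "- s + k"] st S'(2) \<open>- s + k \<in> K\<close> by blast
      then show "k \<in> S" by simp
    qed (use that set_sumI in blast)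
    have "x + y \<in> set_sum S T \<longleftrightarrow> (x \<in> set_sum S T \<longleftrightarrow> y \<in> set_sum S T)"
      if xy: "x \<in> set_sum K T" "y \<in> set_sum K T" for x y
    proof -
      obtain k t k' t' where kt': "k \<in> K" "t \<in> T" "x = k + t" "k' \<in> K" "t' \<in> T" "y = k' + t'"
        using xy unfolding set_sum_def by blast
      have "x + y = k + (t + k') + t'" using kt' by (simp add: add.assoc)
      also have "t + k' = k' + t" using comm[OF kt'(4,2)] by simp
      also have "k + (k' + t) + t' = (k + k') + (t + t')" by (simp add: add.assoc)
      finally have "x + y \<in> set_sum S T \<longleftrightarrow> k + k' \<in> S"
        using kt[OF subgrp_add[OF K] subgrp_add[OF T]] kt' by simp
      then show ?thesis using kt kt' S'(3) by simp
    qed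
    moreover have "T \<subseteq> set_sum S T" 
    proof
      fix t assume "t \<in> T"
      moreover have "0 \<in> S" using S'(1) subgrp_zero[OF K] subgrp_zero[OF T] by blast
      ultimately show "t \<in> set_sum S T" using set_sumI[of 0 S t T] by simp
    qed
    moreover have "set_sum S T \<subseteq> set_sum K T" using S' by (auto simp: set_sum_def)
    ultimately show "set_sum S T \<in> hom2 (set_sum K T) T" by (simp add: hom2_def)
    have "k \<in> set_sum S T \<longleftrightarrow> k \<in> S" if "k \<in> K" for k using kt[OF that subgrp_zero[OF T]] by simp
    then show "set_sum S T \<inter> K = S" using S' by blast
  qed
  have "bij_betw (\<lambda>S. S \<inter> K) (hom2 (set_sum K T) T) (hom2 K (K \<inter> T))"
    by (rule bij_betw_byWitness[where f' = "\<lambda>S. set_sum S T"]) (use F G in blast)+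
  then show ?thesis by (rule bij_betw_same_card)
qed

lemma set_sum_commute:
  assumes "\<And>a b. a \<in> A \<Longrightarrow> b \<in> B \<Longrightarrow> a + b = b + a" shows "set_sum A B = set_sum B A"
  unfolding set_sum_def using assms by (metis (lifting))

context finite_index
begin

text \<open>Conjugating \<open>H\<close> lets all indices be taken inside fixed standard subgroups
  instead of inside their translates by \<open>g\<close>.\<close>

abbreviation HK :: "ugroup \<Rightarrow> ugroup set" where "HK g \<equiv> conj_set (- g) H"

definition zet :: "tvert \<Rightarrow> ugroup \<Rightarrow> real" where
  "zet v g = real (ncosets (HK g) (gen {v}))"

text \<open>Minus the Euler characteristic of the free group on the neighbours of \<open>v\<close>.
  At a pivot this is the number of leaves, since \<open>Center\<close> is the one further
  neighbour.\<close>

definition chi :: "tvert \<Rightarrow> real" where "chi v = real (card (V \<inter> lk v)) - 1"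

lemma subgrp_HK: "subgrp (HK g)" by (rule subgrp_conj_set[OF H])

lemma finite_HK: "g \<in> gen V \<Longrightarrow> S \<subseteq> gen V \<Longrightarrow> finite (rcoset (HK g) ` S)"
proof -
  assume g: "g \<in> gen V" and S: "S \<subseteq> gen V"
  have "rcoset (HK g) ` S \<subseteq> (\<lambda>q. (+) (- g) ` q) ` rcoset H ` gen V"
  proof clarify
    fix s assume "s \<in> S"
    then have "g + s \<in> gen V" using g S subgrp_add[OF subgrp_gen] by blast
    moreover have "rcoset (HK g) s = (+) (- g) ` rcoset H (g + s)" by (simp add: rcoset_conj_set)
    ultimately show "rcoset (HK g) s \<in> (\<lambda>q. (+) (- g) ` q) ` rcoset H ` gen V" by blast
  qed
  then show ?thesis using fin by (meson finite_imageI finite_subset)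
qed

lemma chi_pos: "v \<in> I \<Longrightarrow> 0 < chi v"
  using good by (auto simp: good_def I_def chi_def)

lemma gen_sub_V: "v \<in> I \<Longrightarrow> gen {v} \<subseteq> gen V"
  using ID by (intro gen_mono) auto

lemma zet_pos:
  assumes "v \<in> I" "g \<in> gen V" shows "0 < zet v g"
proof -
  have "finite (rcoset (HK g) ` gen {v})" using finite_HK assms gen_sub_V by blast
  moreover have "rcoset (HK g) ` gen {v} \<noteq> {}" using subgrp_zero[OF subgrp_gen] by blast
  ultimately show ?thesis by (simp add: zet_def ncosets_def card_gt_0_iff)
qed

text \<open>The index of the vertex group is \<open>zet v g\<close> times the index \<open>d\<close>
  after dividing by \<open>gen {v}\<close>, and Schreier's formula makes the Euler characteristic
  multiplicative: \<open>xval (Cw v g) = d * chi v\<close>.\<close>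

lemma xval_Cw:
  assumes v: "v \<in> I" and g: "g \<in> gen V"
  shows "real (ncosets (HK g) (gen (V \<inter> star v))) * chi v = zet v g * xval (Cw v g)"
proof -
  let ?S = "gen (V \<inter> star v)" and ?T = "gen {v}"
  define K where "K = HK g \<inter> ?S"
  \<comment> \<open>\<open>schreier\<close> wants a group containing \<open>gen {v}\<close>. Passing
    from \<open>K\<close> to \<open>B\<close> costs exactly the index \<open>zet v g\<close> and
    does not change the homomorphisms that are counted.\<close>
  define B where "B = set_sum K ?T"
  define d where "d = ncosets B ?S"
  have VS: "V \<inter> star v = insert v (V \<inter> lk v)" using ID[OF v] by (auto simp: star_def)
  have TS: "?T \<subseteq> ?S" using VS by (intro gen_mono) auto
  have SV: "?S \<subseteq> gen V" by (intro gen_mono) auto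
  have K: "subgrp K" "K \<subseteq> ?S" by (simp_all add: K_def subgrp_Int subgrp_HK subgrp_gen)
  have comm: "k + t = t + k" if "k \<in> K" "t \<in> ?T" for k t
    using gen_star_commute[of k v t] that K gen_mono[of "V \<inter> star v" "star v"] by auto
  have B: "subgrp B" unfolding B_def using K(1) comm by (intro subgrp_set_sum subgrp_gen)
  have KB: "K \<subseteq> B" "?T \<subseteq> B" "B \<subseteq> ?S"
    unfolding B_def using set_sum_left[OF subgrp_gen] set_sum_right[OF K(1)] set_sum_subset[OF subgrp_gen K(2) TS] by auto
  have "ncosets (HK g) ?S = ncosets K ?S"
    by (rule ncosets_cong) (auto simp: K_def subgrp_HK subgrp_gen subgrp_Int)
  also have "\<dots> = ncosets K B * d" unfolding d_def by (rule ncosets_tower[OF K(1) B subgrp_gen KB(1,3)])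
  also have "ncosets K B = ncosets K ?T" unfolding B_def by (rule ncosets_set_sum) (use K subgrp_zero in auto)
  also have "\<dots> = ncosets (HK g) ?T"
    by (rule ncosets_cong) (use TS in \<open>auto simp: K_def subgrp_HK subgrp_gen subgrp_Int\<close>)
  finally have idx: "real (ncosets (HK g) ?S) = zet v g * real d" by (simp add: zet_def)
  have finB: "finite (rcoset B ` ?S)"
  proof (rule finite_rcosets_mono[OF _ _ B KB(1)])
    have "finite (rcoset (HK g) ` ?S)" using finite_HK[OF g SV] .
    then have "0 < ncosets (HK g) ?S" using subgrp_zero[OF subgrp_gen]
      by (auto simp: ncosets_def card_gt_0_iff)
    then have "0 < ncosets K ?S" using \<open>ncosets (HK g) ?S = ncosets K ?S\<close> by simp
    then show "finite (rcoset K ` ?S)" by (simp add: ncosets_def card_gt_0_iff)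
  qed (rule K)
  interpret sch: schreier v "V \<inter> lk v" B
    by unfold_locales (use ID[OF v] finV B KB finB VS in auto)
  have CK: "Cw v g = conj_set g K"
    by (simp add: Cw_def K_def conj_set_Int)
  have ZK: "center (Cw v g) = conj_set g (K \<inter> ?T)"
    using TS by (auto simp: center_Cw[OF v g] Zw_def K_def conj_set_Int mem_conj_set)
  have "center (Cw v g) = conj_set g (center K)" by (simp add: CK center_conj_set)
  then have cK: "center K = K \<inter> ?T" using ZK conj_set_inverse(1) by metis
  have "card (hom2 B ?T) = card (hom2 K (K \<inter> ?T))"
    unfolding B_def by (rule card_hom2_set_sum[OF K(1) subgrp_gen]) (rule comm)
  then have "card (hom2 K (K \<inter> ?T)) * 2 ^ d = 2 * 2 ^ (d * card (V \<inter> lk v))"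
    using sch.card_hom2 by (simp add: d_def ncosets_def VS)
  from arg_cong[OF this, of real]
  have X: "real (card (hom2 K (K \<inter> ?T))) * 2 ^ d = 2 * 2 ^ (d * card (V \<inter> lk v))" by simp
  have pos: "0 < real (card (hom2 K (K \<inter> ?T)))"
  proof (rule ccontr)
    assume "\<not> 0 < real (card (hom2 K (K \<inter> ?T)))"
    then have "real (card (hom2 K (K \<inter> ?T))) = 0" by simp
    with X show False by simp
  qed
  have "log 2 (real (card (hom2 K (K \<inter> ?T))) * 2 ^ d) = log 2 (real (card (hom2 K (K \<inter> ?T)))) + real d"
    using pos by (simp add: log_mult log_nat_power)
  moreover have "log 2 (2 * 2 ^ (d * card (V \<inter> lk v))) = 1 + real d * real (card (V \<inter> lk v))"
    by (simp add: log_mult log_nat_power)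
  ultimately have "xval K = real d * chi v"
    using X by (simp add: xval_def cK chi_def algebra_simps)
  then have "xval (Cw v g) = real d * chi v" using xval_conj_set[OF K(1)] by (simp add: CK)
  then show ?thesis using idx by simp
qed

text \<open>The index of the sum of the two centers in \<open>gen {v, u}\<close> is computed twice:
  through the edge group, and through a group containing all of \<open>gen {v}\<close>.\<close>

lemma iota_Cw:
  assumes v: "v \<in> I" and u: "u \<in> I" and vu: "utree v u" and g: "g \<in> gen V"
  shows "real (ncosets (HK g) (gen {v, u})) * iota (Cw v g, Cw u g) = zet v g * zet u g"
proof -
  let ?S = "gen {v, u}" and ?K = "HK g"
  let ?Kv = "?K \<inter> gen {v}" and ?Ku = "?K \<inter> gen {u}"
  define A where "A = set_sum ?Kv ?Ku"
  define B where "B = ?K \<inter> ?S"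
  \<comment> \<open>The intermediate group of the second computation: below it the index is that at
    \<open>v\<close>, above it that at \<open>u\<close>.\<close>
  define A' where "A' = set_sum (gen {v}) ?Ku"
  note G = subgrp_gen
  have u_lk: "{u} \<subseteq> lk v" using vu by (simp add: lk_def)
  have S: "?S = set_sum (gen {v}) (gen {u})" using gen_insert[OF u_lk] by simp
  have comm: "a + b = b + a" if "a \<in> gen {v}" "b \<in> gen {u}" for a b
    using lk_commute[of b v a] that gen_mono[OF u_lk] by auto
  have triv: "x = 0" if "x \<in> gen {v}" "x \<in> gen {u}" for x
    using gen_Int[of "{v}" "{u}"] adjacent_star(3)[OF vu] that by (auto simp: gen_empty)
  have Kv: "subgrp ?Kv" and Ku: "subgrp ?Ku" by (simp_all add: subgrp_Int subgrp_HK G)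
  have A: "subgrp A" unfolding A_def using comm by (intro subgrp_set_sum Kv Ku) auto
  have A': "subgrp A'" unfolding A'_def using comm by (intro subgrp_set_sum G Ku) auto
  have B: "subgrp B" by (simp add: B_def subgrp_Int subgrp_HK G)
  have vS: "gen {v} \<subseteq> ?S" and uS: "gen {u} \<subseteq> ?S" by (intro gen_mono; simp)+
  have AB: "A \<subseteq> B" unfolding A_def using vS uS by (intro set_sum_subset[OF B]) (auto simp: B_def)
  have AA': "A \<subseteq> A'" by (auto simp: A_def A'_def set_sum_def)
  have A'S: "A' \<subseteq> ?S" unfolding A'_def using vS uS by (intro set_sum_subset[OF G]) auto
  have "ncosets A ?S = ncosets A B * ncosets B ?S"
    by (rule ncosets_tower[OF A B G AB]) (simp add: B_def)
  moreover have "ncosets B ?S = ncosets ?K ?S"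
    by (rule ncosets_cong) (auto simp: B_def B[unfolded B_def] subgrp_HK G)
  moreover have "ncosets A ?S = ncosets A A' * ncosets A' ?S"
    by (rule ncosets_tower[OF A A' G AA' A'S])
  moreover have "ncosets A A' = ncosets ?K (gen {v})"
  proof -
    have "A' = set_sum ?Ku (gen {v})" unfolding A'_def using comm by (intro set_sum_commute) auto
    then have "ncosets A A' = ncosets A (gen {v})"
      using set_sum_right[OF Kv] subgrp_zero[OF Ku] by (simp add: A_def ncosets_set_sum[OF A[unfolded A_def]])
    also have "\<dots> = ncosets ?K (gen {v})"
    proof (rule ncosets_cong[OF A subgrp_HK G])
      have "a + b \<in> ?K" if "a \<in> ?Kv" "b \<in> ?Ku" for a b using that subgrp_add[OF subgrp_HK] by blast
      then show "A \<inter> gen {v} = ?K \<inter> gen {v}" using set_sum_left[OF Ku, of ?Kv] by (auto simp: A_def set_sum_def)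
    qed
    finally show ?thesis .
  qed
  moreover have "ncosets A' ?S = ncosets ?K (gen {u})"
  proof -
    have "gen {v} \<subseteq> A'" unfolding A'_def by (rule set_sum_left[OF Ku])
    then have "ncosets A' ?S = ncosets A' (gen {u})" unfolding S
      by (intro ncosets_set_sum[OF A'] subgrp_zero[OF G])
    also have "\<dots> = ncosets ?K (gen {u})"
    proof (rule ncosets_cong[OF A' subgrp_HK G])
      have "a = 0" if "a \<in> gen {v}" "b \<in> ?Ku" "a + b \<in> gen {u}" for a b
        using triv that subgrp_add_cancel_right[OF G[of "{u}"], of b a] by blast
      then have "a + b \<in> ?Ku" if "a \<in> gen {v}" "b \<in> ?Ku" "a + b \<in> gen {u}" for a b
        using that by (metis add_0_left)
      then have "A' \<inter> gen {u} \<subseteq> ?Ku" unfolding A'_def set_sum_def by blast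
      moreover have "?Ku \<subseteq> A'" unfolding A'_def by (rule set_sum_right[OF G])
      ultimately show "A' \<inter> gen {u} = ?K \<inter> gen {u}" by blast
    qed
    finally show ?thesis .
  qed
  moreover have "iota (Cw v g, Cw u g) = real (ncosets A B)"
  proof -
    have "Zw w g = conj_set g (?K \<inter> gen {w})" for w by (simp add: Zw_def conj_set_Int)
    then have "set_sum (center (Cw v g)) (center (Cw u g)) = conj_set g A"
      by (simp add: center_Cw v u g A_def set_sum_conj_set)
    moreover have "{v, u} = (V \<inter> star v) \<inter> (V \<inter> star u)" using star_Int_star[OF vu] ID v u by blast
    then have "Cw v g \<inter> Cw u g = conj_set g B"
      using gen_Int[of "V \<inter> star v" "V \<inter> star u"]
      by (auto simp: Cw_def B_def conj_set_Int mem_conj_set)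
    ultimately show ?thesis by (simp add: iota_def ncosets_conj_set[OF A])
  qed
  ultimately show ?thesis by (simp add: zet_def flip: of_nat_mult)
qed

section \<open>Counting cosets over classes of vertices and edges\<close>

abbreviation Om :: "ugroup set set" where "Om \<equiv> rcoset H ` gen V"

definition VC :: "ugroup set set set" where "VC = vclass H ` vertices H"
definition EC :: "(ugroup set \<times> ugroup set) set set" where "EC = eclass H ` edges H"

text \<open>A class has many labels \<open>(v, g)\<close>. One is chosen, and \<open>lab_Cw\<close>
  shows that the vertex and the index read off from it do not depend on the choice.\<close>

definition lab :: "ugroup set set \<Rightarrow> tvert \<times> ugroup" where
  "lab c = (SOME p. fst p \<in> I \<and> snd p \<in> gen V \<and> c = vclass H (Cw (fst p) (snd p)))"

definition kap :: "ugroup set set \<Rightarrow> tvert" where "kap c = fst (lab c)"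
definition zeta :: "ugroup set set \<Rightarrow> real" where "zeta c = zet (fst (lab c)) (snd (lab c))"

end

text \<open>Defined outside the locale because, like \<open>class_iota\<close>, it refers only to
  the class and not to the ambient graph; this is what an isomorphism preserves.\<close>

definition class_xval :: "'a::group_add set set \<Rightarrow> real" where
  "class_xval c = xval (SOME C. C \<in> c)"

definition class_iota :: "('a::group_add set \<times> 'a set) set \<Rightarrow> real" where
  "class_iota e = iota (SOME p. p \<in> e)"

context finite_index
begin

text \<open>Changing \<open>g\<close> by an element of \<open>H\<close> does not change
  \<open>HK g\<close>, and changing it by an element of the star conjugates \<open>HK g\<close> by
  something that centralizes \<open>gen {v}\<close>.\<close>

lemma zet_shift:
  assumes "v \<in> I" "h \<in> H" "- g + (h + k) \<in> gen (V \<inter> star v)"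
  shows "zet v g = zet v k"
proof -
  define s where "s = - g + (h + k)"
  have s: "s \<in> gen (star v)" using assms gen_mono[of "V \<inter> star v" "star v"] by (auto simp: s_def)
  have k: "k = - h + g + s" by (simp add: s_def group_norm)
  have Hk: "HK k = conj_set (- s) (HK g)"
    using conj_set_subgrp[OF H assms(2)] by (simp add: k minus_add conj_set_add)
  have t: "t \<in> HK k \<longleftrightarrow> t \<in> HK g" if "t \<in> gen {v}" for t
  proof -
    have "s + t = t + s" by (rule gen_star_commute[OF s that])
    then have "s + t + - s = t" by (simp add: add.assoc[of t s])
    then show ?thesis unfolding Hk mem_conj_set by simp
  qed
  have e: "HK g \<inter> gen {v} = HK k \<inter> gen {v}" using t by blast
  show ?thesis unfolding zet_def ncosets_cong[OF subgrp_HK subgrp_HK subgrp_gen e] ..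
qed

lemma VC_cases:
  assumes "c \<in> VC" obtains v g where "v \<in> I" "g \<in> gen V" "c = vclass H (Cw v g)"
  using assms by (auto simp: VC_def vertices_eq)

lemma vclass_in_VC: "v \<in> I \<Longrightarrow> g \<in> gen V \<Longrightarrow> vclass H (Cw v g) \<in> VC"
  unfolding VC_def vertices_eq by blast

lemma eclass_in_EC: "v \<in> I \<Longrightarrow> u \<in> I \<Longrightarrow> utree v u \<Longrightarrow> g \<in> gen V \<Longrightarrow> eclass H (Cw v g, Cw u g) \<in> EC"
  unfolding EC_def edges_eq by blast

lemma EC_cases:
  assumes "e \<in> EC"
  obtains v u g where "v \<in> I" "u \<in> I" "utree v u" "g \<in> gen V" "e = eclass H (Cw v g, Cw u g)"
  using assms by (auto simp: EC_def edges_eq)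

lemma lab_Cw:
  assumes v: "v \<in> I" "g \<in> gen V"
  shows "kap (vclass H (Cw v g)) = v" "zeta (vclass H (Cw v g)) = zet v g"
proof -
  let ?c = "vclass H (Cw v g)"
  have "\<exists>p. fst p \<in> I \<and> snd p \<in> gen V \<and> ?c = vclass H (Cw (fst p) (snd p))"
    using v by (intro exI[of _ "(v, g)"]) simp
  from someI_ex[OF this] have l: "fst (lab ?c) \<in> I" "snd (lab ?c) \<in> gen V"
    "?c = vclass H (Cw (fst (lab ?c)) (snd (lab ?c)))" by (auto simp: lab_def)
  from vclass_Cw_eq_iff[OF v l(1,2)] l(3) obtain h where "v = fst (lab ?c)" "h \<in> H"
    "- g + (h + snd (lab ?c)) \<in> gen (V \<inter> star v)" by blast
  then show "kap ?c = v" "zeta ?c = zet v g"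
    using zet_shift[OF v(1)] by (simp_all add: kap_def zeta_def)
qed

lemma class_xval_Cw: "class_xval (vclass H (Cw v g)) = xval (Cw v g)"
proof -
  have "Cw v g \<in> vclass H (Cw v g)" using subgrp_zero[OF H] by (force simp: vclass_def)
  then have "(SOME C. C \<in> vclass H (Cw v g)) \<in> vclass H (Cw v g)" by (rule someI)
  then show ?thesis using xval_conj_set[OF subgrp_Cw] by (auto simp: class_xval_def vclass_def)
qed

lemma iota_conj_set:
  assumes "subgrp (set_sum (center C) (center D))"
  shows "iota (conj_set h C, conj_set h D) = iota (C, D)"
  by (simp add: iota_def center_conj_set set_sum_conj_set ncosets_conj_set[OF assms] flip: conj_set_Int)

lemma class_iota_Cw:
  assumes "v \<in> I" "u \<in> I" "utree v u" "g \<in> gen V"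
  shows "class_iota (eclass H (Cw v g, Cw u g)) = iota (Cw v g, Cw u g)"
proof -
  let ?e = "eclass H (Cw v g, Cw u g)"
  have "(Cw v g, Cw u g) \<in> ?e" using subgrp_zero[OF H] by (force simp: eclass_def)
  then have "(SOME p. p \<in> ?e) \<in> ?e" by (rule someI)
  then obtain h where h: "(SOME p. p \<in> ?e) = (conj_set h (Cw v g), conj_set h (Cw u g))"
    by (auto simp: eclass_def)
  have "a + b = b + a" if "a \<in> center (Cw v g)" "b \<in> center (Cw u g)" for a b
  proof -
    have "(Cw v g, Cw u g) \<in> edges H" using assms by (auto simp: edges_eq)
    then have "a \<in> Cw u g" using that by (auto simp: edges_def)
    then show ?thesis using that by (auto simp: center_def)
  qed
  then have "subgrp (set_sum (center (Cw v g)) (center (Cw u g)))"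
    by (intro subgrp_set_sum subgrp_center subgrp_Cw)
  then show ?thesis using iota_conj_set h by (simp add: class_iota_def)
qed

lemma src_eclass: "fst ` eclass H (C, D) = vclass H C"
  and dst_eclass: "snd ` eclass H (C, D) = vclass H D"
  by (auto simp: eclass_def vclass_def image_image)

text \<open>The choice of x in the coset q is irrelevant.\<close>
definition fV :: "tvert \<Rightarrow> ugroup set \<Rightarrow> ugroup set set" where
  "fV v q = vclass H (Cw v (SOME x. x \<in> q))"

definition fE :: "tvert \<Rightarrow> tvert \<Rightarrow> ugroup set \<Rightarrow> (ugroup set \<times> ugroup set) set" where
  "fE v u q = eclass H (Cw v (SOME x. x \<in> q), Cw u (SOME x. x \<in> q))"

lemma some_rcoset: "\<exists>h\<in>H. (SOME y. y \<in> rcoset H x) = h + x"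
proof -
  have "x \<in> rcoset H x" by (simp add: mem_rcoset subgrp_zero[OF H])
  then have "(SOME y. y \<in> rcoset H x) \<in> rcoset H x" by (rule someI)
  then show ?thesis by (auto simp: rcoset_def)
qed

lemma fE_rcoset:
  assumes "v \<in> I" "u \<in> I" "utree v u" "x \<in> gen V"
  shows "fE v u (rcoset H x) = eclass H (Cw v x, Cw u x)"
proof -
  obtain h where h: "h \<in> H" "(SOME y. y \<in> rcoset H x) = h + x" using some_rcoset by blast
  have "h + x \<in> gen V" using h HV assms subgrp_add[OF subgrp_gen] by blast
  moreover have "- (h + x) + (h + x) \<in> gen {v, u}" by (simp add: subgrp_zero[OF subgrp_gen])
  ultimately show ?thesis unfolding fE_def h(2) using eclass_Cw_eq_iff assms h(1) by blast
qed

lemma fV_rcoset: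
  assumes "v \<in> I" "x \<in> gen V"
  shows "fV v (rcoset H x) = vclass H (Cw v x)"
proof -
  obtain h where h: "h \<in> H" "(SOME y. y \<in> rcoset H x) = h + x" using some_rcoset by blast
  have "h + x \<in> gen V" using h HV assms subgrp_add[OF subgrp_gen] by blast
  moreover have "- (h + x) + (h + x) \<in> gen (V \<inter> star v)" by (simp add: subgrp_zero[OF subgrp_gen])
  ultimately show ?thesis unfolding fV_def h(2) using vclass_Cw_eq_iff assms h(1) by blast
qed

text \<open>The fibre is the set of cosets of \<open>H\<close> inside one double coset of
  \<open>H\<close> and \<open>S\<close>; these correspond to the cosets of \<open>HK g\<close> met
  by \<open>S\<close>.\<close>

lemma fiber_rcosets:
  assumes g: "g \<in> gen V" and S: "S \<subseteq> gen V" "subgrp S"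
    and f: "\<And>x. x \<in> gen V \<Longrightarrow> f (rcoset H x) = c \<longleftrightarrow> (\<exists>h\<in>H. - g + (h + x) \<in> S)"
  shows "card {q \<in> Om. f q = c} = ncosets (HK g) S"
proof -
  have "{q \<in> Om. f q = c} = (\<lambda>s. rcoset H (g + s)) ` S"
  proof (intro equalityI subsetI)
    fix q assume "q \<in> {q \<in> Om. f q = c}"
    then obtain x h where x: "x \<in> gen V" "q = rcoset H x" "h \<in> H" "- g + (h + x) \<in> S" using f by blast
    then have "rcoset H (g + (- g + (h + x))) = q" by (simp add: rcoset_absorb[OF H])
    then show "q \<in> (\<lambda>s. rcoset H (g + s)) ` S" using x by blast
  next
    fix q assume "q \<in> (\<lambda>s. rcoset H (g + s)) ` S"
    then obtain s where s: "s \<in> S" "q = rcoset H (g + s)" by blast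
    have gs: "g + s \<in> gen V" using s g S subgrp_add[OF subgrp_gen] by blast
    have "- g + (0 + (g + s)) \<in> S" using s by simp
    then have "f (rcoset H (g + s)) = c" using f[OF gs] subgrp_zero[OF H] by blast
    then show "q \<in> {q \<in> Om. f q = c}" using s gs by blast
  qed
  moreover have "card ((\<lambda>s. rcoset H (g + s)) ` S) = card ((\<lambda>s. rcoset (HK g) s) ` S)"
    by (rule card_image_rcoset_cong[OF H subgrp_HK]) (simp add: mem_conj_set group_norm)
  ultimately show ?thesis by (simp add: ncosets_def)
qed

lemma card_fV:
  assumes v: "v \<in> I" and g: "g \<in> gen V"
  defines "c \<equiv> vclass H (Cw v g)"
  shows "real (card {q \<in> Om. fV v q = c}) * chi v = zeta c * class_xval c"
proof -
  have "card {q \<in> Om. fV v q = c} = ncosets (HK g) (gen (V \<inter> star v))"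
  proof (rule fiber_rcosets[OF g _ subgrp_gen])
    fix x assume x: "x \<in> gen V"
    show "fV v (rcoset H x) = c \<longleftrightarrow> (\<exists>h\<in>H. - g + (h + x) \<in> gen (V \<inter> star v))"
      using vclass_Cw_eq_iff[OF v g v x] fV_rcoset[OF v x] by (auto simp: c_def)
  qed (intro gen_mono; blast)
  then show ?thesis using xval_Cw[OF v g] lab_Cw[OF v g] class_xval_Cw by (simp add: c_def)
qed

lemma card_fE:
  assumes v: "v \<in> I" "u \<in> I" "utree v u" and g: "g \<in> gen V"
  defines "e \<equiv> eclass H (Cw v g, Cw u g)"
  shows "real (card {q \<in> Om. fE v u q = e}) * class_iota e = zeta (fst ` e) * zeta (snd ` e)"
proof -
  have "card {q \<in> Om. fE v u q = e} = ncosets (HK g) (gen {v, u})"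
  proof (rule fiber_rcosets[OF g _ subgrp_gen])
    fix x assume x: "x \<in> gen V"
    show "fE v u (rcoset H x) = e \<longleftrightarrow> (\<exists>h\<in>H. - g + (h + x) \<in> gen {v, u})"
      using eclass_Cw_eq_iff[OF v g v x] fE_rcoset[OF v x] by (auto simp: e_def)
  qed (intro gen_mono; use ID v in blast)
  then show ?thesis
    using iota_Cw[OF v g] lab_Cw v g class_iota_Cw[OF v g] by (simp add: e_def src_eclass dst_eclass)
qed

lemma iota_pos:
  assumes "e \<in> EC" shows "0 < class_iota e"
proof -
  obtain v u g where vu: "v \<in> I" "u \<in> I" "utree v u" "g \<in> gen V" "e = eclass H (Cw v g, Cw u g)"
    using EC_cases[OF assms] .
  have "0 < zeta (fst ` e) * zeta (snd ` e)"
    using zet_pos lab_Cw vu by (simp add: src_eclass dst_eclass)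
  then have "class_iota e \<noteq> 0" using card_fE[OF vu(1-4)] vu(5) by auto
  moreover have "0 \<le> class_iota e" using class_iota_Cw[OF vu(1-4)] vu(5) by (simp add: iota_def)
  ultimately show ?thesis by simp
qed

lemma kap_edge:
  assumes "e \<in> EC" shows "fst ` e \<in> VC" "snd ` e \<in> VC" "utree (kap (fst ` e)) (kap (snd ` e))"
proof -
  obtain v u g where vu: "v \<in> I" "u \<in> I" "utree v u" "g \<in> gen V" "e = eclass H (Cw v g, Cw u g)"
    using EC_cases[OF assms] .
  then show "fst ` e \<in> VC" "snd ` e \<in> VC" "utree (kap (fst ` e)) (kap (snd ` e))"
    using lab_Cw by (auto simp: src_eclass dst_eclass vclass_in_VC)
qed

lemma fV_image: "v \<in> I \<Longrightarrow> fV v ` Om = {c \<in> VC. kap c = v}"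
proof (intro equalityI subsetI)
  fix c assume v: "v \<in> I" and "c \<in> {c \<in> VC. kap c = v}"
  then obtain w g where "w \<in> I" "g \<in> gen V" "c = vclass H (Cw w g)" "kap c = v" using VC_cases by blast
  then have "w = v" "c = fV v (rcoset H g)" using lab_Cw(1) fV_rcoset by auto
  then show "c \<in> fV v ` Om" using \<open>g \<in> gen V\<close> by blast
qed (auto simp: fV_rcoset lab_Cw vclass_in_VC)

lemma kap_I: "c \<in> VC \<Longrightarrow> kap c \<in> I"
  using VC_cases lab_Cw(1) by metis

lemma finite_VC: "finite VC"
proof -
  have "VC = (\<Union>v\<in>I. fV v ` Om)" using fV_image kap_I by auto
  moreover have "finite I" using finV by (simp add: I_def)
  ultimately show ?thesis using fin by simp
qed

lemma fE_in_EC: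
  assumes "v \<in> I" "u \<in> I" "utree v u" "q \<in> Om"
  shows "fE v u q \<in> EC" "fst ` fE v u q = fV v q" "snd ` fE v u q = fV u q"
proof -
  obtain x where x: "x \<in> gen V" "q = rcoset H x" using assms by blast
  note e = fE_rcoset[OF assms(1-3) x(1)] fV_rcoset[OF assms(1) x(1)] fV_rcoset[OF assms(2) x(1)]
  show "fE v u q \<in> EC" "fst ` fE v u q = fV v q" "snd ` fE v u q = fV u q"
    unfolding x(2) e src_eclass dst_eclass using assms x by (simp_all add: eclass_in_EC)
qed

lemma EC_fE:
  assumes "e \<in> EC" obtains g where "g \<in> gen V" "e = fE (kap (fst ` e)) (kap (snd ` e)) (rcoset H g)"
    "e = eclass H (Cw (kap (fst ` e)) g, Cw (kap (snd ` e)) g)"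
proof -
  obtain v u g where vu: "v \<in> I" "u \<in> I" "utree v u" "g \<in> gen V" "e = eclass H (Cw v g, Cw u g)"
    using EC_cases[OF assms] .
  then have "kap (fst ` e) = v" "kap (snd ` e) = u" using lab_Cw by (simp_all add: src_eclass dst_eclass)
  then show ?thesis using that[of g] fE_rcoset[OF vu(1-4)] vu by simp
qed

lemma finite_EC: "finite EC"
proof -
  have "EC \<subseteq> (\<Union>v\<in>I. \<Union>u\<in>I. fE v u ` Om)"
  proof
    fix e assume e: "e \<in> EC"
    obtain g where "g \<in> gen V" "e = fE (kap (fst ` e)) (kap (snd ` e)) (rcoset H g)" using EC_fE[OF e] .
    then show "e \<in> (\<Union>v\<in>I. \<Union>u\<in>I. fE v u ` Om)" using kap_edge[OF e] kap_I by blast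
  qed
  moreover have "finite I" using finV by (simp add: I_def)
  ultimately show ?thesis using fin by (simp add: finite_subset)
qed

lemma card_fV_class: "c \<in> VC \<Longrightarrow> real (card {q \<in> Om. fV (kap c) q = c}) * chi (kap c) = zeta c * class_xval c"
proof -
  assume "c \<in> VC"
  then obtain v g where vg: "v \<in> I" "g \<in> gen V" and c: "c = vclass H (Cw v g)" by (rule VC_cases)
  show ?thesis unfolding c lab_Cw(1)[OF vg] by (rule card_fV[OF vg])
qed

lemma card_fE_class:
  "e \<in> EC \<Longrightarrow> real (card {q \<in> Om. fE (kap (fst ` e)) (kap (snd ` e)) q = e}) = zeta (fst ` e) * zeta (snd ` e) / class_iota e"
proof -
  assume e: "e \<in> EC"
  obtain g where g: "g \<in> gen V" "e = eclass H (Cw (kap (fst ` e)) g, Cw (kap (snd ` e)) g)" by (rule EC_fE[OF e])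
  show ?thesis
    using card_fE[OF kap_I kap_I kap_edge(3)[OF e] g(1), folded g(2)] kap_edge[OF e] iota_pos[OF e]
    by (simp add: field_simps)
qed

lemma zeta_pos: "c \<in> VC \<Longrightarrow> 0 < zeta c"
  by (erule VC_cases) (simp add: lab_Cw(2) zet_pos)

lemma class_xval_pos: assumes "c \<in> VC" shows "0 < class_xval c"
proof -
  have "kap c \<in> I" using assms by (rule kap_I)
  then have "c \<in> fV (kap c) ` Om" using fV_image assms by blast
  then have "{q \<in> Om. fV (kap c) q = c} \<noteq> {}" by auto
  then have "0 < card {q \<in> Om. fV (kap c) q = c}" using fin by (simp add: card_gt_0_iff)
  then have "0 < zeta c * class_xval c"
    using card_fV_class[OF assms] chi_pos[OF kap_I[OF assms]] by (metis mult_pos_pos of_nat_0_less_iff)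
  then show ?thesis using zeta_pos[OF assms] by (simp add: zero_less_mult_iff)
qed

text \<open>Every coset of \<open>H\<close> lies over exactly one class of type \<open>v\<close>,
  and the fibre sizes are known from \<open>card_fV_class\<close>.\<close>

lemma total_eq:
  assumes v: "v \<in> I"
  shows "(\<Sum>c | c \<in> VC \<and> kap c = v. zeta c * class_xval c) = real (card Om) * chi v"
proof -
  have "(\<Sum>c | c \<in> VC \<and> kap c = v. zeta c * class_xval c) = (\<Sum>c | c \<in> VC \<and> kap c = v. real (card {q \<in> Om. fV v q = c}) * chi v)"
    by (rule sum.cong) (auto simp: card_fV_class)
  also have "\<dots> = (\<Sum>c\<in>fV v ` Om. \<Sum>q\<in>{q \<in> Om. fV v q = c}. chi v)"
    by (simp add: fV_image[OF v])
  also have "\<dots> = (\<Sum>q\<in>Om. chi v)" using fin by (intro sum.group) auto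
  finally show ?thesis by simp
qed

text \<open>The cosets over \<open>c\<close> are distributed among the edge classes from
  \<open>c\<close> to type \<open>u\<close>; inserting the sizes of all fibres and cancelling
  \<open>zeta c\<close> gives the equation.\<close>

lemma star_eq_src:
  assumes c: "c \<in> VC" and u: "u \<in> I" "utree (kap c) u"
  shows "(\<Sum>e | e \<in> EC \<and> fst ` e = c \<and> kap (snd ` e) = u. zeta (snd ` e) / class_iota e) = class_xval c / chi (kap c)"
proof -
  let ?v = "kap c" and ?F = "{q \<in> Om. fV (kap c) q = c}"
  let ?E = "{e. e \<in> EC \<and> fst ` e = c \<and> kap (snd ` e) = u}"
  have v: "?v \<in> I" using c by (rule kap_I)
  have kapu: "kap (fV u q) = u" if "q \<in> Om" for q using fV_image[OF u(1)] that by blast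
  have "(\<Sum>e\<in>?E. zeta c * (zeta (snd ` e) / class_iota e)) = (\<Sum>e\<in>?E. \<Sum>q\<in>{q \<in> ?F. fE ?v u q = e}. 1)"
  proof (rule sum.cong[OF HOL.refl])
    fix e assume e: "e \<in> ?E"
    have k: "kap (fst ` e) = ?v" "kap (snd ` e) = u" using e by blast+
    have "fV ?v q = c" if q: "q \<in> Om" "fE ?v u q = e" for q
    proof -
      have "fV ?v q = fst ` e" using fE_in_EC(2)[OF v u q(1)] unfolding q(2) by (rule HOL.sym)
      then show ?thesis using e by blast
    qed
    then have "{q \<in> ?F. fE ?v u q = e} = {q \<in> Om. fE (kap (fst ` e)) (kap (snd ` e)) q = e}"
      unfolding k by blast
    then show "zeta c * (zeta (snd ` e) / class_iota e) = (\<Sum>q\<in>{q \<in> ?F. fE ?v u q = e}. 1)"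
      using e card_fE_class[of e] by simp
  qed
  also have "\<dots> = (\<Sum>q\<in>?F. 1)"
  proof (rule sum.group)
    show "fE ?v u ` ?F \<subseteq> ?E"
    proof (rule image_subsetI)
      fix q assume "q \<in> ?F"
      then show "fE ?v u q \<in> ?E" using kapu by (simp add: fE_in_EC[OF v u])
    qed
  qed (use fin finite_EC in simp_all)
  finally have "zeta c * (\<Sum>e\<in>?E. zeta (snd ` e) / class_iota e) = real (card ?F)"
    by (simp add: sum_distrib_left)
  also have "\<dots> = zeta c * (class_xval c / chi ?v)"
    using card_fV_class[OF c] chi_pos[OF v] by (simp add: field_simps)
  finally show ?thesis using zeta_pos[OF c] unfolding mult_cancel_left by auto
qed

lemma star_eq_dst:
  assumes c: "c \<in> VC" and u: "u \<in> I" "utree u (kap c)"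
  shows "(\<Sum>e | e \<in> EC \<and> snd ` e = c \<and> kap (fst ` e) = u. zeta (fst ` e) / class_iota e) = class_xval c / chi (kap c)"
proof -
  let ?v = "kap c" and ?F = "{q \<in> Om. fV (kap c) q = c}"
  let ?E = "{e. e \<in> EC \<and> snd ` e = c \<and> kap (fst ` e) = u}"
  have v: "?v \<in> I" using c by (rule kap_I)
  have kapu: "kap (fV u q) = u" if "q \<in> Om" for q using fV_image[OF u(1)] that by blast
  have "(\<Sum>e\<in>?E. zeta c * (zeta (fst ` e) / class_iota e)) = (\<Sum>e\<in>?E. \<Sum>q\<in>{q \<in> ?F. fE u ?v q = e}. 1)"
  proof (rule sum.cong[OF HOL.refl])
    fix e assume e: "e \<in> ?E"
    have k: "kap (fst ` e) = u" "kap (snd ` e) = ?v" using e by blast+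
    have "fV ?v q = c" if q: "q \<in> Om" "fE u ?v q = e" for q
    proof -
      have "fV ?v q = snd ` e" using fE_in_EC(3)[OF u(1) v u(2) q(1)] unfolding q(2) by (rule HOL.sym)
      then show ?thesis using e by blast
    qed
    then have "{q \<in> ?F. fE u ?v q = e} = {q \<in> Om. fE (kap (fst ` e)) (kap (snd ` e)) q = e}"
      unfolding k by blast
    then show "zeta c * (zeta (fst ` e) / class_iota e) = (\<Sum>q\<in>{q \<in> ?F. fE u ?v q = e}. 1)"
      using e card_fE_class[of e] by (simp add: mult.commute)
  qed
  also have "\<dots> = (\<Sum>q\<in>?F. 1)"
  proof (rule sum.group)
    show "fE u ?v ` ?F \<subseteq> ?E"
    proof (rule image_subsetI)
      fix q assume "q \<in> ?F"
      then show "fE u ?v q \<in> ?E" using kapu by (simp add: fE_in_EC[OF u(1) v u(2)])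
    qed
  qed (use fin finite_EC in simp_all)
  finally have "zeta c * (\<Sum>e\<in>?E. zeta (fst ` e) / class_iota e) = real (card ?F)"
    by (simp add: sum_distrib_left)
  also have "\<dots> = zeta c * (class_xval c / chi ?v)"
    using card_fV_class[OF c] chi_pos[OF v] by (simp add: field_simps)
  finally show ?thesis using zeta_pos[OF c] unfolding mult_cancel_left by auto
qed

text \<open>For fixed \<open>g\<close> each vertex is joined to the one at \<open>Center\<close>.
  Lengthening \<open>g\<close> by one generator does not affect the vertex at an interior
  \<open>p\<close> whose star contains that generator, so one can pass from any \<open>g\<close> to
  0.\<close>

lemma connected:
  assumes edge: "\<And>e. e \<in> EC \<Longrightarrow> Pr (fst ` e) \<longleftrightarrow> Pr (snd ` e)" and c: "c \<in> VC" "c' \<in> VC"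
  shows "Pr c \<longleftrightarrow> Pr c'"
proof -
  have C: "Center \<in> I" using good by (simp add: good_def I_def interior_def)
  have adj: "Pr (vclass H (Cw v g)) \<longleftrightarrow> Pr (vclass H (Cw Center g))" if "v \<in> I" "g \<in> gen V" for v g
  proof (cases "v = Center")
    case False
    then have "utree v Center" using ID[OF that(1)] by (auto simp: interior_def Piv_def utree_def)
    then have "eclass H (Cw v g, Cw Center g) \<in> EC" using that C by (simp add: eclass_in_EC)
    from edge[OF this] show ?thesis by (simp add: src_eclass dst_eclass)
  qed simp
  have "Pr (vclass H (Cw Center g)) \<longleftrightarrow> Pr (vclass H (Cw Center 0))" if "g \<in> gen V" for g
    using that
  proof (induction rule: gen_induct_right)
    case (ltr v b y)
    obtain p where p: "p \<in> V" "interior p" "v \<in> star p" using good ltr by (auto simp: good_def)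
    have "ltr v b \<in> gen (V \<inter> star p)" using p ltr by (simp add: ltr_in_gen)
    then have "Cw p (y + ltr v b) = Cw p y" by (rule Cw_shift)
    moreover have "y + ltr v b \<in> gen V" using ltr subgrp_add[OF subgrp_gen] ltr_in_gen by blast
    ultimately show ?case using adj[of p y] adj[of p "y + ltr v b"] p ltr by (simp add: I_def)
  qed simp
  then have "Pr c \<longleftrightarrow> Pr (vclass H (Cw Center 0))" if "c \<in> VC" for c
    using VC_cases[OF that] adj by metis
  then show ?thesis using c by blast
qed

end

section \<open>Comparing two solutions of the local equations\<close>

text \<open>The parameters up to \<open>io\<close> are determined by \<open>H\<close> alone, the
  others come from an ambient group, \<open>N\<close> being the index of \<open>H\<close>.
  Connectedness is phrased by predicates so that no paths have to be handled.\<close>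

locale solution =
  fixes VC :: "'c set" and EC :: "'e set" and src dst :: "'e \<Rightarrow> 'c" and xv :: "'c \<Rightarrow> real" and io :: "'e \<Rightarrow> real"
    and I :: "tvert set" and kap :: "'c \<Rightarrow> tvert" and zeta :: "'c \<Rightarrow> real" and chi :: "tvert \<Rightarrow> real" and N :: real
  assumes fin: "finite VC" "finite EC"
    and kap_I: "c \<in> VC \<Longrightarrow> kap c \<in> I"
    and ends: "e \<in> EC \<Longrightarrow> src e \<in> VC" "e \<in> EC \<Longrightarrow> dst e \<in> VC"
    and kap_edge: "e \<in> EC \<Longrightarrow> utree (kap (src e)) (kap (dst e))"
    and zeta_pos: "c \<in> VC \<Longrightarrow> 0 < zeta c" and xv_pos: "c \<in> VC \<Longrightarrow> 0 < xv c"
    and chi_pos: "v \<in> I \<Longrightarrow> 0 < chi v" and N_pos: "0 < N"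
    and Center_I: "Center \<in> I" and I_interior: "v \<in> I \<Longrightarrow> interior v"
    and total: "v \<in> I \<Longrightarrow> (\<Sum>c | c \<in> VC \<and> kap c = v. zeta c * xv c) = N * chi v"
    and star_src: "c \<in> VC \<Longrightarrow> u \<in> I \<Longrightarrow> utree (kap c) u \<Longrightarrow>
      (\<Sum>e | e \<in> EC \<and> src e = c \<and> kap (dst e) = u. zeta (dst e) / io e) = xv c / chi (kap c)"
    and star_dst: "c \<in> VC \<Longrightarrow> u \<in> I \<Longrightarrow> utree u (kap c) \<Longrightarrow>
      (\<Sum>e | e \<in> EC \<and> dst e = c \<and> kap (src e) = u. zeta (src e) / io e) = xv c / chi (kap c)"
    and conn: "(\<And>e. e \<in> EC \<Longrightarrow> Pr (src e) \<longleftrightarrow> Pr (dst e)) \<Longrightarrow> c \<in> VC \<Longrightarrow> c' \<in> VC \<Longrightarrow> Pr c \<longleftrightarrow> Pr c'"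
begin

text \<open>The equations at the sources, added up with arbitrary weights \<open>w\<close>; later
  \<open>w\<close> is the \<open>zeta\<close> of the other solution.\<close>

lemma sum_src:
  assumes T: "T \<subseteq> VC" and u: "u \<in> I" "\<And>c. c \<in> T \<Longrightarrow> utree (kap c) u"
  shows "(\<Sum>e | e \<in> EC \<and> src e \<in> T \<and> kap (dst e) = u. w (src e) * zeta (dst e) / io e) =
    (\<Sum>c\<in>T. w c * xv c / chi (kap c))"
proof -
  let ?E = "{e. e \<in> EC \<and> src e \<in> T \<and> kap (dst e) = u}"
  have "(\<Sum>e\<in>?E. w (src e) * zeta (dst e) / io e) = (\<Sum>c\<in>T. \<Sum>e\<in>{e \<in> ?E. src e = c}. w (src e) * zeta (dst e) / io e)"
    using fin T by (intro sum.group[symmetric]) (auto intro: finite_subset)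
  also have "\<dots> = (\<Sum>c\<in>T. w c * xv c / chi (kap c))"
  proof (rule sum.cong[OF HOL.refl])
    fix c assume c: "c \<in> T"
    have "{e \<in> ?E. src e = c} = {e. e \<in> EC \<and> src e = c \<and> kap (dst e) = u}" using c by blast
    then have "(\<Sum>e\<in>{e \<in> ?E. src e = c}. w (src e) * zeta (dst e) / io e) =
      (\<Sum>e | e \<in> EC \<and> src e = c \<and> kap (dst e) = u. w c * (zeta (dst e) / io e))"
      by (intro sum.cong) auto
    also have "\<dots> = w c * (xv c / chi (kap c))"
      using c T u by (subst star_src[symmetric]) (auto simp: sum_distrib_left)
    finally show "(\<Sum>e\<in>{e \<in> ?E. src e = c}. w (src e) * zeta (dst e) / io e) = w c * xv c / chi (kap c)" by simp
  qed
  finally show ?thesis .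
qed

lemma sum_dst:
  assumes T: "T \<subseteq> VC" and u: "u \<in> I" "\<And>c. c \<in> T \<Longrightarrow> utree u (kap c)"
  shows "(\<Sum>e | e \<in> EC \<and> dst e \<in> T \<and> kap (src e) = u. zeta (src e) * w (dst e) / io e) =
    (\<Sum>c\<in>T. w c * xv c / chi (kap c))"
proof -
  let ?E = "{e. e \<in> EC \<and> dst e \<in> T \<and> kap (src e) = u}"
  have "(\<Sum>e\<in>?E. zeta (src e) * w (dst e) / io e) = (\<Sum>c\<in>T. \<Sum>e\<in>{e \<in> ?E. dst e = c}. zeta (src e) * w (dst e) / io e)"
    using fin T by (intro sum.group[symmetric]) (auto intro: finite_subset)
  also have "\<dots> = (\<Sum>c\<in>T. w c * xv c / chi (kap c))"
  proof (rule sum.cong[OF HOL.refl])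
    fix c assume c: "c \<in> T"
    have "{e \<in> ?E. dst e = c} = {e. e \<in> EC \<and> dst e = c \<and> kap (src e) = u}" using c by blast
    then have "(\<Sum>e\<in>{e \<in> ?E. dst e = c}. zeta (src e) * w (dst e) / io e) =
      (\<Sum>e | e \<in> EC \<and> dst e = c \<and> kap (src e) = u. w c * (zeta (src e) / io e))"
      by (intro sum.cong) auto
    also have "\<dots> = w c * (xv c / chi (kap c))"
      using c T u by (subst star_dst[symmetric]) (auto simp: sum_distrib_left)
    finally show "(\<Sum>e\<in>{e \<in> ?E. dst e = c}. zeta (src e) * w (dst e) / io e) = w c * xv c / chi (kap c)" by simp
  qed
  finally show ?thesis .
qed

lemma exists_class: "v \<in> I \<Longrightarrow> \<exists>c\<in>VC. kap c = v"
proof (rule ccontr)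
  assume v: "v \<in> I" and "\<not> (\<exists>c\<in>VC. kap c = v)"
  then have "{c. c \<in> VC \<and> kap c = v} = {}" by blast
  then have "N * chi v = 0" using total[OF v] by (simp only: sum.empty)
  then show False using N_pos chi_pos[OF v] by simp
qed

lemma I_cases: "v \<in> I \<Longrightarrow> v = Center \<or> v \<in> Piv"
  using I_interior by (auto simp: interior_def)

lemma utree_Piv: "v \<in> Piv \<Longrightarrow> utree Center v" "v \<in> Piv \<Longrightarrow> utree v Center"
  by (auto simp: Piv_def utree_def)

lemma alternate: "e \<in> EC \<Longrightarrow> kap (src e) = Center \<longleftrightarrow> kap (dst e) \<noteq> Center"
  using P.bipartite[OF kap_edge[of e]] I_cases[OF kap_I[OF ends(1)[of e]]] I_cases[OF kap_I[OF ends(2)[of e]]]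
  by auto

lemma kap_Piv: "c \<in> VC \<Longrightarrow> kap c \<noteq> Center \<Longrightarrow> kap c \<in> Piv"
  using I_cases kap_I by blast

end

locale two_solutions =
  S: solution VC EC src dst xv io I kap zeta chi N +
  S': solution VC EC src dst xv io I' kap' zeta' chi' N'
  for VC :: "'c set" and EC :: "'e set" and src dst xv io I kap zeta chi N I' kap' zeta' chi' N'
begin

text \<open>In both solutions the type alternates along every edge, so agreement of the two types is
  constant along edges, hence on the connected graph.\<close>

lemma dichotomy:
  "(\<forall>c\<in>VC. kap c = Center \<longleftrightarrow> kap' c = Center) \<or> (\<forall>c\<in>VC. kap c = Center \<longleftrightarrow> kap' c \<noteq> Center)"
proof -
  let ?Pr = "\<lambda>c. kap c = Center \<longleftrightarrow> kap' c = Center"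
  have "?Pr c \<longleftrightarrow> ?Pr c'" if "c \<in> VC" "c' \<in> VC" for c c'
  proof (rule S.conn[where Pr = ?Pr, OF _ that])
    fix e assume "e \<in> EC"
    then show "?Pr (src e) \<longleftrightarrow> ?Pr (dst e)" using S.alternate[of e] S'.alternate[of e] by argo
  qed
  then show ?thesis by blast
qed

text \<open>The pairing over the edges from type \<open>Center\<close> to type \<open>p\<close>: the
  sources give \<open>N' * chi' Center / chi Center\<close>, the targets a sum of reciprocals of
  \<open>chi'\<close>. The weights \<open>zeta c * xv c\<close> have sum \<open>N * chi p\<close>,
  so this determines the average of these reciprocals.\<close>

lemma same_type_equation:
  assumes same: "\<And>c. c \<in> VC \<Longrightarrow> kap c = Center \<longleftrightarrow> kap' c = Center" and p: "p \<in> I" "p \<in> Piv"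
  shows "(\<Sum>c | c \<in> VC \<and> kap c = p. zeta c * xv c * (1 / chi' (kap' c) - (N' * chi' Center) / (N * chi Center) / chi p)) = 0"
proof -
  let ?T = "{c. c \<in> VC \<and> kap c = Center}" and ?U = "{c. c \<in> VC \<and> kap c = p}"
  have pC: "p \<noteq> Center" using p by auto
  have T': "?T = {c. c \<in> VC \<and> kap' c = Center}" using same by blast
  have "(\<Sum>e | e \<in> EC \<and> src e \<in> ?T \<and> kap (dst e) = p. zeta' (src e) * zeta (dst e) / io e) = (\<Sum>c\<in>?T. zeta' c * xv c / chi (kap c))"
    using p S.utree_Piv by (intro S.sum_src) auto
  also have "\<dots> = (\<Sum>c\<in>?T. zeta' c * xv c / chi Center)" by (intro sum.cong) auto
  also have "\<dots> = N' * chi' Center / chi Center"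
    using S'.total[OF S'.Center_I] by (simp add: T' flip: sum_divide_distrib)
  finally have 1: "(\<Sum>e | e \<in> EC \<and> src e \<in> ?T \<and> kap (dst e) = p. zeta' (src e) * zeta (dst e) / io e) = N' * chi' Center / chi Center" .
  have "{e. e \<in> EC \<and> src e \<in> ?T \<and> kap (dst e) = p} = {e. e \<in> EC \<and> dst e \<in> ?U \<and> kap' (src e) = Center}"
    using S.alternate S.ends same pC by blast
  moreover have "(\<Sum>e | e \<in> EC \<and> dst e \<in> ?U \<and> kap' (src e) = Center. zeta' (src e) * zeta (dst e) / io e) =
      (\<Sum>c\<in>?U. zeta c * xv c / chi' (kap' c))"
  proof (rule S'.sum_dst)
    fix c assume "c \<in> ?U"
    then show "utree Center (kap' c)" using same pC S'.kap_Piv S.utree_Piv by blast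
  qed (use S'.Center_I in auto)
  ultimately have 2: "(\<Sum>c\<in>?U. zeta c * xv c / chi' (kap' c)) = N' * chi' Center / chi Center" using 1 by simp
  let ?r = "(N' * chi' Center) / (N * chi Center) / chi p"
  have "(\<Sum>c\<in>?U. zeta c * xv c * (1 / chi' (kap' c) - ?r)) = (\<Sum>c\<in>?U. zeta c * xv c / chi' (kap' c)) - (\<Sum>c\<in>?U. zeta c * xv c) * ?r"
  proof -
    have "(\<Sum>c\<in>?U. f c * (1 / g c - r)) = (\<Sum>c\<in>?U. f c / g c) - (\<Sum>c\<in>?U. f c) * r" for f g :: "'c \<Rightarrow> real" and r
      by (simp add: right_diff_distrib sum_subtractf sum_distrib_right)
    then show ?thesis .
  qed
  also have "\<dots> = N' * chi' Center / chi Center - N * chi p * ?r" using 2 S.total[OF p(1)] by simp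
  also have "\<dots> = 0" using S.N_pos S.chi_pos[OF p(1)] by simp
  finally show ?thesis .
qed

text \<open>The pairing over the edges from \<open>kap' = q\<close> to \<open>kap = p\<close>. With
  colours interchanged the denominators at both ends belong to \<open>Center\<close>, so both sums
  reduce to totals, and \<open>chi' q\<close> is the same for all \<open>q\<close>.\<close>

lemma opposite_type_equation:
  assumes opp: "\<And>c. c \<in> VC \<Longrightarrow> kap c = Center \<longleftrightarrow> kap' c \<noteq> Center"
    and p: "p \<in> I" "p \<in> Piv" and q: "q \<in> I'" "q \<in> Piv"
  shows "N' * chi' q / chi Center = N * chi p / chi' Center"
proof -
  let ?T = "{c. c \<in> VC \<and> kap' c = q}" and ?U = "{c. c \<in> VC \<and> kap c = p}"
  have pq: "p \<noteq> Center" "q \<noteq> Center" using p q by auto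
  have T: "kap c = Center" if "c \<in> ?T" for c using that opp pq by blast
  have U: "kap' c = Center" if "c \<in> ?U" for c using that opp pq by blast
  have "(\<Sum>e | e \<in> EC \<and> src e \<in> ?T \<and> kap (dst e) = p. zeta' (src e) * zeta (dst e) / io e) = (\<Sum>c\<in>?T. zeta' c * xv c / chi (kap c))"
    using p S.utree_Piv T by (intro S.sum_src) auto
  also have "\<dots> = (\<Sum>c\<in>?T. zeta' c * xv c / chi Center)" using T by (intro sum.cong) auto
  also have "\<dots> = N' * chi' q / chi Center"
    using S'.total[OF q(1)] by (simp flip: sum_divide_distrib)
  finally have 1: "(\<Sum>e | e \<in> EC \<and> src e \<in> ?T \<and> kap (dst e) = p. zeta' (src e) * zeta (dst e) / io e) = N' * chi' q / chi Center" .
  have "(\<Sum>e | e \<in> EC \<and> dst e \<in> ?U \<and> kap' (src e) = q. zeta' (src e) * zeta (dst e) / io e) = (\<Sum>c\<in>?U. zeta c * xv c / chi' (kap' c))"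
    using q S.utree_Piv U by (intro S'.sum_dst) auto
  also have "\<dots> = (\<Sum>c\<in>?U. zeta c * xv c / chi' Center)" using U by (intro sum.cong) auto
  also have "\<dots> = N * chi p / chi' Center"
    using S.total[OF p(1)] by (simp flip: sum_divide_distrib)
  finally have 2: "(\<Sum>e | e \<in> EC \<and> dst e \<in> ?U \<and> kap' (src e) = q. zeta' (src e) * zeta (dst e) / io e) = N * chi p / chi' Center" .
  have "{e. e \<in> EC \<and> src e \<in> ?T \<and> kap (dst e) = p} = {e. e \<in> EC \<and> dst e \<in> ?U \<and> kap' (src e) = q}"
    using S.ends by blast
  then show ?thesis using 1 2 by simp
qed

end

lemma sum_zero_neg_pos:
  fixes f :: "'a \<Rightarrow> real"
  assumes "finite T" "sum f T = 0" "x \<in> T" "f x < 0" shows "\<exists>y\<in>T. 0 < f y"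
proof (rule ccontr)
  assume "\<not> ?thesis"
  then have "\<And>y. y \<in> T \<Longrightarrow> 0 \<le> - f y" by (simp add: not_less)
  moreover have "sum (\<lambda>y. - f y) T = 0" using assms(2) by (simp add: sum_negf)
  ultimately have "\<forall>y\<in>T. - f y = 0" using assms(1) by (simp add: sum_nonneg_eq_0_iff)
  then show False using assms(3,4) by force
qed

text \<open>The b-values are constant on the fibres of k and average to the a-value there, and vice versa;
  look at a class where the larger of the two values is maximal among those with a, b different.\<close>
lemma mutual_averages_equal:
  fixes a b w w' :: "'c \<Rightarrow> real"
  assumes fin: "finite W" and w: "\<And>u. u \<in> W \<Longrightarrow> 0 < w u" "\<And>u. u \<in> W \<Longrightarrow> 0 < w' u"
    and a: "\<And>u u'. u \<in> W \<Longrightarrow> u' \<in> W \<Longrightarrow> k u = k u' \<Longrightarrow> a u = a u'"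
    and b: "\<And>u u'. u \<in> W \<Longrightarrow> u' \<in> W \<Longrightarrow> k' u = k' u' \<Longrightarrow> b u = b u'"
    and avg: "\<And>u. u \<in> W \<Longrightarrow> (\<Sum>x | x \<in> W \<and> k x = k u. w x * (b x - a x)) = 0"
    and avg': "\<And>u. u \<in> W \<Longrightarrow> (\<Sum>x | x \<in> W \<and> k' x = k' u. w' x * (a x - b x)) = 0"
    and u: "u \<in> W"
  shows "a u = b u"
proof (rule ccontr)
  assume "a u \<noteq> b u"
  define D where "D = {x \<in> W. a x \<noteq> b x}"
  define f where "f = (\<lambda>x. max (a x) (b x))"
  have D: "finite (f ` D)" "f ` D \<noteq> {}" using fin u \<open>a u \<noteq> b u\<close> by (auto simp: D_def)
  obtain x where xD: "x \<in> D" "Max (f ` D) = f x" using Max_in[OF D] by blast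
  have max: "max (a y) (b y) \<le> max (a x) (b x)" if "y \<in> W" "a y \<noteq> b y" for y
    using Max_ge[OF D(1), of "f y"] that xD(2) by (auto simp: D_def f_def)
  have x: "x \<in> W" "a x \<noteq> b x" using xD(1) by (simp_all add: D_def)
  show False
  proof (cases "a x < b x")
    case True
    then have "w' x * (a x - b x) < 0" using w x by (simp add: mult_pos_neg)
    then obtain y where y: "y \<in> W" "k' y = k' x" "0 < w' y * (a y - b y)"
      using sum_zero_neg_pos[OF _ avg'[OF x(1)], of x] fin x by auto
    then have "b x = b y" "b y < a y" using b[OF y(1) x(1)] w(2)[OF y(1)] by (simp_all add: zero_less_mult_iff)
    then show False using max[OF y(1)] True by auto
  next
    case False
    then have "w x * (b x - a x) < 0" using w x by (simp add: mult_pos_neg)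
    then obtain y where y: "y \<in> W" "k y = k x" "0 < w y * (b y - a y)"
      using sum_zero_neg_pos[OF _ avg[OF x(1)], of x] fin x by auto
    then have "a x = a y" "a y < b y" using a[OF y(1) x(1)] w(1)[OF y(1)] by (simp_all add: zero_less_mult_iff)
    then show False using max[OF y(1)] False x by auto
  qed
qed

context two_solutions
begin

theorem proportional_or_constant:
  assumes p0: "p0 \<in> I \<inter> Piv"
  shows "(\<exists>r>0. chi ` (I \<inter> Piv) = (\<lambda>q. r * chi' q) ` (I' \<inter> Piv)) \<or> (\<exists>k. \<forall>q\<in>I' \<inter> Piv. chi' q = k)"
  using dichotomy
proof
  assume opp: "\<forall>c\<in>VC. kap c = Center \<longleftrightarrow> kap' c \<noteq> Center"
  have "chi' q = N * chi p0 / chi' Center * chi Center / N'" if "q \<in> I' \<inter> Piv" for q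
  proof -
    have "N' * chi' q / chi Center = N * chi p0 / chi' Center"
      using opposite_type_equation[of p0 q] opp that p0 by simp
    moreover have "chi' q = N' * chi' q / chi Center * chi Center / N'"
      using S.chi_pos[OF S.Center_I] S'.N_pos by simp
    ultimately show ?thesis by simp
  qed
  then show ?thesis by blast
next
  assume same: "\<forall>c\<in>VC. kap c = Center \<longleftrightarrow> kap' c = Center"
  \<comment> \<open>Exchanging the two solutions supplies the second family of averages.\<close>
  interpret T: two_solutions VC EC src dst xv io I' kap' zeta' chi' N' I kap zeta chi N ..
  \<comment> \<open>The common factor between the two families: \<open>r / chi\<close> and
    \<open>1 / chi'\<close> are averages of each other.\<close>
  define r where "r = (N' * chi' Center) / (N * chi Center)"
  have r: "0 < r" using S.N_pos S'.N_pos S.chi_pos[OF S.Center_I] S'.chi_pos[OF S'.Center_I] by (simp add: r_def)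
  define W where "W = {c. c \<in> VC \<and> kap c \<noteq> Center}"
  have WP: "kap c \<in> I" "kap c \<in> Piv" "kap' c \<in> I'" "kap' c \<in> Piv" if "c \<in> W" for c
    using that same S.kap_Piv S'.kap_Piv S.kap_I S'.kap_I by (auto simp: W_def)
  have eq: "r / chi (kap c) = 1 / chi' (kap' c)" if "c \<in> W" for c
  proof (rule mutual_averages_equal[where W = W and w = "\<lambda>c. zeta c * xv c" and w' = "\<lambda>c. zeta' c * xv c"
        and k = kap and k' = kap' and a = "\<lambda>c. r / chi (kap c)" and b = "\<lambda>c. 1 / chi' (kap' c)"])
    show "finite W" using S.fin by (simp add: W_def)
    fix u assume u: "u \<in> W"
    show "0 < zeta u * xv u" "0 < zeta' u * xv u" using u S.zeta_pos S'.zeta_pos S.xv_pos by (auto simp: W_def)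
    have "{x. x \<in> W \<and> kap x = kap u} = {c. c \<in> VC \<and> kap c = kap u}" using u by (auto simp: W_def)
    then show "(\<Sum>x | x \<in> W \<and> kap x = kap u. zeta x * xv x * (1 / chi' (kap' x) - r / chi (kap x))) = 0"
      using same_type_equation[of "kap u"] same WP[OF u] by (simp add: r_def)
    have k: "kap' u \<noteq> Center" using WP(4)[OF u] by auto
    have "x \<in> W" if x: "x \<in> VC" "kap' x = kap' u" for x
    proof -
      have "kap' x \<noteq> Center" unfolding x(2) by (rule k)
      then show ?thesis using x(1) same by (simp add: W_def)
    qed
    then have "{x. x \<in> W \<and> kap' x = kap' u} = {c. c \<in> VC \<and> kap' c = kap' u}" unfolding W_def by blast
    then have "(\<Sum>x | x \<in> W \<and> kap' x = kap' u. zeta' x * xv x * (r / chi (kap x) - 1 / chi' (kap' x))) =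
      (\<Sum>c | c \<in> VC \<and> kap' c = kap' u. r * (zeta' c * xv c * (1 / chi (kap c) - (N * chi Center) / (N' * chi' Center) / chi' (kap' u))))"
    proof (intro sum.cong)
      fix x assume x: "x \<in> {c. c \<in> VC \<and> kap' c = kap' u}"
      have "r * ((N * chi Center) / (N' * chi' Center) / chi' (kap' u)) = 1 / chi' (kap' u)"
        using S.N_pos S'.N_pos S.chi_pos[OF S.Center_I] S'.chi_pos[OF S'.Center_I] by (simp add: r_def)
      then show "zeta' x * xv x * (r / chi (kap x) - 1 / chi' (kap' x)) =
        r * (zeta' x * xv x * (1 / chi (kap x) - N * chi Center / (N' * chi' Center) / chi' (kap' u)))"
      proof -
        assume M: "r * ((N * chi Center) / (N' * chi' Center) / chi' (kap' u)) = 1 / chi' (kap' u)"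
        have "r * (w * (1 / y - M)) = w * (r / y - r * M)" for w y M by (simp add: right_diff_distrib)
        from this[of "zeta' x * xv x" "chi (kap x)" "N * chi Center / (N' * chi' Center) / chi' (kap' u)"]
        show ?thesis unfolding M using x by auto
      qed
    qed simp
    also have "\<dots> = 0"
      using T.same_type_equation[of "kap' u"] same WP[OF u] unfolding sum_distrib_left[symmetric] by simp
    finally show "(\<Sum>x | x \<in> W \<and> kap' x = kap' u. zeta' x * xv x * (r / chi (kap x) - 1 / chi' (kap' x))) = 0" .
  qed (use that in auto)
  have eq': "chi (kap c) = r * chi' (kap' c)" if "c \<in> W" for c
    using eq[OF that] S.chi_pos[OF WP(1)[OF that]] S'.chi_pos[OF WP(3)[OF that]] by (simp add: field_simps)
  have "chi ` (I \<inter> Piv) = (\<lambda>q. r * chi' q) ` (I' \<inter> Piv)"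
  proof (intro equalityI subsetI)
    fix x assume "x \<in> chi ` (I \<inter> Piv)"
    then obtain p where p: "p \<in> I" "p \<in> Piv" "x = chi p" by blast
    obtain c where c: "c \<in> VC" "kap c = p" using S.exists_class[OF p(1)] by blast
    then have "c \<in> W" using p by (auto simp: W_def)
    then show "x \<in> (\<lambda>q. r * chi' q) ` (I' \<inter> Piv)" using eq' WP c p by blast
  next
    fix x assume "x \<in> (\<lambda>q. r * chi' q) ` (I' \<inter> Piv)"
    then obtain q where q: "q \<in> I'" "q \<in> Piv" "x = r * chi' q" by blast
    obtain c where c: "c \<in> VC" "kap' c = q" using S'.exists_class[OF q(1)] by blast
    then have "c \<in> W" using q same by (auto simp: W_def)
    then have "x = chi (kap c)" "kap c \<in> I \<inter> Piv" using eq' WP c q by auto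
    then show "x \<in> chi ` (I \<inter> Piv)" by blast
  qed
  then show ?thesis using r by blast
qed

end

lemma (in finite_index) solution:
  "solution VC EC ((`) fst) ((`) snd) class_xval class_iota I kap zeta chi (real (card Om))"
proof
  show "0 < real (card Om)" using fin subgrp_zero[OF subgrp_gen] by (auto simp: card_gt_0_iff)
  show "Center \<in> I" using good by (simp add: good_def I_def interior_def)
qed (use finite_VC finite_EC kap_I kap_edge zeta_pos class_xval_pos chi_pos ID total_eq star_eq_src star_eq_dst connected in blast)+

section \<open>Invariance under isomorphism\<close>

locale subgroup_iso =
  fixes H :: "'a::group_add set" and f :: "'a \<Rightarrow> 'b::group_add"
  assumes H: "subgrp H" and inj: "inj_on f H"
    and hom: "x \<in> H \<Longrightarrow> y \<in> H \<Longrightarrow> f (x + y) = f x + f y"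
begin

lemma f_zero: "f 0 = 0"
proof -
  have "f 0 + f 0 = f 0 + 0" using hom[of 0 0] subgrp_zero[OF H] by simp
  then show ?thesis by (simp only: add_left_cancel)
qed

lemma f_minus: "x \<in> H \<Longrightarrow> f (- x) = - f x"
  using hom[of "- x" x] subgrp_minus[OF H] f_zero by (simp add: eq_neg_iff_add_eq_0)

lemma f_diff: "x \<in> H \<Longrightarrow> y \<in> H \<Longrightarrow> f (x - y) = f x - f y"
  using hom[of x "- y"] f_minus subgrp_minus[OF H] by (simp add: diff_conv_add_uminus)

lemma f_eq_iff: "x \<in> H \<Longrightarrow> y \<in> H \<Longrightarrow> f x = f y \<longleftrightarrow> x = y"
  using inj by (auto simp: inj_on_def)

lemma f_mem_iff: "x \<in> H \<Longrightarrow> A \<subseteq> H \<Longrightarrow> f x \<in> f ` A \<longleftrightarrow> x \<in> A"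
  using inj by (meson image_eqI inj_on_image_mem_iff)

lemma f_commute_iff: "x \<in> H \<Longrightarrow> y \<in> H \<Longrightarrow> f x + f y = f y + f x \<longleftrightarrow> x + y = y + x"
  using f_eq_iff[of "x + y" "y + x"] subgrp_add[OF H] by (simp add: hom)

lemma f_cent: "z \<in> H \<Longrightarrow> cent (f ` H) (f z) = f ` cent H z"
  by (auto simp: cent_def f_commute_iff)

lemma f_special: "special (f ` H) = f ` special H"
proof -
  have "f z \<in> special (f ` H) \<longleftrightarrow> z \<in> special H" if z: "z \<in> H" for z
  proof -
    have "(\<exists>x\<in>cent H z. \<exists>y\<in>cent H z. f x + f y \<noteq> f y + f x) \<longleftrightarrow> (\<exists>x\<in>cent H z. \<exists>y\<in>cent H z. x + y \<noteq> y + x)"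
      using f_commute_iff by (auto simp: cent_def)
    moreover have "f z = 0 \<longleftrightarrow> z = 0" using f_eq_iff[OF z subgrp_zero[OF H]] f_zero by simp
    ultimately show ?thesis using z by (simp add: special_def f_cent)
  qed
  moreover have "special (f ` H) \<subseteq> f ` H" "special H \<subseteq> H" by (auto simp: special_def)
  ultimately show ?thesis by blast
qed

lemma special_H: "special H \<subseteq> H" by (auto simp: special_def)

lemma f_vertices: "vertices (f ` H) = (`) f ` vertices H"
  unfolding vertices_def f_special image_image
  using special_H by (intro image_cong) (auto simp: f_cent)

lemma vertices_H: "C \<in> vertices H \<Longrightarrow> C \<subseteq> H"
  by (auto simp: vertices_def cent_def)

lemma f_center: "C \<subseteq> H \<Longrightarrow> center (f ` C) = f ` center C"
  by (auto simp: center_def f_commute_iff subset_iff)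

lemma center_subset: "center C \<subseteq> C" by (auto simp: center_def)

lemma f_subset_iff: "A \<subseteq> H \<Longrightarrow> B \<subseteq> H \<Longrightarrow> f ` A \<subseteq> f ` B \<longleftrightarrow> A \<subseteq> B"
proof
  assume A: "A \<subseteq> H" and B: "B \<subseteq> H" and sub: "f ` A \<subseteq> f ` B"
  show "A \<subseteq> B"
  proof
    fix x assume "x \<in> A"
    then show "x \<in> B" using f_mem_iff[OF _ B, of x] A sub by blast
  qed
qed blast

lemma f_edges: "edges (f ` H) = map_prod ((`) f) ((`) f) ` edges H"
proof -
  have "(f ` C, f ` D) \<in> edges (f ` H) \<longleftrightarrow> (C, D) \<in> edges H" if "C \<in> vertices H" "D \<in> vertices H" for C D
  proof -
    have "C \<subseteq> H" "D \<subseteq> H" using that vertices_H by auto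
    then show ?thesis
      using that f_subset_iff[of "center C" D] center_subset[of C] f_subset_iff[of C D] f_subset_iff[of D C]
      by (auto simp: edges_def f_vertices f_center)
  qed
  moreover have "edges (f ` H) \<subseteq> (`) f ` vertices H \<times> (`) f ` vertices H"
    by (auto simp: edges_def f_vertices)
  moreover have "edges H \<subseteq> vertices H \<times> vertices H" by (auto simp: edges_def)
  ultimately show ?thesis by (force simp: image_iff)
qed

lemma f_conj_set: "h \<in> H \<Longrightarrow> C \<subseteq> H \<Longrightarrow> conj_set (f h) (f ` C) = f ` conj_set h C"
proof -
  assume h: "h \<in> H" and C: "C \<subseteq> H"
  have "f h + f x - f h = f (h + x - h)" if "x \<in> C" for x
    using that C h subgrp_add[OF H] by (simp add: hom f_diff subset_iff)
  then show ?thesis by (simp add: conj_set_def image_image)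
qed

lemma f_vclass: "C \<subseteq> H \<Longrightarrow> vclass (f ` H) (f ` C) = (`) f ` vclass H C"
  by (auto simp: vclass_def image_image f_conj_set)

lemma f_eclass: "C \<subseteq> H \<Longrightarrow> D \<subseteq> H \<Longrightarrow>
    eclass (f ` H) (f ` C, f ` D) = map_prod ((`) f) ((`) f) ` eclass H (C, D)"
  by (auto simp: eclass_def image_image f_conj_set)

lemma f_xval: "C \<subseteq> H \<Longrightarrow> subgrp C \<Longrightarrow> xval (f ` C) = xval C"
proof -
  assume C: "C \<subseteq> H" "subgrp C"
  have "card (hom2 (f ` C) (f ` center C)) = card (hom2 C (center C))"
    by (rule card_hom2_image[OF C(2)]) (use C inj center_subset hom in \<open>auto simp: inj_on_subset subset_iff\<close>)
  then show ?thesis by (simp add: xval_def f_center C)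
qed

lemma subgrp_image: "A \<subseteq> H \<Longrightarrow> subgrp A \<Longrightarrow> subgrp (f ` A)"
proof (rule subgrpI)
  assume A: "A \<subseteq> H" "subgrp A"
  show "0 \<in> f ` A" using f_zero subgrp_zero[OF A(2)] by (metis image_eqI)
  show "x + y \<in> f ` A" if xy: "x \<in> f ` A" "y \<in> f ` A" for x y
  proof -
    obtain a b where "a \<in> A" "b \<in> A" "x = f a" "y = f b" using xy by blast
    then have "a + b \<in> A" "x + y = f (a + b)" using A subgrp_add hom by (auto simp: subset_iff)
    then show ?thesis by blast
  qed
  show "- x \<in> f ` A" if x: "x \<in> f ` A" for x
  proof -
    obtain a where "a \<in> A" "x = f a" using x by blast
    then have "- a \<in> A" "- x = f (- a)" using A subgrp_minus f_minus by (auto simp: subset_iff)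
    then show ?thesis by blast
  qed
qed

lemma f_ncosets:
  assumes A: "A \<subseteq> H" "subgrp A" and B: "B \<subseteq> H"
  shows "ncosets (f ` A) (f ` B) = ncosets A B"
proof -
  have "card ((\<lambda>x. rcoset (f ` A) (f x)) ` B) = card ((\<lambda>x. rcoset A x) ` B)"
  proof (rule card_image_eq_of_kernel)
    fix x y assume "x \<in> B" "y \<in> B"
    then have xy: "x \<in> H" "y \<in> H" using B by auto
    have "f x - f y \<in> f ` A \<longleftrightarrow> x - y \<in> A"
      using f_mem_iff[OF subgrp_diff[OF H xy] A(1)] f_diff[OF xy] by simp
    then show "rcoset (f ` A) (f x) = rcoset (f ` A) (f y) \<longleftrightarrow> rcoset A x = rcoset A y"
      by (simp add: rcoset_eq_iff A subgrp_image)
  qed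
  then show ?thesis by (simp add: ncosets_def image_image)
qed

lemma f_set_sum: "A \<subseteq> H \<Longrightarrow> B \<subseteq> H \<Longrightarrow> set_sum (f ` A) (f ` B) = f ` set_sum A B"
proof -
  assume AB: "A \<subseteq> H" "B \<subseteq> H"
  have e: "f (a + b) = f a + f b" if "a \<in> A" "b \<in> B" for a b using that AB hom by blast
  have s: "set_sum A B = (\<lambda>(a, b). a + b) ` (A \<times> B)" for A B :: "'c::group_add set" by (auto simp: set_sum_def)
  have "(\<lambda>(a, b). a + b) ` (f ` A \<times> f ` B) = (\<lambda>(a, b). f a + f b) ` (A \<times> B)" by force
  also have "\<dots> = f ` (\<lambda>(a, b). a + b) ` (A \<times> B)"
    unfolding image_image by (intro image_cong) (auto simp: e)
  finally show ?thesis by (simp add: s)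
qed

lemma f_iota:
  assumes C: "C \<subseteq> H" and D: "D \<subseteq> H" and s: "subgrp (set_sum (center C) (center D))"
  shows "iota (f ` C, f ` D) = iota (C, D)"
proof -
  have c: "center C \<subseteq> H" "center D \<subseteq> H" using C D center_subset by blast+
  have "set_sum (center C) (center D) \<subseteq> H" using c by (intro set_sum_subset[OF H])
  moreover have "f ` C \<inter> f ` D = f ` (C \<inter> D)" using C D inj by (simp add: inj_on_image_Int)
  ultimately show ?thesis
    using C D c s by (simp add: iota_def f_center f_set_sum f_ncosets le_infI1)
qed

end

text \<open>Only \<open>kap\<close> and \<open>zeta\<close> have to be pulled back along the
  bijection of classes; \<open>xv\<close> and \<open>io\<close> agree on corresponding
  classes.\<close>

lemma solution_transfer:
  assumes sol: "solution VC' EC' src' dst' xv' io' I kap zeta chi N"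
    and F: "bij_betw F VC VC'" and G: "bij_betw G EC EC'"
    and src: "\<And>e. e \<in> EC \<Longrightarrow> src' (G e) = F (src e)" "\<And>e. e \<in> EC \<Longrightarrow> dst' (G e) = F (dst e)"
    and ends: "\<And>e. e \<in> EC \<Longrightarrow> src e \<in> VC" "\<And>e. e \<in> EC \<Longrightarrow> dst e \<in> VC"
    and xv: "\<And>c. c \<in> VC \<Longrightarrow> xv' (F c) = xv c" and io: "\<And>e. e \<in> EC \<Longrightarrow> io' (G e) = io e"
  shows "solution VC EC src dst xv io I (kap \<circ> F) (zeta \<circ> F) chi N"
proof -
  interpret S: solution VC' EC' src' dst' xv' io' I kap zeta chi N by (rule sol)
  have FC: "F c \<in> VC'" if "c \<in> VC" for c using F that by (auto simp: bij_betw_def)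
  have GE: "G e \<in> EC'" if "e \<in> EC" for e using G that by (auto simp: bij_betw_def)
  have F_eq: "F c = F c' \<longleftrightarrow> c = c'" if "c \<in> VC" "c' \<in> VC" for c c'
    using F that by (auto simp: bij_betw_def inj_on_def)
  have bij_sub: "bij_betw h {x \<in> A. P (h x)} {y \<in> B. P y}" if "bij_betw h A B" for h A B P
    using that by (auto simp: bij_betw_def inj_on_def)
  have sumE: "(\<Sum>e | e \<in> EC \<and> P (G e). t (G e)) = (\<Sum>e | e \<in> EC' \<and> P e. t e)" for P t
    using sum.reindex_bij_betw[OF bij_sub[OF G, of P], of t] by simp
  show ?thesis
  proof
    show "finite VC" "finite EC" using S.fin F G by (auto simp: bij_betw_finite)
    show "0 < N" by (rule S.N_pos)
    show "Center \<in> I" by (rule S.Center_I)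
    fix v assume v: "v \<in> I"
    show "0 < chi v" "interior v" using v S.chi_pos S.I_interior by auto
    have "(\<Sum>c | c \<in> VC \<and> (kap \<circ> F) c = v. (zeta \<circ> F) c * xv c) = (\<Sum>c\<in>{c \<in> VC. kap (F c) = v}. zeta (F c) * xv' (F c))"
      by (rule sum.cong) (auto simp: xv)
    also have "\<dots> = (\<Sum>c | c \<in> VC' \<and> kap c = v. zeta c * xv' c)"
      using sum.reindex_bij_betw[OF bij_sub[OF F, of "\<lambda>c. kap c = v"], of "\<lambda>c. zeta c * xv' c"] by simp
    finally show "(\<Sum>c | c \<in> VC \<and> (kap \<circ> F) c = v. (zeta \<circ> F) c * xv c) = N * chi v"
      using S.total[OF v] by simp
  next
    fix c assume c: "c \<in> VC"
    show "(kap \<circ> F) c \<in> I" "0 < (zeta \<circ> F) c" "0 < xv c"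
      using S.kap_I[OF FC[OF c]] S.zeta_pos[OF FC[OF c]] S.xv_pos[OF FC[OF c]] by (simp_all add: xv[OF c])
    fix u assume u: "u \<in> I"
    show "(\<Sum>e | e \<in> EC \<and> src e = c \<and> (kap \<circ> F) (dst e) = u. (zeta \<circ> F) (dst e) / io e) = xv c / chi ((kap \<circ> F) c)"
      if "utree ((kap \<circ> F) c) u"
    proof -
      have "(\<Sum>e | e \<in> EC \<and> src e = c \<and> (kap \<circ> F) (dst e) = u. (zeta \<circ> F) (dst e) / io e) =
        (\<Sum>e | e \<in> EC \<and> (src' (G e) = F c \<and> kap (dst' (G e)) = u). zeta (dst' (G e)) / io' (G e))"
        by (rule sum.cong) (auto simp: src io F_eq[OF ends(1) c])
      then show ?thesis using sumE[of "\<lambda>e. zeta (dst' e) / io' e" "\<lambda>e. src' e = F c \<and> kap (dst' e) = u"]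
        S.star_src[OF FC[OF c] u] that xv[OF c] by simp
    qed
    show "(\<Sum>e | e \<in> EC \<and> dst e = c \<and> (kap \<circ> F) (src e) = u. (zeta \<circ> F) (src e) / io e) = xv c / chi ((kap \<circ> F) c)"
      if "utree u ((kap \<circ> F) c)"
    proof -
      have "(\<Sum>e | e \<in> EC \<and> dst e = c \<and> (kap \<circ> F) (src e) = u. (zeta \<circ> F) (src e) / io e) =
        (\<Sum>e | e \<in> EC \<and> (dst' (G e) = F c \<and> kap (src' (G e)) = u). zeta (src' (G e)) / io' (G e))"
        by (rule sum.cong) (auto simp: src io F_eq[OF ends(2) c])
      then show ?thesis using sumE[of "\<lambda>e. zeta (src' e) / io' e" "\<lambda>e. dst' e = F c \<and> kap (src' e) = u"]
        S.star_dst[OF FC[OF c] u] that xv[OF c] by simp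
    qed
  next
    fix e assume e: "e \<in> EC"
    show "src e \<in> VC" "dst e \<in> VC" using ends e by auto
    show "utree ((kap \<circ> F) (src e)) ((kap \<circ> F) (dst e))" using S.kap_edge[OF GE[OF e]] src e by simp
  next
    fix Pr c c' assume Pr: "\<And>e. e \<in> EC \<Longrightarrow> Pr (src e) \<longleftrightarrow> Pr (dst e)" and c: "c \<in> VC" "c' \<in> VC"
    define Pr' where "Pr' = (\<lambda>d. Pr (inv_into VC F d))"
    have Pr': "Pr' (F c) \<longleftrightarrow> Pr c" if "c \<in> VC" for c
      using F that by (simp add: Pr'_def bij_betw_def)
    have "Pr' (src' e) \<longleftrightarrow> Pr' (dst' e)" if e': "e \<in> EC'" for e
    proof -
      obtain e0 where e0: "e0 \<in> EC" "e = G e0" using G e' by (auto simp: bij_betw_def)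
      then show ?thesis using Pr[OF e0(1)] Pr' ends src by simp
    qed
    from S.conn[of Pr', OF this FC[OF c(1)] FC[OF c(2)]] show "Pr c \<longleftrightarrow> Pr c'" using Pr' c by simp
  qed
qed

context finite_index
begin

lemma self_vclass: "C \<in> vclass H C"
proof -
  have "conj_set 0 C \<in> vclass H C" unfolding vclass_def using subgrp_zero[OF H] by (rule imageI)
  then show ?thesis by simp
qed

lemma self_eclass: "(C, D) \<in> eclass H (C, D)"
proof -
  have "(conj_set 0 (fst (C, D)), conj_set 0 (snd (C, D))) \<in> eclass H (C, D)"
    unfolding eclass_def using subgrp_zero[OF H] by (rule imageI)
  then show ?thesis by simp
qed

lemma Cw_subset: "Cw v g \<subseteq> H" by (simp add: Cw_def)

lemma VC_members:
  assumes "c \<in> VC" obtains C where "C \<in> c" "C \<in> vertices H" "subgrp C" "C \<subseteq> H" "class_xval c = xval C"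
    "c = vclass H C"
proof -
  obtain v g where c: "v \<in> I" "g \<in> gen V" "c = vclass H (Cw v g)" using VC_cases[OF assms] .
  show ?thesis
  proof (rule that)
    show "Cw v g \<in> c" unfolding c(3) by (rule self_vclass)
    show "Cw v g \<in> vertices H" unfolding vertices_eq using c(1,2) by blast
    show "class_xval c = xval (Cw v g)" unfolding c(3) by (rule class_xval_Cw)
  qed (rule subgrp_Cw Cw_subset c(3))+
qed

lemma class_xval_member: "c \<in> VC \<Longrightarrow> C \<in> c \<Longrightarrow> class_xval c = xval C"
proof -
  assume c: "c \<in> VC" and "C \<in> c"
  obtain C' where m: "subgrp C'" "class_xval c = xval C'" "c = vclass H C'" using c by (rule VC_members)
  obtain h where "C = conj_set h C'" using \<open>C \<in> c\<close> unfolding m(3) vclass_def by blast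
  then show ?thesis using xval_conj_set[OF m(1)] m(2) by simp
qed

lemma EC_members:
  assumes "e \<in> EC" obtains C D where "(C, D) \<in> e" "C \<subseteq> H" "D \<subseteq> H" "subgrp (set_sum (center C) (center D))"
    "class_iota e = iota (C, D)" "e = eclass H (C, D)"
proof -
  obtain v u g where e: "v \<in> I" "u \<in> I" "utree v u" "g \<in> gen V" "e = eclass H (Cw v g, Cw u g)"
    using EC_cases[OF assms] .
  show ?thesis
  proof (rule that)
    show "(Cw v g, Cw u g) \<in> e" unfolding e(5) by (rule self_eclass)
    show "class_iota e = iota (Cw v g, Cw u g)" unfolding e(5) by (rule class_iota_Cw[OF e(1-4)])
    have "a + b = b + a" if "a \<in> center (Cw v g)" "b \<in> center (Cw u g)" for a b
    proof -
      have "(Cw v g, Cw u g) \<in> edges H" unfolding edges_eq using e(1-4) by blast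
      then have "a \<in> Cw u g" using that by (auto simp: edges_def)
      then show ?thesis using that by (simp add: center_def)
    qed
    then show "subgrp (set_sum (center (Cw v g)) (center (Cw u g)))"
      by (intro subgrp_set_sum subgrp_center subgrp_Cw)
  qed (rule Cw_subset e(5))+
qed

lemma class_iota_member: "e \<in> EC \<Longrightarrow> (C, D) \<in> e \<Longrightarrow> class_iota e = iota (C, D)"
proof -
  assume e: "e \<in> EC" and CD: "(C, D) \<in> e"
  obtain C' D' where m: "subgrp (set_sum (center C') (center D'))" "class_iota e = iota (C', D')" "e = eclass H (C', D')"
    using e by (rule EC_members)
  obtain h where "C = conj_set h C'" "D = conj_set h D'" using CD unfolding m(3) eclass_def by auto
  then show ?thesis using iota_conj_set[OF m(1)] m(2) by simp
qed

lemma VC_Pow: "c \<in> VC \<Longrightarrow> c \<subseteq> Pow H"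
  by (erule VC_cases) (use Cw_subset in \<open>auto simp: vclass_def conj_Cw\<close>)

lemma EC_Pow: "e \<in> EC \<Longrightarrow> e \<subseteq> Pow H \<times> Pow H"
  by (erule EC_cases) (use Cw_subset in \<open>auto simp: eclass_def conj_Cw\<close>)

end

theorem commensurable_subgroups:
  assumes fi: "finite_index V H" and fi': "finite_index V' H'"
    and iso: "subgroup_iso H f" and im: "f ` H = H'" and p0: "V \<inter> Piv \<noteq> {}"
  shows "(\<exists>r>0. finite_index.chi V ` (V \<inter> Piv) = (\<lambda>q. r * finite_index.chi V' q) ` (V' \<inter> Piv)) \<or>
    (\<exists>k. \<forall>q\<in>V' \<inter> Piv. finite_index.chi V' q = k)"
proof -
  interpret A: finite_index V H by (rule fi)
  interpret B: finite_index V' H' by (rule fi')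
  interpret f: subgroup_iso H f by (rule iso)
  \<comment> \<open>Classes are sets of subgroups, so the isomorphism acts on them by a two-fold
    image.\<close>
  let ?F = "(`) ((`) f)" and ?G = "(`) (map_prod ((`) f) ((`) f))"
  have im_v: "vertices H' = (`) f ` vertices H" "edges H' = map_prod ((`) f) ((`) f) ` edges H"
    using f.f_vertices f.f_edges im by auto
  have inj1: "inj_on ((`) f) (Pow H)" by (rule inj_on_image_Pow[OF f.inj])
  have "inj_on ?F (Pow (Pow H))" by (rule inj_on_image_Pow[OF inj1])
  then have injF: "inj_on ?F A.VC" by (rule inj_on_subset) (use A.VC_Pow in blast)
  have "inj_on ?G (Pow (Pow H \<times> Pow H))" by (rule inj_on_image_Pow[OF map_prod_inj_on[OF inj1 inj1]])
  then have injG: "inj_on ?G A.EC" by (rule inj_on_subset) (use A.EC_Pow in blast)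
  have F: "?F ` A.VC = B.VC"
  proof -
    have "vclass H' (f ` C) = ?F (vclass H C)" if "C \<in> vertices H" for C
      using f.f_vclass[OF f.vertices_H[OF that]] im by simp
    then show ?thesis by (simp add: A.VC_def B.VC_def im_v image_image)
  qed
  have G: "?G ` A.EC = B.EC"
  proof -
    have "eclass H' (map_prod ((`) f) ((`) f) p) = ?G (eclass H p)" if "p \<in> edges H" for p
    proof -
      obtain C D where p: "p = (C, D)" by (cases p)
      have "C \<subseteq> H" "D \<subseteq> H" using that f.vertices_H by (auto simp: p edges_def)
      then show ?thesis using f.f_eclass[of C D] im by (simp add: p)
    qed
    then show ?thesis by (simp add: A.EC_def B.EC_def im_v image_image)
  qed
  have sol: "solution A.VC A.EC ((`) fst) ((`) snd) class_xval class_iota B.I (B.kap \<circ> ?F) (B.zeta \<circ> ?F) B.chi (real (card B.Om))"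
  proof (rule solution_transfer[OF B.solution])
    show "bij_betw ?F A.VC B.VC" "bij_betw ?G A.EC B.EC" using F G injF injG by (simp_all add: bij_betw_def)
    show "fst ` ?G e = ?F (fst ` e)" "snd ` ?G e = ?F (snd ` e)" for e
      by (simp_all add: image_image)
    fix e assume e: "e \<in> A.EC"
    show "fst ` e \<in> A.VC" "snd ` e \<in> A.VC" using e by (rule A.kap_edge)+
    obtain C D where m: "(C, D) \<in> e" "C \<subseteq> H" "D \<subseteq> H" "subgrp (set_sum (center C) (center D))" "class_iota e = iota (C, D)"
      using e by (rule A.EC_members)
    have "(f ` C, f ` D) \<in> ?G e" using m(1) by force
    moreover have "?G e \<in> B.EC" using G e by blast
    ultimately show "class_iota (?G e) = class_iota e"
      using B.class_iota_member f.f_iota m by metis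
  next
    fix c assume c: "c \<in> A.VC"
    obtain C where m: "C \<in> c" "subgrp C" "C \<subseteq> H" "class_xval c = xval C" using c by (rule A.VC_members)
    have "?F c \<in> B.VC" "f ` C \<in> ?F c" using F c m by blast+
    then show "class_xval (?F c) = class_xval c" using B.class_xval_member f.f_xval m by metis
  qed
  interpret T: two_solutions A.VC A.EC "(`) fst" "(`) snd" class_xval class_iota A.I A.kap A.zeta A.chi "real (card A.Om)"
    B.I "B.kap \<circ> ?F" "B.zeta \<circ> ?F" B.chi "real (card B.Om)"
    by (intro two_solutions.intro A.solution sol)
  have "A.I \<inter> Piv = V \<inter> Piv" "B.I \<inter> Piv = V' \<inter> Piv" by (auto simp: A.I_def B.I_def interior_def)
  then show ?thesis using T.proportional_or_constant p0 by auto
qed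

section \<open>Embedding the groups of finite trees\<close>

lemma raag_class_eq_iff: "raag_class E u = raag_class E w \<longleftrightarrow> raag_eq E u w"
  unfolding raag_class_def by (auto intro: raag_eq.refl raag_eq.sym raag_eq.trans)

lemma raag_class_mult:
  "(\<Union>x\<in>raag_class E u. \<Union>y\<in>raag_class E w. raag_class E (x @ y)) = raag_class E (u @ w)"
proof -
  have "raag_class E (x @ y) = raag_class E (u @ w)" if "x \<in> raag_class E u" "y \<in> raag_class E w" for x y
  proof -
    have "raag_eq E (u @ w) (x @ y)" using that raag_eq_append by (simp add: raag_class_def)
    then show ?thesis unfolding raag_class_eq_iff by (rule raag_eq.sym)
  qed
  moreover have "u \<in> raag_class E u" "w \<in> raag_class E w" by (auto simp: raag_class_def raag_eq.refl)
  ultimately show ?thesis by blast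
qed

locale induced_subgraph =
  fixes V :: "tvert set" and E :: "tvert \<Rightarrow> tvert \<Rightarrow> bool"
  assumes E_utree: "E u v \<Longrightarrow> utree u v" and utree_E: "u \<in> V \<Longrightarrow> v \<in> V \<Longrightarrow> utree u v \<Longrightarrow> E u v"
begin

abbreviation G :: "tvert word set monoid" where "G \<equiv> RAAG V E"

definition em :: "tvert word set \<Rightarrow> ugroup" where "em A = el (SOME w. w \<in> A)"

lemma em_class: "em (raag_class E w) = el w"
proof -
  have "w \<in> raag_class E w" by (simp add: raag_class_def raag_eq.refl)
  then have "(SOME w'. w' \<in> raag_class E w) \<in> raag_class E w" by (rule someI)
  then have "raag_eq E w (SOME w'. w' \<in> raag_class E w)" by (simp add: raag_class_def)
  from raag_eq_filter[of E w _ UNIV utree, OF this E_utree]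
  show ?thesis by (simp add: em_def el_eq_iff raag_eq.sym)
qed

lemma carrier_cases:
  assumes "A \<in> carrier G" obtains w where "set w \<subseteq> V \<times> UNIV" "A = raag_class E w"
  using assms by (auto simp: RAAG_def)

lemma class_carrier: "set w \<subseteq> V \<times> UNIV \<Longrightarrow> raag_class E w \<in> carrier G"
  by (auto simp: RAAG_def)

lemma class_mult: "raag_class E u \<otimes>\<^bsub>G\<^esub> raag_class E w = raag_class E (u @ w)"
  by (simp add: RAAG_def raag_class_mult)

lemma one_class: "\<one>\<^bsub>G\<^esub> = raag_class E []"
  by (simp add: RAAG_def)

lemma mult_carrier: "A \<in> carrier G \<Longrightarrow> B \<in> carrier G \<Longrightarrow> A \<otimes>\<^bsub>G\<^esub> B \<in> carrier G"
  by (elim carrier_cases) (auto simp: class_mult intro!: class_carrier)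

lemma em_mult: "A \<in> carrier G \<Longrightarrow> B \<in> carrier G \<Longrightarrow> em (A \<otimes>\<^bsub>G\<^esub> B) = em A + em B"
  by (elim carrier_cases) (simp add: class_mult em_class el_append)

lemma em_one: "em \<one>\<^bsub>G\<^esub> = 0"
  by (simp add: one_class em_class)

text \<open>An equality in the universal group may be derived through vertices outside
  \<open>V\<close>. Deleting their letters gives a derivation inside \<open>V\<close>, where the two
  edge relations agree.\<close>

lemma inj_em: "inj_on em (carrier G)"
proof (rule inj_onI)
  fix A B assume "A \<in> carrier G" "B \<in> carrier G" "em A = em B"
  then obtain u w where uw: "set u \<subseteq> V \<times> UNIV" "set w \<subseteq> V \<times> UNIV" "A = raag_class E u" "B = raag_class E w"
    "el u = el w" by (metis carrier_cases em_class)
  then have "raag_eq utree u w" by (simp add: el_eq_iff)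
  then have "raag_eq E (filter (\<lambda>p. fst p \<in> V) u) (filter (\<lambda>p. fst p \<in> V) w)"
    using utree_E by (rule raag_eq_filter)
  moreover have "filter (\<lambda>p. fst p \<in> V) u = u" "filter (\<lambda>p. fst p \<in> V) w = w"
    using uw by (auto simp: filter_id_conv)
  ultimately show "A = B" using uw by (simp add: raag_class_eq_iff)
qed

lemma em_carrier: "em ` carrier G = gen V"
proof -
  have "{w. set w \<subseteq> V \<times> UNIV} = {w::tvert word. fst ` set w \<subseteq> V}" by fastforce
  then show ?thesis by (simp add: RAAG_def gen_def image_image em_class)
qed

lemma group_G: "group G"
proof (rule groupI)
  show "\<one>\<^bsub>G\<^esub> \<in> carrier G" by (simp add: one_class class_carrier)
  fix A assume A: "A \<in> carrier G"
  then show "\<one>\<^bsub>G\<^esub> \<otimes>\<^bsub>G\<^esub> A = A" by (elim carrier_cases) (simp add: one_class class_mult)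
  obtain w where w: "set w \<subseteq> V \<times> UNIV" "A = raag_class E w" using A by (rule carrier_cases)
  have "set (word_inv w) \<subseteq> V \<times> UNIV" using w by (auto simp: word_inv_def)
  moreover have "raag_class E (word_inv w) \<otimes>\<^bsub>G\<^esub> A = \<one>\<^bsub>G\<^esub>"
    using w by (simp add: class_mult one_class raag_class_eq_iff raag_eq_word_inv_left)
  ultimately show "\<exists>B\<in>carrier G. B \<otimes>\<^bsub>G\<^esub> A = \<one>\<^bsub>G\<^esub>" using class_carrier by blast
next
  fix A B C assume "A \<in> carrier G" "B \<in> carrier G" "C \<in> carrier G"
  then show "A \<otimes>\<^bsub>G\<^esub> B \<otimes>\<^bsub>G\<^esub> C = A \<otimes>\<^bsub>G\<^esub> (B \<otimes>\<^bsub>G\<^esub> C)"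
    by (elim carrier_cases) (simp add: class_mult)
qed (rule mult_carrier)

lemma finite_index_image:
  assumes good: "good V" and H: "subgroup H G" and fin: "finite (rcosets\<^bsub>G\<^esub> H)"
  shows "finite_index V (em ` H)"
proof
  interpret subgroup H G by (rule H)
  interpret group G by (rule group_G)
  show "good V" by (rule good)
  have HG: "H \<subseteq> carrier G" by (rule subset)
  show "subgrp (em ` H)"
  proof (rule subgrpI)
    show "0 \<in> em ` H" using subgroup.one_closed[OF H] em_one by (metis image_eqI)
    show "x + y \<in> em ` H" if xy: "x \<in> em ` H" "y \<in> em ` H" for x y
    proof -
      obtain A B where "A \<in> H" "B \<in> H" "x = em A" "y = em B" using xy by blast
      then have "A \<otimes>\<^bsub>G\<^esub> B \<in> H" "x + y = em (A \<otimes>\<^bsub>G\<^esub> B)"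
        using HG subgroup.m_closed[OF H] by (auto simp: em_mult subset_iff)
      then show ?thesis by blast
    qed
    show "- x \<in> em ` H" if x: "x \<in> em ` H" for x
    proof -
      obtain A where A: "A \<in> H" "x = em A" using x by blast
      then have i: "inv\<^bsub>G\<^esub> A \<in> H" "A \<in> carrier G" "inv\<^bsub>G\<^esub> A \<in> carrier G"
        using HG subgroup.m_inv_closed[OF H] by auto
      have "em (inv\<^bsub>G\<^esub> A) + x = em (inv\<^bsub>G\<^esub> A \<otimes>\<^bsub>G\<^esub> A)" unfolding A(2) by (rule em_mult[OF i(3,2), symmetric])
      also have "\<dots> = 0" using i by (simp add: em_one)
      finally have "- x = em (inv\<^bsub>G\<^esub> A)" by (simp add: eq_neg_iff_add_eq_0[symmetric])
      then show ?thesis using i by blast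
    qed
  qed
  show "em ` H \<subseteq> gen V" using HG em_carrier by blast
  have "rcoset (em ` H) ` gen V = (\<lambda>Q. em ` Q) ` (rcosets\<^bsub>G\<^esub> H)"
  proof -
    have "rcoset (em ` H) (em A) = em ` (H #>\<^bsub>G\<^esub> A)" if "A \<in> carrier G" for A
      using that HG by (auto simp: rcoset_def r_coset_def image_image image_UN em_mult subset_iff)
    then show ?thesis by (simp add: RCOSETS_def image_UN flip: em_carrier) (auto simp: image_image)
  qed
  then show "finite (rcoset (em ` H) ` gen V)" using fin by simp
qed

end

lemma commensurable_imp:
  assumes G: "induced_subgraph V E" "good V" and G': "induced_subgraph V' E'" "good V'"
    and comm: "commensurable (RAAG V E) (RAAG V' E')" and p0: "V \<inter> Piv \<noteq> {}"
  shows "(\<exists>r>0. finite_index.chi V ` (V \<inter> Piv) = (\<lambda>q. r * finite_index.chi V' q) ` (V' \<inter> Piv)) \<or>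
    (\<exists>k. \<forall>q\<in>V' \<inter> Piv. finite_index.chi V' q = k)"
proof -
  interpret A: induced_subgraph V E by (rule G)
  interpret B: induced_subgraph V' E' by (rule G')
  obtain H H' where H: "subgroup H A.G" "finite (rcosets\<^bsub>A.G\<^esub> H)"
    and H': "subgroup H' B.G" "finite (rcosets\<^bsub>B.G\<^esub> H')"
    and iso: "A.G\<lparr>carrier := H\<rparr> \<cong> B.G\<lparr>carrier := H'\<rparr>"
    using comm unfolding commensurable_def by blast
  obtain h where h: "bij_betw h H H'" "\<And>x y. x \<in> H \<Longrightarrow> y \<in> H \<Longrightarrow> h (x \<otimes>\<^bsub>A.G\<^esub> y) = h x \<otimes>\<^bsub>B.G\<^esub> h y"
    using iso by (auto simp: is_iso_def iso_def hom_def)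
  have HG: "H \<subseteq> carrier A.G" "H' \<subseteq> carrier B.G" using H H' subgroup.subset by blast+
  have inj: "inj_on A.em H" "inj_on B.em H'" using A.inj_em B.inj_em HG by (auto intro: inj_on_subset)
  define f where "f = (\<lambda>x. B.em (h (inv_into H A.em x)))"
  have f: "f (A.em x) = B.em (h x)" if "x \<in> H" for x using inj(1) that by (simp add: f_def)
  have hH: "h x \<in> H'" if "x \<in> H" for x using h(1) that by (auto simp: bij_betw_def)
  have "subgroup_iso (A.em ` H) f"
  proof
    show "subgrp (A.em ` H)" using A.finite_index_image[OF G(2) H] by (rule finite_index.H)
    show "inj_on f (A.em ` H)"
    proof (rule inj_onI)
      fix x y assume "x \<in> A.em ` H" "y \<in> A.em ` H" and eq: "f x = f y"
      then obtain a b where ab: "a \<in> H" "b \<in> H" "x = A.em a" "y = A.em b" by blast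
      then have "h a = h b" using eq f hH inj(2) by (simp add: inj_on_eq_iff)
      then have "a = b" using ab(1,2) h(1) by (auto simp: bij_betw_def dest: inj_onD)
      then show "x = y" using ab by simp
    qed
    fix x y assume "x \<in> A.em ` H" "y \<in> A.em ` H"
    then obtain a b where ab: "a \<in> H" "b \<in> H" "x = A.em a" "y = A.em b" by blast
    have "a \<otimes>\<^bsub>A.G\<^esub> b \<in> H" using H(1) ab by (simp add: subgroup.m_closed)
    then have "f (A.em (a \<otimes>\<^bsub>A.G\<^esub> b)) = B.em (h a \<otimes>\<^bsub>B.G\<^esub> h b)" using f h(2) ab by simp
    moreover have "A.em (a \<otimes>\<^bsub>A.G\<^esub> b) = x + y" using ab HG A.em_mult by blast
    moreover have "B.em (h a \<otimes>\<^bsub>B.G\<^esub> h b) = B.em (h a) + B.em (h b)" using hH ab HG B.em_mult by blast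
    ultimately show "f (x + y) = f x + f y" using f ab by simp
  qed
  moreover have "f ` A.em ` H = B.em ` H'"
  proof -
    have "f ` A.em ` H = B.em ` h ` H" using f by (simp add: image_image)
    then show ?thesis using h(1) by (simp add: bij_betw_def)
  qed
  ultimately show ?thesis
    using commensurable_subgroups[OF A.finite_index_image[OF G(2) H] B.finite_index_image[OF G'(2) H']] p0 by blast
qed

section \<open>The trees of the theorem and their leaf numbers\<close>

locale tree_without_hair =
  fixes ps :: "(nat \<times> nat) list"
  assumes leaves: "\<And>i. i < length ps \<Longrightarrow> 0 < fst (ps ! i)"
    and pivots: "\<exists>P. P \<subseteq> {(i, a). i < length ps \<and> a < snd (ps ! i)} \<and> card P = 2"
begin

abbreviation V :: "tvert set" where "V \<equiv> tree_V ps 0"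

lemma induced: "induced_subgraph V (tree_E ps 0)"
  by unfold_locales (auto simp: tree_E_def tree_E0_def utree_def tree_V_def)

lemma V_Piv: "V \<inter> Piv = {Pivot i a | i a. i < length ps \<and> a < snd (ps ! i)}"
  by (auto simp: tree_V_def Piv_def)

lemma finite_pairs: "finite {(i, a). i < length ps \<and> a < snd (ps ! i)}"
proof -
  have "{(i, a). i < length ps \<and> a < snd (ps ! i)} = (SIGMA i:{..<length ps}. {..<snd (ps ! i)})" by auto
  then show ?thesis by simp
qed

lemma V_Piv_image: "V \<inter> Piv = (\<lambda>(i, a). Pivot i a) ` {(i, a). i < length ps \<and> a < snd (ps ! i)}"
  by (auto simp: V_Piv)

lemma V_lk_Pivot: "i < length ps \<Longrightarrow> a < snd (ps ! i) \<Longrightarrow>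
    V \<inter> lk (Pivot i a) = insert Center (Leaf i a ` {..<fst (ps ! i)})"
  by (auto simp: lk_simps tree_V_def)

lemma card_lk_Pivot: "i < length ps \<Longrightarrow> a < snd (ps ! i) \<Longrightarrow> card (V \<inter> lk (Pivot i a)) = Suc (fst (ps ! i))"
proof -
  assume ia: "i < length ps" "a < snd (ps ! i)"
  have "card (Leaf i a ` {..<fst (ps ! i)}) = fst (ps ! i)" by (simp add: card_image inj_on_def)
  moreover have "Center \<notin> Leaf i a ` {..<fst (ps ! i)}" by auto
  ultimately show ?thesis using V_lk_Pivot[OF ia] by simp
qed

lemma finite_V: "finite V"
proof -
  have "V \<subseteq> insert Center ((V \<inter> Piv) \<union> (\<Union>p\<in>V \<inter> Piv. V \<inter> lk p))"
  proof
    fix v assume v: "v \<in> V"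
    show "v \<in> insert Center ((V \<inter> Piv) \<union> (\<Union>p\<in>V \<inter> Piv. V \<inter> lk p))"
    proof (cases v)
      case (Leaf i a b)
      then have "Pivot i a \<in> V \<inter> Piv" "v \<in> lk (Pivot i a)" using v by (auto simp: tree_V_def Piv_def lk_simps)
      then show ?thesis using v by blast
    qed (use v in \<open>auto simp: tree_V_def Piv_def\<close>)
  qed
  moreover have "finite (V \<inter> Piv)" using finite_pairs by (simp add: V_Piv_image)
  moreover have "finite (V \<inter> lk p)" if "p \<in> V \<inter> Piv" for p using that V_lk_Pivot by (auto simp: V_Piv)
  ultimately show ?thesis by (meson finite.insertI finite_UN_I finite_UnI finite_subset)
qed

lemma good_V: "good V"
  unfolding good_def
proof (intro conjI ballI impI)
  show "finite V" by (rule finite_V)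
  show C: "Center \<in> V" by (simp add: tree_V_def)
  show "\<exists>p\<in>V. interior p \<and> v \<in> star p" if v: "v \<in> V" for v
  proof (cases v)
    case (Leaf i a b)
    then have "Pivot i a \<in> V" "v \<in> star (Pivot i a)" using v by (auto simp: tree_V_def star_def lk_simps)
    then show ?thesis by (auto simp: interior_def Piv_def)
  next
    case (Pivot i a)
    then have "v \<in> star Center" by (auto simp: star_def lk_simps)
    then show ?thesis using C by (auto simp: interior_def)
  qed (use v C in \<open>auto simp: tree_V_def interior_def star_def\<close>)
  fix v assume v: "v \<in> V" "interior v"
  show "2 \<le> card (V \<inter> lk v)"
  proof (cases "v = Center")
    case True
    obtain P where P: "P \<subseteq> {(i, a). i < length ps \<and> a < snd (ps ! i)}" "card P = 2" using pivots by blast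
    have "inj_on (\<lambda>(i, a). Pivot i a) P" by (auto simp: inj_on_def)
    then have "card ((\<lambda>(i, a). Pivot i a) ` P) = 2" using P by (simp add: card_image)
    moreover have "(\<lambda>(i, a). Pivot i a) ` P \<subseteq> V \<inter> lk v" using P V_Piv_image True lk_Center by auto
    ultimately show ?thesis using finite_V by (metis card_mono finite_Int)
  next
    case False
    then have "v \<in> V \<inter> Piv" using v by (simp add: interior_def)
    then obtain i a where "v = Pivot i a" "i < length ps" "a < snd (ps ! i)"
      unfolding V_Piv by blast
    then show ?thesis using card_lk_Pivot leaves by (simp add: Suc_le_eq)
  qed
qed

lemma chi_V: "finite_index.chi V ` (V \<inter> Piv) = {real (fst (ps ! i)) | i. i < length ps \<and> 0 < snd (ps ! i)}"
proof -
  \<comment> \<open>The value of \<open>chi\<close> depends only on \<open>V\<close>, but its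
    definition is unfolded through a finite index subgroup; the whole group serves.\<close>
  have V_fin: "finite_index V (gen V)"
  proof
    have "rcoset (gen V) ` gen V = {gen V}"
      using subgrp_zero[OF subgrp_gen] rcoset_absorb[OF subgrp_gen, of _ V 0] by (force simp: rcoset_def)
    then show "finite (rcoset (gen V) ` gen V)" by simp
  qed (use good_V subgrp_gen in auto)
  have chi: "finite_index.chi V (Pivot i a) = real (fst (ps ! i))" if "i < length ps" "a < snd (ps ! i)" for i a
    using card_lk_Pivot[OF that] by (simp add: finite_index.chi_def[OF V_fin])
  show ?thesis
  proof (intro equalityI subsetI)
    fix x assume "x \<in> {real (fst (ps ! i)) | i. i < length ps \<and> 0 < snd (ps ! i)}"
    then obtain i where "i < length ps" "0 < snd (ps ! i)" "x = finite_index.chi V (Pivot i 0)" using chi by auto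
    then show "x \<in> finite_index.chi V ` (V \<inter> Piv)" unfolding V_Piv by blast
  next
    fix x assume "x \<in> finite_index.chi V ` (V \<inter> Piv)"
    then show "x \<in> {real (fst (ps ! i)) | i. i < length ps \<and> 0 < snd (ps ! i)}"
      using chi unfolding V_Piv by force
  qed
qed

lemma V_Piv_nonempty: "V \<inter> Piv \<noteq> {}"
proof -
  obtain P where P: "P \<subseteq> {(i, a). i < length ps \<and> a < snd (ps ! i)}" "card P = 2" using pivots by blast
  then have "P \<noteq> {}" by auto
  then show ?thesis using P unfolding V_Piv_image by blast
qed

end

theorem commensurable_trees:
  assumes ps: "tree_without_hair ps" and qs: "tree_without_hair qs"
    and comm: "commensurable (tree_RAAG ps 0) (tree_RAAG qs 0)"
    and one: "\<And>j. j < length qs \<Longrightarrow> 0 < snd (qs ! j)" "\<And>i. i < length ps \<Longrightarrow> 0 < snd (ps ! i)"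
  shows "(\<exists>r>0. real ` fst ` set ps = (\<lambda>n. r * real n) ` fst ` set qs) \<or> (\<exists>k. \<forall>n\<in>fst ` set qs. n = k)"
proof -
  interpret A: tree_without_hair ps by (rule ps)
  interpret B: tree_without_hair qs by (rule qs)
  have set_eq: "{real (fst (xs ! i)) | i. i < length xs \<and> 0 < snd (xs ! i)} = real ` fst ` set xs"
    if "\<And>i. i < length xs \<Longrightarrow> 0 < snd (xs ! i)" for xs :: "(nat \<times> nat) list"
    using that by (auto simp: set_conv_nth image_image)
  have chi: "finite_index.chi A.V ` (A.V \<inter> Piv) = real ` fst ` set ps" "finite_index.chi B.V ` (B.V \<inter> Piv) = real ` fst ` set qs"
    using A.chi_V B.chi_V set_eq one by auto
  have "(\<lambda>q. r * finite_index.chi B.V q) ` (B.V \<inter> Piv) = (\<lambda>n. r * real n) ` fst ` set qs" for r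
  proof -
    have "(\<lambda>q. r * finite_index.chi B.V q) ` (B.V \<inter> Piv) = (*) r ` finite_index.chi B.V ` (B.V \<inter> Piv)"
      by (simp add: image_image)
    then show ?thesis unfolding chi by (simp add: image_image)
  qed
  \<comment> \<open>The common value \<open>k\<close> is only known as a real number, while the leaf
    numbers are natural.\<close>
  moreover have "\<forall>n\<in>fst ` set qs. n = nat \<lfloor>k\<rfloor>" if "\<forall>q\<in>B.V \<inter> Piv. finite_index.chi B.V q = k" for k
  proof -
    have "\<forall>x\<in>real ` fst ` set qs. x = k" unfolding chi(2)[symmetric] using that by blast
    then show ?thesis by auto
  qed
  ultimately show ?thesis
    using commensurable_imp[OF A.induced A.good_V B.induced B.good_V _ A.V_Piv_nonempty] comm chi(1)
    unfolding tree_RAAG_def by metis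
qed

lemma tree_without_hair_one:
  assumes "length ns \<ge> 2" "\<forall>n\<in>set ns. n > 0"
  shows "tree_without_hair (map (\<lambda>n. (n, 1)) ns)"
proof
  let ?P = "{(0::nat, 0::nat), (1, 0)}"
  have len: "0 < length ns" "1 < length ns" using assms by linarith+
  show "\<exists>P. P \<subseteq> {(i, a). i < length (map (\<lambda>n. (n, 1::nat)) ns) \<and> a < snd (map (\<lambda>n. (n, 1::nat)) ns ! i)} \<and> card P = 2"
    by (rule exI[of _ ?P]) (use len in \<open>auto simp: nth_map\<close>)
qed (use assms in auto)

lemma strict_sorted_constant:
  assumes "sorted_wrt (<) (ns::nat list)" "length ns \<ge> 2" shows "\<not> (\<forall>n\<in>set ns. n = k)"
proof
  assume "\<forall>n\<in>set ns. n = k"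
  moreover have len: "0 < length ns" "1 < length ns" using assms by linarith+
  ultimately have "ns ! 0 = k" "ns ! 1 = k" by (metis nth_mem)+
  moreover have "ns ! 0 < ns ! 1" by (rule sorted_wrt_nth_less[OF assms(1)]) (use len in auto)
  ultimately show False by simp
qed

theorem mainTheorem4:
  fixes ms ns :: "nat list"
  assumes "length ms \<ge> 2" and "length ns \<ge> 2"
    and "sorted_wrt (<) ms" and "sorted_wrt (<) ns"
    and "\<forall>m\<in>set ms. m > 0" and "\<forall>n\<in>set ns. n > 0"
  shows "(commensurable (tree_RAAG (map (\<lambda>m. (m, 1)) ms) 0)
                        (tree_RAAG (map (\<lambda>n. (n, 1)) ns) 0)
            \<longrightarrow> length ms = length ns \<and>
                (\<forall>i < length ms. real (ns ! i) / real (ms ! i) = real (ns ! 0) / real (ms ! 0)))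
         \<and> (\<forall>m::nat. m \<ge> 2 \<longrightarrow>
              \<not> commensurable (tree_RAAG [(m, 2)] 0) (tree_RAAG (map (\<lambda>n. (n, 1)) ns) 0))"
proof (intro conjI impI allI notI)
  assume comm: "commensurable (tree_RAAG (map (\<lambda>m. (m, 1)) ms) 0) (tree_RAAG (map (\<lambda>n. (n, 1)) ns) 0)"
  have "(\<exists>r>0. real ` fst ` set (map (\<lambda>m. (m, 1::nat)) ms) = (\<lambda>n. r * real n) ` fst ` set (map (\<lambda>n. (n, 1::nat)) ns)) \<or>
      (\<exists>k. \<forall>n\<in>fst ` set (map (\<lambda>n. (n, 1::nat)) ns). n = k)"
    by (rule commensurable_trees) (use assms comm tree_without_hair_one in auto)
  then have "(\<exists>r>0. real ` set ms = (\<lambda>n. r * real n) ` set ns) \<or> (\<exists>k. \<forall>n\<in>set ns. n = k)"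
    by (simp add: image_image)
  then obtain r where r: "r > 0" "real ` set ms = (\<lambda>n. r * real n) ` set ns"
    using strict_sorted_constant[OF assms(4,2)] by blast
  have "sorted_wrt (<) (map real ms)" "sorted_wrt (<) (map (\<lambda>n. r * real n) ns)"
    using assms(3,4) r(1) by (simp_all add: sorted_wrt_map)
  \<comment> \<open>Two strictly increasing lists with the same elements are equal, and scaling by
    \<open>r > 0\<close> keeps the order; so equality of sets gives both the length and the
    ratios.\<close>
  then have eq: "map real ms = map (\<lambda>n. r * real n) ns"
    using r(2) by (intro strict_sorted_equal) auto
  then show "length ms = length ns" by (metis length_map)
  fix i assume "i < length ms"
  have ratio: "real (ns ! i) / real (ms ! i) = 1 / r" if "i < length ms" for i
  proof -
    have "i < length ns" using that \<open>length ms = length ns\<close> by simp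
    then have "real (ms ! i) = r * real (ns ! i)" using that eq by (metis nth_map)
    moreover have "0 < ns ! i" using \<open>i < length ns\<close> assms(6) by simp
    ultimately show ?thesis using r(1) by simp
  qed
  show "real (ns ! i) / real (ms ! i) = real (ns ! 0) / real (ms ! 0)"
  proof -
    have "0 < length ms" using assms(1) by linarith
    then show ?thesis using ratio[OF \<open>i < length ms\<close>] ratio by simp
  qed
next
  fix m :: nat assume m: "m \<ge> 2"
    and comm: "commensurable (tree_RAAG [(m, 2)] 0) (tree_RAAG (map (\<lambda>n. (n, 1)) ns) 0)"
  have "tree_without_hair [(m, 2)]"
  proof
    show "\<exists>P. P \<subseteq> {(i, a). i < length [(m, 2::nat)] \<and> a < snd ([(m, 2::nat)] ! i)} \<and> card P = 2"
      by (rule exI[of _ "{(0, 0), (0, 1)}"]) auto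
  qed (use m in auto)
  then have "(\<exists>r>0. real ` fst ` set [(m, 2::nat)] = (\<lambda>n. r * real n) ` fst ` set (map (\<lambda>n. (n, 1::nat)) ns)) \<or>
      (\<exists>k. \<forall>n\<in>fst ` set (map (\<lambda>n. (n, 1::nat)) ns). n = k)"
    by (rule commensurable_trees) (use assms comm tree_without_hair_one in auto)
  then have "(\<exists>r>0. {real m} = (\<lambda>n. r * real n) ` set ns) \<or> (\<exists>k. \<forall>n\<in>set ns. n = k)"
    by (simp add: image_image)
  then obtain r where r: "r > 0" "{real m} = (\<lambda>n. r * real n) ` set ns"
    using strict_sorted_constant[OF assms(4,2)] by blast
  \<comment> \<open>A tree with a single leaf number would force all entries of \<open>ns\<close> to
    equal \<open>real m / r\<close>, contrary to their strict increase.\<close>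
  have "r * real n = real m" if "n \<in> set ns" for n using r(2) that by blast
  then have "n = nat \<lfloor>real m / r\<rfloor>" if "n \<in> set ns" for n
  proof -
    have "real m / r = real n" using \<open>\<And>n. n \<in> set ns \<Longrightarrow> r * real n = real m\<close>[OF that] r(1) by (simp add: field_simps)
    then show ?thesis by simp
  qed
  then show False using strict_sorted_constant[OF assms(4,2)] by blast
qed

end
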